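(* Let $R$ be a unital ring and $L=R[x_1^{\pm1},x_2^{\pm1},\dots,x_n^{\pm1}]$. Suppose $D$ is a bounded cochain complex of projective $L$-modules, and suppose further that $D$ is $R$-finitely dominated. Then the induced cochain complex $D\otimes_L R(\!(x_1,x_2,\dots,x_n)\!)$ is acyclic, and thus contractible.
   Context: Modules are right modules. A cochain complex of $L$-modules is called $R$-finitely dominated if, as a complex of $R$-modules, it is homotopy equivalent to a bounded complex of finitely generated projective $R$-modules. For a formal Laurent series $f=\sum_{\mathbf a\in\mathbb Z^n}r_{\mathbf a}\mathbf x^{\mathbf a}$ with $r_{\mathbf a}\in R$ the support is $\mathrm{supp}(f)=\{\mathbf a\in\mathbb Z^n\mid r_{\mathbf a}\ne0\}$. With $\mathbf 1=(1,1,\dots,1)$ and $\mathbb N=\{0,1,2,\dots\}$, the Novikov ring is $$R(\!(x_1,\dots,x_n)\!)=\{f\mid\exists k\in\mathbb N:\ k\mathbf 1+\mathrm{supp}(f)\subseteq\mathbb N^n\}=R[[x_1,\dots,x_n]]\big[1/(x_1x_2\cdots x_n)\big],$$ with the usual multiplication of series; it contains $L$ as a subring. *)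

theory Defs
  imports
    "HOL-Algebra.Module"
    "HOL-Algebra.Free_Abelian_Groups"
    "HOL-Analysis.Finite_Cartesian_Product"
begin

section \<open>Right modules over a unital ring\<close>

text \<open>
  The ring need not be commutative. We reuse the record of the library's modules, whose fields
  \<open>mult\<close> and \<open>one\<close> are irrelevant; \<open>a \<odot>\<^bsub>M\<^esub> x\<close> stands for the right action \<open>x \<cdot> a\<close>,
  so \<open>x \<cdot> (a b) = (x \<cdot> a) \<cdot> b\<close> reads as in \<open>smult_assoc\<close>.
\<close>

locale right_module = R?: ring R + M?: abelian_group M
  for R (structure) and M :: "('a, 'm, 'y) module_scheme" (structure) +
  assumes smult_closed:
      "\<lbrakk>a \<in> carrier R; x \<in> carrier M\<rbrakk> \<Longrightarrow> a \<odot>\<^bsub>M\<^esub> x \<in> carrier M"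
    and smult_l_distr:
      "\<lbrakk>a \<in> carrier R; b \<in> carrier R; x \<in> carrier M\<rbrakk> \<Longrightarrow>
       (a \<oplus>\<^bsub>R\<^esub> b) \<odot>\<^bsub>M\<^esub> x = a \<odot>\<^bsub>M\<^esub> x \<oplus>\<^bsub>M\<^esub> b \<odot>\<^bsub>M\<^esub> x"
    and smult_r_distr:
      "\<lbrakk>a \<in> carrier R; x \<in> carrier M; y \<in> carrier M\<rbrakk> \<Longrightarrow>
       a \<odot>\<^bsub>M\<^esub> (x \<oplus>\<^bsub>M\<^esub> y) = a \<odot>\<^bsub>M\<^esub> x \<oplus>\<^bsub>M\<^esub> a \<odot>\<^bsub>M\<^esub> y"
    and smult_assoc:
      "\<lbrakk>a \<in> carrier R; b \<in> carrier R; x \<in> carrier M\<rbrakk> \<Longrightarrow>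
       (a \<otimes>\<^bsub>R\<^esub> b) \<odot>\<^bsub>M\<^esub> x = b \<odot>\<^bsub>M\<^esub> (a \<odot>\<^bsub>M\<^esub> x)"
    and smult_one:
      "x \<in> carrier M \<Longrightarrow> \<one>\<^bsub>R\<^esub> \<odot>\<^bsub>M\<^esub> x = x"

definition rmod_hom ::
  "('a, 'r) ring_scheme \<Rightarrow> ('a, 'm) module \<Rightarrow> ('a, 'p) module \<Rightarrow> ('m \<Rightarrow> 'p) set" where
  "rmod_hom R M N =
     {h \<in> carrier M \<rightarrow> carrier N.
        (\<forall>x\<in>carrier M. \<forall>y\<in>carrier M. h (x \<oplus>\<^bsub>M\<^esub> y) = h x \<oplus>\<^bsub>N\<^esub> h y) \<and>
        (\<forall>a\<in>carrier R. \<forall>x\<in>carrier M. h (a \<odot>\<^bsub>M\<^esub> x) = a \<odot>\<^bsub>N\<^esub> h x)}"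

definition free_rmodule ::
  "('a, 'r) ring_scheme \<Rightarrow> 'i set \<Rightarrow> ('a, 'i \<Rightarrow> 'a) module" where
  "free_rmodule R X =
     \<lparr>carrier = {f. (\<forall>i\<in>X. f i \<in> carrier R) \<and> (\<forall>i. i \<notin> X \<longrightarrow> f i = \<zero>\<^bsub>R\<^esub>) \<and>
                   finite {i. f i \<noteq> \<zero>\<^bsub>R\<^esub>}},
      monoid.mult = undefined, one = undefined,
      ring.zero = (\<lambda>i. \<zero>\<^bsub>R\<^esub>),
      add = (\<lambda>f g i. f i \<oplus>\<^bsub>R\<^esub> g i),
      smult = (\<lambda>a f i. f i \<otimes>\<^bsub>R\<^esub> a)\<rparr>"

text \<open>
  Projective means direct summand of a free module. It is no restriction to take the basis in the
  element type of \<open>M\<close>, since the free module on \<open>carrier M\<close> always surjects onto \<open>M\<close>.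
\<close>

definition projective_rmodule :: "('a, 'r) ring_scheme \<Rightarrow> ('a, 'm) module \<Rightarrow> bool" where
  "projective_rmodule R M \<longleftrightarrow>
     right_module R M \<and>
     (\<exists>(X :: 'm set) i p.
        i \<in> rmod_hom R M (free_rmodule R X) \<and> p \<in> rmod_hom R (free_rmodule R X) M \<and>
        (\<forall>x\<in>carrier M. p (i x) = x))"

definition fg_rmodule :: "('a, 'r) ring_scheme \<Rightarrow> ('a, 'm) module \<Rightarrow> bool" where
  "fg_rmodule R M \<longleftrightarrow>
     right_module R M \<and>
     (\<exists>S. finite S \<and> S \<subseteq> carrier M \<and>
        (\<forall>x\<in>carrier M. \<exists>c\<in>S \<rightarrow> carrier R. x = (\<Oplus>\<^bsub>M\<^esub>s\<in>S. c s \<odot>\<^bsub>M\<^esub> s)))"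


section \<open>Cochain complexes\<close>

record ('a, 'm) mod_complex =
  obj :: "int \<Rightarrow> ('a, 'm) module"
  differential :: "int \<Rightarrow> 'm \<Rightarrow> 'm"

definition cochain_complex :: "('a, 'r) ring_scheme \<Rightarrow> ('a, 'm) mod_complex \<Rightarrow> bool" where
  "cochain_complex R D \<longleftrightarrow>
     (\<forall>k. right_module R (obj D k)) \<and>
     (\<forall>k. differential D k \<in> rmod_hom R (obj D k) (obj D (k + 1))) \<and>
     (\<forall>k. \<forall>x\<in>carrier (obj D k). differential D (k + 1) (differential D k x) = \<zero>\<^bsub>obj D (k + 1 + 1)\<^esub>)"

definition bounded_complex :: "('a, 'm) mod_complex \<Rightarrow> bool" where
  "bounded_complex D \<longleftrightarrow>
     (\<exists>a b. \<forall>k. k < a \<or> b < k \<longrightarrow> carrier (obj D k) = {\<zero>\<^bsub>obj D k\<^esub>})"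

definition acyclic_complex :: "('a, 'm) mod_complex \<Rightarrow> bool" where
  "acyclic_complex D \<longleftrightarrow>
     (\<forall>k. {x \<in> carrier (obj D k). differential D k x = \<zero>\<^bsub>obj D (k + 1)\<^esub>} =
          differential D (k - 1) ` carrier (obj D (k - 1)))"

definition cochain_map ::
  "('a, 'r) ring_scheme \<Rightarrow> ('a, 'm) mod_complex \<Rightarrow> ('a, 'p) mod_complex \<Rightarrow>
   (int \<Rightarrow> 'm \<Rightarrow> 'p) \<Rightarrow> bool" where
  "cochain_map R C D f \<longleftrightarrow>
     (\<forall>k. f k \<in> rmod_hom R (obj C k) (obj D k)) \<and>
     (\<forall>k. \<forall>x\<in>carrier (obj C k). f (k + 1) (differential C k x) = differential D k (f k x))"

definition cochain_homotopic ::
  "('a, 'r) ring_scheme \<Rightarrow> ('a, 'm) mod_complex \<Rightarrow> ('a, 'p) mod_complex \<Rightarrow>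
   (int \<Rightarrow> 'm \<Rightarrow> 'p) \<Rightarrow> (int \<Rightarrow> 'm \<Rightarrow> 'p) \<Rightarrow> bool" where
  "cochain_homotopic R C D f g \<longleftrightarrow>
     (\<exists>s. (\<forall>k. s k \<in> rmod_hom R (obj C k) (obj D (k - 1))) \<and>
          (\<forall>k. \<forall>x\<in>carrier (obj C k).
             f k x \<ominus>\<^bsub>obj D k\<^esub> g k x =
             differential D (k - 1) (s k x) \<oplus>\<^bsub>obj D k\<^esub> s (k + 1) (differential C k x)))"

definition homotopy_equivalent ::
  "('a, 'r) ring_scheme \<Rightarrow> ('a, 'm) mod_complex \<Rightarrow> ('a, 'p) mod_complex \<Rightarrow> bool" where
  "homotopy_equivalent R C D \<longleftrightarrow>
     (\<exists>f g. cochain_map R C D f \<and> cochain_map R D C g \<and>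
        cochain_homotopic R C C (\<lambda>k. g k \<circ> f k) (\<lambda>k. id) \<and>
        cochain_homotopic R D D (\<lambda>k. f k \<circ> g k) (\<lambda>k. id))"

definition contractible_complex :: "('a, 'r) ring_scheme \<Rightarrow> ('a, 'm) mod_complex \<Rightarrow> bool" where
  "contractible_complex R D \<longleftrightarrow>
     cochain_homotopic R D D (\<lambda>k. id) (\<lambda>k x. \<zero>\<^bsub>obj D k\<^esub>)"


section \<open>Change of rings\<close>

definition restrict_scalars :: "('a \<Rightarrow> 'b) \<Rightarrow> ('b, 'm) module \<Rightarrow> ('a, 'm) module" where
  "restrict_scalars \<phi> M =
     \<lparr>carrier = carrier M, monoid.mult = (\<otimes>\<^bsub>M\<^esub>), one = \<one>\<^bsub>M\<^esub>,
      ring.zero = \<zero>\<^bsub>M\<^esub>, add = (\<oplus>\<^bsub>M\<^esub>),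
      smult = (\<lambda>a x. \<phi> a \<odot>\<^bsub>M\<^esub> x)\<rparr>"

definition restrict_complex :: "('a \<Rightarrow> 'b) \<Rightarrow> ('b, 'm) mod_complex \<Rightarrow> ('a, 'm) mod_complex" where
  "restrict_complex \<phi> D = \<lparr>obj = (\<lambda>k. restrict_scalars \<phi> (obj D k)), differential = differential D\<rparr>"

text \<open>
  For a ring homomorphism \<open>\<phi> : A \<rightarrow> S\<close> and a right \<open>A\<close>-module \<open>M\<close>, the tensor product of \<open>M\<close> and
  \<open>S\<close> over \<open>A\<close> is the quotient of the free Abelian group on \<open>M \<times> S\<close> by the subgroup generated by
  the balanced bilinearity relations. Its elements are cosets, and a map given on representatives
  acts on a coset as the union of the cosets of the images of its elements.
\<close>

definition tensor_gens ::
  "('a, 'm) module \<Rightarrow> ('s, 't) ring_scheme \<Rightarrow> ('m \<times> 's \<Rightarrow>\<^sub>0 int) monoid" where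
  "tensor_gens M S = free_Abelian_group (carrier M \<times> carrier S)"

definition tensor_rels ::
  "('a, 'r) ring_scheme \<Rightarrow> ('s, 't) ring_scheme \<Rightarrow> ('a \<Rightarrow> 's) \<Rightarrow> ('a, 'm) module \<Rightarrow>
   ('m \<times> 's \<Rightarrow>\<^sub>0 int) set" where
  "tensor_rels A S \<phi> M =
     {frag_of (x \<oplus>\<^bsub>M\<^esub> y, s) - frag_of (x, s) - frag_of (y, s) | x y s.
        x \<in> carrier M \<and> y \<in> carrier M \<and> s \<in> carrier S} \<union>
     {frag_of (x, s \<oplus>\<^bsub>S\<^esub> t) - frag_of (x, s) - frag_of (x, t) | x s t.
        x \<in> carrier M \<and> s \<in> carrier S \<and> t \<in> carrier S} \<union>
     {frag_of (a \<odot>\<^bsub>M\<^esub> x, s) - frag_of (x, \<phi> a \<otimes>\<^bsub>S\<^esub> s) | a x s.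
        a \<in> carrier A \<and> x \<in> carrier M \<and> s \<in> carrier S}"

definition tensor_null ::
  "('a, 'r) ring_scheme \<Rightarrow> ('s, 't) ring_scheme \<Rightarrow> ('a \<Rightarrow> 's) \<Rightarrow> ('a, 'm) module \<Rightarrow>
   ('m \<times> 's \<Rightarrow>\<^sub>0 int) set" where
  "tensor_null A S \<phi> M = generate (tensor_gens M S) (tensor_rels A S \<phi> M)"

definition extend_scalars ::
  "('a, 'r) ring_scheme \<Rightarrow> ('s, 't) ring_scheme \<Rightarrow> ('a \<Rightarrow> 's) \<Rightarrow> ('a, 'm) module \<Rightarrow>
   ('s, ('m \<times> 's \<Rightarrow>\<^sub>0 int) set) module" where
  "extend_scalars A S \<phi> M =
     (let F = tensor_gens M S; H = tensor_null A S \<phi> M; Q = F Mod H in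
      \<lparr>carrier = carrier Q, monoid.mult = undefined, one = undefined,
       ring.zero = \<one>\<^bsub>Q\<^esub>, add = (\<otimes>\<^bsub>Q\<^esub>),
       smult = (\<lambda>t U. \<Union>u\<in>U. H #>\<^bsub>F\<^esub> frag_extend (\<lambda>(x, s). frag_of (x, s \<otimes>\<^bsub>S\<^esub> t)) u)\<rparr>)"

definition extend_map ::
  "('a, 'r) ring_scheme \<Rightarrow> ('s, 't) ring_scheme \<Rightarrow> ('a \<Rightarrow> 's) \<Rightarrow> ('a, 'p) module \<Rightarrow>
   ('m \<Rightarrow> 'p) \<Rightarrow> ('m \<times> 's \<Rightarrow>\<^sub>0 int) set \<Rightarrow> ('p \<times> 's \<Rightarrow>\<^sub>0 int) set" where
  "extend_map A S \<phi> N h U =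
     (\<Union>u\<in>U. tensor_null A S \<phi> N #>\<^bsub>tensor_gens N S\<^esub>
               frag_extend (\<lambda>(x, s). frag_of (h x, s)) u)"

definition extend_complex ::
  "('a, 'r) ring_scheme \<Rightarrow> ('s, 't) ring_scheme \<Rightarrow> ('a \<Rightarrow> 's) \<Rightarrow> ('a, 'm) mod_complex \<Rightarrow>
   ('s, ('m \<times> 's \<Rightarrow>\<^sub>0 int) set) mod_complex" where
  "extend_complex A S \<phi> D =
     \<lparr>obj = (\<lambda>k. extend_scalars A S \<phi> (obj D k)),
      differential = (\<lambda>k. extend_map A S \<phi> (obj D (k + 1)) (differential D k))\<rparr>"


section \<open>Laurent polynomials and Novikov rings\<close>

text \<open>
  A formal Laurent series in the variables indexed by \<open>'n\<close> is its coefficient function on exponent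
  vectors. The convolution sum only ranges over the nonzero terms; this set is finite for any two
  elements of the Novikov ring.
\<close>

definition supp :: "('a, 'r) ring_scheme \<Rightarrow> (int ^ 'n \<Rightarrow> 'a) \<Rightarrow> (int ^ 'n) set" where
  "supp R f = {a. f a \<noteq> \<zero>\<^bsub>R\<^esub>}"

definition novikov_ring :: "('a, 'r) ring_scheme \<Rightarrow> (int ^ 'n \<Rightarrow> 'a) ring" where
  "novikov_ring R =
     \<lparr>carrier = {f. range f \<subseteq> carrier R \<and>
                   (\<exists>k::nat. \<forall>a\<in>supp R f. \<forall>i. 0 \<le> int k + a $ i)},
      monoid.mult = (\<lambda>f g a. \<Oplus>\<^bsub>R\<^esub>b\<in>{b. b \<in> supp R f \<and> a - b \<in> supp R g}. f b \<otimes>\<^bsub>R\<^esub> g (a - b)),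
      one = (\<lambda>a. if a = 0 then \<one>\<^bsub>R\<^esub> else \<zero>\<^bsub>R\<^esub>),
      ring.zero = (\<lambda>a. \<zero>\<^bsub>R\<^esub>),
      add = (\<lambda>f g a. f a \<oplus>\<^bsub>R\<^esub> g a)\<rparr>"

definition laurent_ring :: "('a, 'r) ring_scheme \<Rightarrow> (int ^ 'n \<Rightarrow> 'a) ring" where
  "laurent_ring R =
     (novikov_ring R)\<lparr>carrier := {f. range f \<subseteq> carrier R \<and> finite (supp R f)}\<rparr>"

definition laurent_const :: "('a, 'r) ring_scheme \<Rightarrow> 'a \<Rightarrow> (int ^ 'n \<Rightarrow> 'a)" where
  "laurent_const R r = (\<lambda>a. if a = 0 then r else \<zero>\<^bsub>R\<^esub>)"

text \<open>
  The type argument is the element type of the complex of finitely generated projective modules;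
  a statement assuming this for an arbitrary type \<open>'c\<close> covers all such complexes.
\<close>

definition finitely_dominated ::
  "'c itself \<Rightarrow> ('a, 'r) ring_scheme \<Rightarrow> (int ^ 'n \<Rightarrow> 'a, 'm) mod_complex \<Rightarrow> bool" where
  "finitely_dominated (_ :: 'c itself) R D \<longleftrightarrow>
     (\<exists>C :: ('a, 'c) mod_complex.
        cochain_complex R C \<and> bounded_complex C \<and>
        (\<forall>k. fg_rmodule R (obj C k) \<and> projective_rmodule R (obj C k)) \<and>
        homotopy_equivalent R (restrict_complex (laurent_const R) D) C)"

definition novikov_complex ::
  "('a, 'r) ring_scheme \<Rightarrow> (int ^ 'n \<Rightarrow> 'a, 'm) mod_complex \<Rightarrow>
   (int ^ 'n \<Rightarrow> 'a, ('m \<times> (int ^ 'n \<Rightarrow> 'a) \<Rightarrow>\<^sub>0 int) set) mod_complex" where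
  "novikov_complex R D = extend_complex (laurent_ring R) (novikov_ring R) (\<lambda>f. f) D"

end

theory Submission
  imports Defs "HOL-Algebra.Subrings"
begin

text \<open>
  Fix a variable \<open>x\<close> among \<open>x\<^sub>1, \<dots>, x\<^sub>n\<close>, let \<open>X\<close> be its action on \<open>D\<close>, an \<open>R\<close>-linear automorphism, and let
  \<open>B\<close> be the tensor product of \<open>D\<close> with \<open>R((x))\<close> over \<open>R\<close>. Let \<open>E\<close> be the image of \<open>B\<close> in the tensor
  product of \<open>D\<close> with the Novikov ring over \<open>L\<close>. As \<open>D\<close> is projective, the endomorphism \<open>\<zeta> = X - x\<close> of
  \<open>B\<close> is injective with cokernel \<open>E\<close>.

  By finite domination the identity of \<open>D\<close> is homotopic over \<open>R\<close> to a map \<open>e\<close> that factors through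
  finitely generated projective modules, so \<open>\<zeta>\<close> is homotopic to \<open>X - x e = X (1 - x X\<^sup>-\<^sup>1 e)\<close>. The second factor
  is invertible because the matrix \<open>1 - x N\<close> is invertible over \<open>R((x))\<close> for each square matrix \<open>N\<close> over \<open>R\<close>.
  Hence \<open>\<zeta>\<close> is an isomorphism on cohomology, and \<open>E\<close> is acyclic.

  The canonical map from \<open>D\<close> to its tensor product with the Novikov ring takes values in \<open>E\<close>. It is
  null-homotopic since \<open>D\<close> is bounded and projective, and a null homotopy extends to a contraction.
\<close>

section \<open>Abelian groups\<close>

context abelian_monoid
begin

lemma finsum_delta:
  assumes "finite A" "f \<in> A \<rightarrow> carrier G"
  shows "(\<Oplus>i\<in>A. if j = i then f i else \<zero>) = (if j \<in> A then f j else \<zero>)"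
proof (cases "j \<in> A")
  case True
  with assms show ?thesis by (simp add: finsum_singleton)
next
  case False
  then have "(\<Oplus>i\<in>A. if j = i then f i else \<zero>) = \<zero>"
    by (intro add.finprod_one_eqI) auto
  with False show ?thesis by simp
qed

lemma finsum_swap:
  assumes "finite A" "finite B" "\<And>a b. \<lbrakk>a \<in> A; b \<in> B\<rbrakk> \<Longrightarrow> f a b \<in> carrier G"
  shows "(\<Oplus>a\<in>A. \<Oplus>b\<in>B. f a b) = (\<Oplus>b\<in>B. \<Oplus>a\<in>A. f a b)"
  using assms(1,3)
proof (induction A rule: finite_induct)
  case (insert a A)
  have "(\<Oplus>b\<in>B. \<Oplus>a\<in>insert a A. f a b) = (\<Oplus>b\<in>B. f a b \<oplus> (\<Oplus>a\<in>A. f a b))"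
    using insert by (intro finsum_cong') (auto intro!: finsum_insert finsum_closed)
  also have "\<dots> = (\<Oplus>b\<in>B. f a b) \<oplus> (\<Oplus>b\<in>B. \<Oplus>a\<in>A. f a b)"
    using insert by (intro finsum_addf) (auto intro!: finsum_closed)
  finally show ?case
    using insert by (subst finsum_insert) (auto intro!: finsum_closed)
qed simp

lemma finsum_group:
  assumes "finite A" "\<And>x. x \<in> A \<Longrightarrow> f x \<in> carrier G"
  shows "(\<Oplus>x\<in>A. f x) = (\<Oplus>y\<in>p ` A. \<Oplus>x\<in>{x \<in> A. p x = y}. f x)"
proof -
  have "(\<Oplus>x\<in>(\<Union>y\<in>p ` A. {x \<in> A. p x = y}). f x) = (\<Oplus>y\<in>p ` A. \<Oplus>x\<in>{x \<in> A. p x = y}. f x)"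
    using assms by (intro add.finprod_UN_disjoint) (auto simp: pairwise_def disjnt_def)
  moreover have "(\<Union>y\<in>p ` A. {x \<in> A. p x = y}) = A" by auto
  ultimately show ?thesis by simp
qed

lemma finsum_Sigma:
  assumes "finite I" "\<And>i. i \<in> I \<Longrightarrow> finite (A i)" "\<And>i a. \<lbrakk>i \<in> I; a \<in> A i\<rbrakk> \<Longrightarrow> f i a \<in> carrier G"
  shows "(\<Oplus>p\<in>Sigma I A. case_prod f p) = (\<Oplus>i\<in>I. \<Oplus>a\<in>A i. f i a)"
proof -
  have "(\<Oplus>p\<in>(\<Union>i\<in>I. Pair i ` A i). case_prod f p) =
      (\<Oplus>i\<in>I. \<Oplus>p\<in>Pair i ` A i. case_prod f p)"
    using assms by (intro add.finprod_UN_disjoint) (auto simp: pairwise_def disjnt_def)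
  also have "\<dots> = (\<Oplus>i\<in>I. \<Oplus>a\<in>A i. f i a)"
    using assms by (intro finsum_cong') (auto simp: finsum_reindex inj_on_def Pi_iff intro!: finsum_closed)
  moreover have "Sigma I A = (\<Union>i\<in>I. Pair i ` A i)" by auto
  ultimately show ?thesis by simp
qed

end

context abelian_group
begin

lemma minus_eq_iff:
  "\<lbrakk>x \<in> carrier G; y \<in> carrier G; z \<in> carrier G\<rbrakk> \<Longrightarrow> x \<ominus> y = z \<longleftrightarrow> x = z \<oplus> y"
  unfolding a_minus_def by (rule add.inv_solve_right')

lemma minus_zero_right: "x \<in> carrier G \<Longrightarrow> x \<ominus> \<zero> = x"
  by (simp add: minus_eq_iff)

lemma minus_self: "x \<in> carrier G \<Longrightarrow> x \<ominus> x = \<zero>"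
  by (simp add: minus_eq_iff)

lemma minus_add_minus_swap:
  "\<lbrakk>w \<in> carrier G; x \<in> carrier G; y \<in> carrier G; z \<in> carrier G\<rbrakk> \<Longrightarrow>
   (w \<oplus> x) \<ominus> (y \<oplus> z) = (w \<ominus> y) \<oplus> (x \<ominus> z)"
  by (simp add: a_minus_def minus_add a_ac)

lemma minus_diff_minus:
  "\<lbrakk>x \<in> carrier G; y \<in> carrier G; z \<in> carrier G\<rbrakk> \<Longrightarrow> (x \<ominus> y) \<ominus> (x \<ominus> z) = z \<ominus> y"
  using minus_add_minus_swap[of x "\<ominus> y" x "\<ominus> z"]
  by (simp add: minus_self) (simp add: a_minus_def a_comm)

end

context abelian_group_hom
begin

lemma hom_minus: "\<lbrakk>x \<in> carrier G; y \<in> carrier G\<rbrakk> \<Longrightarrow> h (x \<ominus>\<^bsub>G\<^esub> y) = h x \<ominus>\<^bsub>H\<^esub> h y"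
  by (simp add: a_minus_def)

lemma inj_onI_kernel:
  assumes "\<And>x. \<lbrakk>x \<in> carrier G; h x = \<zero>\<^bsub>H\<^esub>\<rbrakk> \<Longrightarrow> x = \<zero>\<^bsub>G\<^esub>"
  shows "inj_on h (carrier G)"
  using group_hom.inj_on_one_iff[OF a_group_hom] assms by simp

lemma hom_finsum: "f \<in> I \<rightarrow> carrier G \<Longrightarrow> h (\<Oplus>\<^bsub>G\<^esub>i\<in>I. f i) = (\<Oplus>\<^bsub>H\<^esub>i\<in>I. h (f i))"
proof (induction I rule: infinite_finite_induct)
  case (insert i I)
  then show ?case
    by (simp add: Pi_iff G.finsum_insert H.finsum_insert)
qed auto

end

lemma abelian_group_homI_additive:
  assumes "abelian_group M" "abelian_group N" "\<And>x. x \<in> carrier M \<Longrightarrow> h x \<in> carrier N"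
    and "\<And>x y. \<lbrakk>x \<in> carrier M; y \<in> carrier M\<rbrakk> \<Longrightarrow> h (x \<oplus>\<^bsub>M\<^esub> y) = h x \<oplus>\<^bsub>N\<^esub> h y"
  shows "abelian_group_hom M N h"
  using assms
  by (intro abelian_group_homI group_hom.intro group_hom_axioms.intro abelian_group.a_group homI) auto

section \<open>Homomorphisms of right modules\<close>

lemma rmod_homI:
  assumes "\<And>x. x \<in> carrier M \<Longrightarrow> h x \<in> carrier N"
    and "\<And>x y. \<lbrakk>x \<in> carrier M; y \<in> carrier M\<rbrakk> \<Longrightarrow> h (x \<oplus>\<^bsub>M\<^esub> y) = h x \<oplus>\<^bsub>N\<^esub> h y"
    and "\<And>a x. \<lbrakk>a \<in> carrier R; x \<in> carrier M\<rbrakk> \<Longrightarrow> h (a \<odot>\<^bsub>M\<^esub> x) = a \<odot>\<^bsub>N\<^esub> h x"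
  shows "h \<in> rmod_hom R M N"
  using assms by (auto simp: rmod_hom_def)

lemma rmod_hom_closed: "\<lbrakk>h \<in> rmod_hom R M N; x \<in> carrier M\<rbrakk> \<Longrightarrow> h x \<in> carrier N"
  and rmod_hom_add: "\<lbrakk>h \<in> rmod_hom R M N; x \<in> carrier M; y \<in> carrier M\<rbrakk> \<Longrightarrow>
    h (x \<oplus>\<^bsub>M\<^esub> y) = h x \<oplus>\<^bsub>N\<^esub> h y"
  and rmod_hom_smult: "\<lbrakk>h \<in> rmod_hom R M N; a \<in> carrier R; x \<in> carrier M\<rbrakk> \<Longrightarrow>
    h (a \<odot>\<^bsub>M\<^esub> x) = a \<odot>\<^bsub>N\<^esub> h x"
  by (auto simp: rmod_hom_def)

lemma rmod_hom_abelian_group_hom: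
  "\<lbrakk>h \<in> rmod_hom R M N; right_module R M; right_module R N\<rbrakk> \<Longrightarrow> abelian_group_hom M N h"
  by (intro abelian_group_homI_additive) (auto simp: rmod_hom_def right_module_def)

lemma rmod_hom_map_zero:
  "\<lbrakk>h \<in> rmod_hom R M N; right_module R M; right_module R N\<rbrakk> \<Longrightarrow> h \<zero>\<^bsub>M\<^esub> = \<zero>\<^bsub>N\<^esub>"
  by (rule abelian_group_hom.hom_zero[OF rmod_hom_abelian_group_hom])

lemma rmod_hom_comp:
  "\<lbrakk>h \<in> rmod_hom R N P; g \<in> rmod_hom R M N\<rbrakk> \<Longrightarrow> (\<lambda>x. h (g x)) \<in> rmod_hom R M P"
  by (rule rmod_homI) (simp_all add: rmod_hom_closed rmod_hom_add rmod_hom_smult)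

context right_module
begin

lemma smult_abelian_group_hom: "a \<in> carrier R \<Longrightarrow> abelian_group_hom M M (\<lambda>x. a \<odot>\<^bsub>M\<^esub> x)"
  by (rule abelian_group_homI_additive)
    (simp_all add: M.abelian_group_axioms smult_closed smult_r_distr)

lemma smult_zero_left: "x \<in> carrier M \<Longrightarrow> \<zero>\<^bsub>R\<^esub> \<odot>\<^bsub>M\<^esub> x = \<zero>\<^bsub>M\<^esub>"
proof -
  assume "x \<in> carrier M"
  then interpret abelian_group_hom R M "\<lambda>a. a \<odot>\<^bsub>M\<^esub> x"
    by (intro abelian_group_homI_additive)
      (simp_all add: R.abelian_group_axioms M.abelian_group_axioms smult_closed smult_l_distr)
  show ?thesis by (rule hom_zero)
qed

lemma smult_zero_right: "a \<in> carrier R \<Longrightarrow> a \<odot>\<^bsub>M\<^esub> \<zero>\<^bsub>M\<^esub> = \<zero>\<^bsub>M\<^esub>"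
  by (rule abelian_group_hom.hom_zero[OF smult_abelian_group_hom])

lemma smult_minus:
  "\<lbrakk>a \<in> carrier R; x \<in> carrier M; y \<in> carrier M\<rbrakk> \<Longrightarrow>
   a \<odot>\<^bsub>M\<^esub> (x \<ominus>\<^bsub>M\<^esub> y) = a \<odot>\<^bsub>M\<^esub> x \<ominus>\<^bsub>M\<^esub> a \<odot>\<^bsub>M\<^esub> y"
  by (rule abelian_group_hom.hom_minus[OF smult_abelian_group_hom])

end

lemma rmod_hom_zero:
  assumes "right_module R M"
  shows "(\<lambda>x. \<zero>\<^bsub>M\<^esub>) \<in> rmod_hom R N M"
proof -
  interpret M: right_module R M by fact
  show ?thesis by (rule rmod_homI) (simp_all add: M.smult_zero_right)
qed

lemma rmod_hom_minus:
  assumes "right_module R M" "f \<in> rmod_hom R N M" "g \<in> rmod_hom R N M"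
  shows "(\<lambda>x. f x \<ominus>\<^bsub>M\<^esub> g x) \<in> rmod_hom R N M"
proof -
  interpret M: right_module R M by fact
  show ?thesis
    using assms(2,3)
    by (intro rmod_homI)
      (simp_all add: rmod_hom_closed rmod_hom_add rmod_hom_smult M.M.minus_add_minus_swap M.smult_minus)
qed

lemma rmod_hom_plus:
  assumes "right_module R M" "f \<in> rmod_hom R N M" "g \<in> rmod_hom R N M"
  shows "(\<lambda>x. f x \<oplus>\<^bsub>M\<^esub> g x) \<in> rmod_hom R N M"
proof -
  interpret M: right_module R M by fact
  show ?thesis
    using assms(2,3)
    by (intro rmod_homI)
      (simp_all add: rmod_hom_closed rmod_hom_add rmod_hom_smult M.M.a_ac M.smult_r_distr)
qed

definition regular_rmodule :: "('a, 'r) ring_scheme \<Rightarrow> ('a, 'a) module" where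
  "regular_rmodule R =
     \<lparr>carrier = carrier R, monoid.mult = (\<otimes>\<^bsub>R\<^esub>), one = \<one>\<^bsub>R\<^esub>, ring.zero = \<zero>\<^bsub>R\<^esub>, add = (\<oplus>\<^bsub>R\<^esub>),
      smult = (\<lambda>a x. x \<otimes>\<^bsub>R\<^esub> a)\<rparr>"

lemma regular_rmodule_simps [simp]:
  "carrier (regular_rmodule R) = carrier R" "\<zero>\<^bsub>regular_rmodule R\<^esub> = \<zero>\<^bsub>R\<^esub>"
  "x \<oplus>\<^bsub>regular_rmodule R\<^esub> y = x \<oplus>\<^bsub>R\<^esub> y" "a \<odot>\<^bsub>regular_rmodule R\<^esub> x = x \<otimes>\<^bsub>R\<^esub> a"
  by (simp_all add: regular_rmodule_def)

lemma (in ring) regular_rmodule_right_module: "right_module R (regular_rmodule R)"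
proof -
  have "abelian_group (regular_rmodule R)"
    by (rule abelian_groupI) (auto simp: a_ac intro: l_neg)
  then show ?thesis
    by (intro right_module.intro right_module_axioms.intro ring_axioms)
      (auto simp: l_distr r_distr m_assoc)
qed

lemma functional_abelian_group_hom:
  assumes "\<theta> \<in> rmod_hom R M (regular_rmodule R)" "right_module R M"
  shows "abelian_group_hom M R \<theta>"
proof -
  interpret right_module R M by fact
  show ?thesis
    using rmod_hom_closed[OF assms(1)] rmod_hom_add[OF assms(1)]
    by (intro abelian_group_homI_additive M.abelian_group_axioms R.abelian_group_axioms) simp_all
qed

section \<open>Projective modules\<close>

lemma free_rmodule_simps:
  "carrier (free_rmodule A X) = {f. (\<forall>i\<in>X. f i \<in> carrier A) \<and> (\<forall>i. i \<notin> X \<longrightarrow> f i = \<zero>\<^bsub>A\<^esub>) \<and>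
                   finite {i. f i \<noteq> \<zero>\<^bsub>A\<^esub>}}"
  "\<zero>\<^bsub>free_rmodule A X\<^esub> = (\<lambda>i. \<zero>\<^bsub>A\<^esub>)" "f \<oplus>\<^bsub>free_rmodule A X\<^esub> g = (\<lambda>i. f i \<oplus>\<^bsub>A\<^esub> g i)"
  "a \<odot>\<^bsub>free_rmodule A X\<^esub> f = (\<lambda>i. f i \<otimes>\<^bsub>A\<^esub> a)"
  by (simp_all add: free_rmodule_def)

definition basis_elem :: "('a, 'r) ring_scheme \<Rightarrow> 'i \<Rightarrow> 'i \<Rightarrow> 'a" where
  "basis_elem R i = (\<lambda>j. if j = i then \<one>\<^bsub>R\<^esub> else \<zero>\<^bsub>R\<^esub>)"

context ring
begin

lemma free_rmodule_closed: "f \<in> carrier (free_rmodule R X) \<Longrightarrow> f i \<in> carrier R"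
  by (cases "i \<in> X") (auto simp: free_rmodule_simps)

lemma free_rmoduleI_support:
  assumes "\<And>i. f i \<in> carrier R" "{i. f i \<noteq> \<zero>} \<subseteq> J" "finite J" "J \<subseteq> X"
  shows "f \<in> carrier (free_rmodule R X)"
  using assms by (auto simp: free_rmodule_simps intro: finite_subset)

lemma free_rmodule_right_module: "right_module R (free_rmodule R X)"
proof -
  let ?F = "free_rmodule R X"
  have add: "f \<oplus>\<^bsub>?F\<^esub> g \<in> carrier ?F" if "f \<in> carrier ?F" "g \<in> carrier ?F" for f g
    using that free_rmodule_closed[OF that(1)] free_rmodule_closed[OF that(2)]
    by (intro free_rmoduleI_support[of _ "{i. f i \<noteq> \<zero>} \<union> {i. g i \<noteq> \<zero>}"])
      (auto simp: free_rmodule_simps)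
  have smult: "a \<odot>\<^bsub>?F\<^esub> f \<in> carrier ?F" if "a \<in> carrier R" "f \<in> carrier ?F" for a f
    using that free_rmodule_closed[OF that(2)]
    by (intro free_rmoduleI_support[of _ "{i. f i \<noteq> \<zero>}"]) (auto simp: free_rmodule_simps)
  have "abelian_group ?F"
  proof (rule abelian_groupI)
    fix f assume "f \<in> carrier ?F"
    then show "\<exists>g\<in>carrier ?F. g \<oplus>\<^bsub>?F\<^esub> f = \<zero>\<^bsub>?F\<^esub>"
      using smult[of "\<ominus> \<one>" f] free_rmodule_closed[of f X]
      by (intro bexI[of _ "\<ominus> \<one> \<odot>\<^bsub>?F\<^esub> f"]) (auto simp: free_rmodule_simps r_minus l_neg)
  next
    show "\<zero>\<^bsub>?F\<^esub> \<in> carrier ?F" by (simp add: free_rmodule_simps)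
  qed (simp_all add: add, simp_all add: free_rmodule_simps(2,3) free_rmodule_closed a_ac)
  then show ?thesis
    by (intro right_module.intro right_module_axioms.intro ring_axioms)
      (simp_all add: smult, simp_all add: free_rmodule_simps(3,4) free_rmodule_closed l_distr r_distr m_assoc)
qed

lemma free_rmodule_eval_hom: "(\<lambda>f. f i) \<in> rmod_hom R (free_rmodule R X) (regular_rmodule R)"
  by (rule rmod_homI) (simp_all add: free_rmodule_closed, simp_all add: free_rmodule_simps(3,4))

lemma basis_elem_closed: "i \<in> X \<Longrightarrow> basis_elem R i \<in> carrier (free_rmodule R X)"
  by (rule free_rmoduleI_support[of _ "{i}"]) (auto simp: basis_elem_def)

lemma free_rmodule_expand:
  assumes f: "f \<in> carrier (free_rmodule R X)"
  shows "(\<Oplus>\<^bsub>free_rmodule R X\<^esub>i\<in>{i. f i \<noteq> \<zero>}. f i \<odot>\<^bsub>free_rmodule R X\<^esub> basis_elem R i) = f"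
proof
  fix j
  let ?F = "free_rmodule R X" and ?B = "{i. f i \<noteq> \<zero>}"
  interpret F: right_module R ?F by (rule free_rmodule_right_module)
  interpret eval: abelian_group_hom ?F R "\<lambda>f. f j"
    by (rule functional_abelian_group_hom[OF free_rmodule_eval_hom F.right_module_axioms])
  have B: "finite ?B" "?B \<subseteq> X" using f by (auto simp: free_rmodule_simps)
  have "(\<Oplus>\<^bsub>?F\<^esub>i\<in>?B. f i \<odot>\<^bsub>?F\<^esub> basis_elem R i) j = (\<Oplus>i\<in>?B. (f i \<odot>\<^bsub>?F\<^esub> basis_elem R i) j)"
    using B f by (intro eval.hom_finsum) (auto simp: F.smult_closed free_rmodule_closed basis_elem_closed)
  also have "\<dots> = (\<Oplus>i\<in>?B. if j = i then f i else \<zero>)"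
    using f by (intro finsum_cong') (auto simp: free_rmodule_simps(4) basis_elem_def free_rmodule_closed)
  also have "\<dots> = f j"
    using f B by (simp add: finsum_delta free_rmodule_closed Pi_iff)
  finally show "(\<Oplus>\<^bsub>?F\<^esub>i\<in>?B. f i \<odot>\<^bsub>?F\<^esub> basis_elem R i) j = f j" .
qed

end

definition expands :: "('a, 'r) ring_scheme \<Rightarrow> ('a, 'm) module \<Rightarrow> 'i set \<Rightarrow> ('i \<Rightarrow> 'm \<Rightarrow> 'a) \<Rightarrow>
    ('i \<Rightarrow> 'm) \<Rightarrow> 'm \<Rightarrow> bool" where
  "expands A M X \<theta> e x \<longleftrightarrow> (\<forall>\<^sub>F J in finite_subsets_at_top X.
     {i \<in> X. \<theta> i x \<noteq> \<zero>\<^bsub>A\<^esub>} \<subseteq> J \<and> (\<Oplus>\<^bsub>M\<^esub>i\<in>J. \<theta> i x \<odot>\<^bsub>M\<^esub> e i) = x)"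

locale dual_basis = M: right_module A M
  for A :: "('a, 'r) ring_scheme" and M :: "('a, 'm) module" +
  fixes X :: "'i set" and \<theta> :: "'i \<Rightarrow> 'm \<Rightarrow> 'a" and e :: "'i \<Rightarrow> 'm"
  assumes functional: "i \<in> X \<Longrightarrow> \<theta> i \<in> rmod_hom A M (regular_rmodule A)"
    and generator_closed: "i \<in> X \<Longrightarrow> e i \<in> carrier M"
    and finite_support: "x \<in> carrier M \<Longrightarrow> finite {i \<in> X. \<theta> i x \<noteq> \<zero>\<^bsub>A\<^esub>}"
    and expansion: "x \<in> carrier M \<Longrightarrow> (\<Oplus>\<^bsub>M\<^esub>i\<in>{i \<in> X. \<theta> i x \<noteq> \<zero>\<^bsub>A\<^esub>}. \<theta> i x \<odot>\<^bsub>M\<^esub> e i) = x"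
begin

lemma functional_hom: "i \<in> X \<Longrightarrow> abelian_group_hom M A (\<theta> i)"
  by (rule functional_abelian_group_hom[OF functional M.right_module_axioms])

lemma functional_closed: "\<lbrakk>i \<in> X; x \<in> carrier M\<rbrakk> \<Longrightarrow> \<theta> i x \<in> carrier A"
  by (rule abelian_group_hom.hom_closed[OF functional_hom])

lemma functional_add:
  "\<lbrakk>i \<in> X; x \<in> carrier M; y \<in> carrier M\<rbrakk> \<Longrightarrow> \<theta> i (x \<oplus>\<^bsub>M\<^esub> y) = \<theta> i x \<oplus>\<^bsub>A\<^esub> \<theta> i y"
  by (rule abelian_group_hom.hom_add[OF functional_hom])

lemma functional_smult:
  "\<lbrakk>i \<in> X; a \<in> carrier A; x \<in> carrier M\<rbrakk> \<Longrightarrow> \<theta> i (a \<odot>\<^bsub>M\<^esub> x) = \<theta> i x \<otimes>\<^bsub>A\<^esub> a"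
  using rmod_hom_smult[OF functional] by simp

lemma finsum_support_eq:
  assumes N: "right_module A N" and w: "w \<in> X \<rightarrow> carrier N" and x: "x \<in> carrier M"
    and J: "finite J" "J \<subseteq> X" "{i \<in> X. \<theta> i x \<noteq> \<zero>\<^bsub>A\<^esub>} \<subseteq> J"
  shows "(\<Oplus>\<^bsub>N\<^esub>i\<in>{i \<in> X. \<theta> i x \<noteq> \<zero>\<^bsub>A\<^esub>}. \<theta> i x \<odot>\<^bsub>N\<^esub> w i) = (\<Oplus>\<^bsub>N\<^esub>i\<in>J. \<theta> i x \<odot>\<^bsub>N\<^esub> w i)"
proof -
  interpret N: right_module A N by (rule N)
  have wJ: "i \<in> J \<Longrightarrow> w i \<in> carrier N" for i using w J(2) by auto
  have "i \<in> J \<Longrightarrow> \<theta> i x \<in> carrier A" for i using J(2) x functional_closed by auto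
  with wJ show ?thesis
    using J by (intro N.M.add.finprod_mono_neutral_cong_left)
      (auto simp: N.smult_closed N.smult_zero_left Pi_iff)
qed

lemma expansion_superset:
  assumes "x \<in> carrier M" "finite J" "J \<subseteq> X" "{i \<in> X. \<theta> i x \<noteq> \<zero>\<^bsub>A\<^esub>} \<subseteq> J"
  shows "(\<Oplus>\<^bsub>M\<^esub>i\<in>J. \<theta> i x \<odot>\<^bsub>M\<^esub> e i) = x"
  using finsum_support_eq[OF M.right_module_axioms _ assms, of e] expansion[OF assms(1)] generator_closed
  by simp

lemma expands: "x \<in> carrier M \<Longrightarrow> expands A M X \<theta> e x"
  unfolding expands_def eventually_finite_subsets_at_top
  by (rule exI[of _ "{i \<in> X. \<theta> i x \<noteq> \<zero>\<^bsub>A\<^esub>}"]) (simp add: finite_support expansion_superset)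

lemma combination_hom:
  assumes N: "right_module A N" and w: "w \<in> X \<rightarrow> carrier N"
  shows "(\<lambda>x. \<Oplus>\<^bsub>N\<^esub>i\<in>{i \<in> X. \<theta> i x \<noteq> \<zero>\<^bsub>A\<^esub>}. \<theta> i x \<odot>\<^bsub>N\<^esub> w i) \<in> rmod_hom A M N"
    (is "?\<sigma> \<in> _")
proof -
  interpret N: right_module A N by (rule N)
  let ?supp = "\<lambda>x. {i \<in> X. \<theta> i x \<noteq> \<zero>\<^bsub>A\<^esub>}"
  have term_closed: "\<theta> i x \<odot>\<^bsub>N\<^esub> w i \<in> carrier N" if "i \<in> X" "x \<in> carrier M" for i x
    using that w by (intro N.smult_closed functional_closed) auto
  show ?thesis
  proof (rule rmod_homI)
    show "?\<sigma> x \<in> carrier N" if "x \<in> carrier M" for x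
      using term_closed that by (intro N.M.finsum_closed) auto
  next
    fix x y assume xy: "x \<in> carrier M" "y \<in> carrier M"
    let ?J = "?supp x \<union> ?supp y"
    have J: "finite ?J" "?J \<subseteq> X" using xy finite_support by auto
    have "?\<sigma> (x \<oplus>\<^bsub>M\<^esub> y) = (\<Oplus>\<^bsub>N\<^esub>i\<in>?J. \<theta> i (x \<oplus>\<^bsub>M\<^esub> y) \<odot>\<^bsub>N\<^esub> w i)"
      using xy by (intro finsum_support_eq[OF N w _ J]) (auto simp: functional_add)
    also have "\<dots> = (\<Oplus>\<^bsub>N\<^esub>i\<in>?J. \<theta> i x \<odot>\<^bsub>N\<^esub> w i \<oplus>\<^bsub>N\<^esub> \<theta> i y \<odot>\<^bsub>N\<^esub> w i)"
      using xy w term_closed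
      by (intro N.M.finsum_cong') (auto simp: functional_add functional_closed N.smult_l_distr Pi_iff)
    also have "\<dots> = (\<Oplus>\<^bsub>N\<^esub>i\<in>?J. \<theta> i x \<odot>\<^bsub>N\<^esub> w i) \<oplus>\<^bsub>N\<^esub> (\<Oplus>\<^bsub>N\<^esub>i\<in>?J. \<theta> i y \<odot>\<^bsub>N\<^esub> w i)"
      using xy term_closed by (intro N.M.finsum_addf) auto
    also have "\<dots> = ?\<sigma> x \<oplus>\<^bsub>N\<^esub> ?\<sigma> y"
      using finsum_support_eq[OF N w xy(1) J] finsum_support_eq[OF N w xy(2) J] by simp
    finally show "?\<sigma> (x \<oplus>\<^bsub>M\<^esub> y) = ?\<sigma> x \<oplus>\<^bsub>N\<^esub> ?\<sigma> y" .
  next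
    fix a x assume ax: "a \<in> carrier A" "x \<in> carrier M"
    interpret a: abelian_group_hom N N "\<lambda>y. a \<odot>\<^bsub>N\<^esub> y"
      by (rule N.smult_abelian_group_hom[OF ax(1)])
    have "?\<sigma> (a \<odot>\<^bsub>M\<^esub> x) = (\<Oplus>\<^bsub>N\<^esub>i\<in>?supp x. \<theta> i (a \<odot>\<^bsub>M\<^esub> x) \<odot>\<^bsub>N\<^esub> w i)"
      using ax by (intro finsum_support_eq[OF N w])
        (auto simp: functional_smult M.smult_closed finite_support)
    also have "\<dots> = (\<Oplus>\<^bsub>N\<^esub>i\<in>?supp x. a \<odot>\<^bsub>N\<^esub> (\<theta> i x \<odot>\<^bsub>N\<^esub> w i))"
      using ax w term_closed
      by (intro N.M.finsum_cong')
        (auto simp: functional_smult functional_closed N.smult_assoc N.smult_closed Pi_iff)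
    also have "\<dots> = a \<odot>\<^bsub>N\<^esub> ?\<sigma> x"
      using ax term_closed by (intro a.hom_finsum[symmetric]) auto
    finally show "?\<sigma> (a \<odot>\<^bsub>M\<^esub> x) = a \<odot>\<^bsub>N\<^esub> ?\<sigma> x" .
  qed
qed

lemma lift_along:
  assumes N: "right_module A N" and N': "right_module A N'"
    and d: "d \<in> rmod_hom A N N'" and f: "f \<in> rmod_hom A M N'"
    and range: "f ` carrier M \<subseteq> d ` carrier N"
  shows "\<exists>\<sigma>\<in>rmod_hom A M N. \<forall>x\<in>carrier M. d (\<sigma> x) = f x"
proof -
  interpret N: right_module A N by (rule N)
  interpret N': right_module A N' by (rule N')
  interpret d: abelian_group_hom N N' d by (rule rmod_hom_abelian_group_hom[OF d N N'])
  interpret f: abelian_group_hom M N' f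
    by (rule rmod_hom_abelian_group_hom[OF f M.right_module_axioms N'])
  have "\<exists>w. w \<in> carrier N \<and> d w = f (e i)" if "i \<in> X" for i
    using range generator_closed[OF that] by (force simp: image_subset_iff)
  then obtain w where w: "\<And>i. i \<in> X \<Longrightarrow> w i \<in> carrier N" "\<And>i. i \<in> X \<Longrightarrow> d (w i) = f (e i)"
    by metis
  let ?supp = "\<lambda>x. {i \<in> X. \<theta> i x \<noteq> \<zero>\<^bsub>A\<^esub>}"
  let ?\<sigma> = "\<lambda>x. \<Oplus>\<^bsub>N\<^esub>i\<in>?supp x. \<theta> i x \<odot>\<^bsub>N\<^esub> w i"
  have "d (?\<sigma> x) = f x" if x: "x \<in> carrier M" for x
  proof -
    have "d (?\<sigma> x) = (\<Oplus>\<^bsub>N'\<^esub>i\<in>?supp x. d (\<theta> i x \<odot>\<^bsub>N\<^esub> w i))"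
      using x w(1) by (intro d.hom_finsum) (auto simp: functional_closed N.smult_closed)
    also have "\<dots> = (\<Oplus>\<^bsub>N'\<^esub>i\<in>?supp x. f (\<theta> i x \<odot>\<^bsub>M\<^esub> e i))"
      using x w by (intro N'.M.finsum_cong')
        (auto simp: functional_closed generator_closed N'.smult_closed
          rmod_hom_smult[OF d] rmod_hom_smult[OF f])
    also have "\<dots> = f (\<Oplus>\<^bsub>M\<^esub>i\<in>?supp x. \<theta> i x \<odot>\<^bsub>M\<^esub> e i)"
      using x by (intro f.hom_finsum[symmetric]) (auto simp: functional_closed generator_closed M.smult_closed)
    finally show ?thesis by (simp add: expansion[OF x])
  qed
  moreover have "?\<sigma> \<in> rmod_hom A M N"
    by (rule combination_hom[OF N]) (use w(1) in auto)
  ultimately show ?thesis by (intro bexI[of _ ?\<sigma>] ballI)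
qed

lemma finite_if_fg:
  assumes "fg_rmodule A M"
  shows "\<exists>I\<subseteq>X. finite I \<and> dual_basis A M I \<theta> e"
proof -
  obtain S where S: "finite S" "S \<subseteq> carrier M"
    and span: "\<And>x. x \<in> carrier M \<Longrightarrow> \<exists>c\<in>S \<rightarrow> carrier A. x = (\<Oplus>\<^bsub>M\<^esub>s\<in>S. c s \<odot>\<^bsub>M\<^esub> s)"
    using assms by (auto simp: fg_rmodule_def)
  define I where "I = (\<Union>s\<in>S. {i \<in> X. \<theta> i s \<noteq> \<zero>\<^bsub>A\<^esub>})"
  have I: "finite I" "I \<subseteq> X" using S finite_support by (auto simp: I_def)
  have supp: "{i \<in> X. \<theta> i x \<noteq> \<zero>\<^bsub>A\<^esub>} \<subseteq> I" if x: "x \<in> carrier M" for x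
  proof (intro subsetI, rule ccontr)
    fix i assume i: "i \<in> {i \<in> X. \<theta> i x \<noteq> \<zero>\<^bsub>A\<^esub>}" "i \<notin> I"
    obtain c where c: "c \<in> S \<rightarrow> carrier A" "x = (\<Oplus>\<^bsub>M\<^esub>s\<in>S. c s \<odot>\<^bsub>M\<^esub> s)"
      using span[OF x] by blast
    have "\<theta> i x = (\<Oplus>\<^bsub>A\<^esub>s\<in>S. \<theta> i (c s \<odot>\<^bsub>M\<^esub> s))"
      unfolding c(2) using i c(1) S by (intro abelian_group_hom.hom_finsum[OF functional_hom])
        (auto simp: M.smult_closed Pi_iff)
    also have "\<dots> = \<zero>\<^bsub>A\<^esub>"
      using i c(1) S by (intro M.R.add.finprod_one_eqI)
        (auto simp: functional_smult I_def Pi_iff)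
    finally show False using i by blast
  qed
  have "dual_basis A M I \<theta> e"
  proof unfold_locales
    show "(\<Oplus>\<^bsub>M\<^esub>i\<in>{i \<in> I. \<theta> i x \<noteq> \<zero>\<^bsub>A\<^esub>}. \<theta> i x \<odot>\<^bsub>M\<^esub> e i) = x" if "x \<in> carrier M" for x
      using that I supp[OF that] by (intro expansion_superset) auto
  qed (use I functional generator_closed in auto)
  then show ?thesis using I by blast
qed

end

lemma expands_add:
  assumes "right_module A M" and functional: "\<And>i. i \<in> X \<Longrightarrow> \<theta> i \<in> rmod_hom A M (regular_rmodule A)"
    and generator: "\<And>i. i \<in> X \<Longrightarrow> e i \<in> carrier M"
    and xy: "x \<in> carrier M" "y \<in> carrier M" "expands A M X \<theta> e x" "expands A M X \<theta> e y"
  shows "expands A M X \<theta> e (x \<oplus>\<^bsub>M\<^esub> y)"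
proof -
  interpret M: right_module A M by fact
  have \<theta>: "\<theta> i x \<in> carrier A" "\<theta> i y \<in> carrier A" "\<theta> i (x \<oplus>\<^bsub>M\<^esub> y) = \<theta> i x \<oplus>\<^bsub>A\<^esub> \<theta> i y" if "i \<in> X" for i
    using rmod_hom_closed[OF functional[OF that]] rmod_hom_add[OF functional[OF that]] xy(1,2) by simp_all
  have "\<forall>\<^sub>F J in finite_subsets_at_top X. J \<subseteq> X"
    by (rule eventually_finite_subsets_at_top_weakI)
  with xy(3,4)[unfolded expands_def] show ?thesis
    unfolding expands_def
  proof eventually_elim
    case (elim J)
    then have in_X: "i \<in> X" if "i \<in> J" for i using that by blast
    have "(\<Oplus>\<^bsub>M\<^esub>i\<in>J. \<theta> i (x \<oplus>\<^bsub>M\<^esub> y) \<odot>\<^bsub>M\<^esub> e i) = (\<Oplus>\<^bsub>M\<^esub>i\<in>J. \<theta> i x \<odot>\<^bsub>M\<^esub> e i \<oplus>\<^bsub>M\<^esub> \<theta> i y \<odot>\<^bsub>M\<^esub> e i)"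
      by (rule M.M.finsum_cong') (simp_all add: \<theta> in_X generator M.smult_l_distr M.smult_closed)
    also have "\<dots> = (\<Oplus>\<^bsub>M\<^esub>i\<in>J. \<theta> i x \<odot>\<^bsub>M\<^esub> e i) \<oplus>\<^bsub>M\<^esub> (\<Oplus>\<^bsub>M\<^esub>i\<in>J. \<theta> i y \<odot>\<^bsub>M\<^esub> e i)"
      by (rule M.M.finsum_addf) (simp_all add: \<theta> in_X generator M.smult_closed)
    finally have "(\<Oplus>\<^bsub>M\<^esub>i\<in>J. \<theta> i (x \<oplus>\<^bsub>M\<^esub> y) \<odot>\<^bsub>M\<^esub> e i) = x \<oplus>\<^bsub>M\<^esub> y" using elim by simp
    moreover have "i \<in> J" if i: "i \<in> X" "\<theta> i (x \<oplus>\<^bsub>M\<^esub> y) \<noteq> \<zero>\<^bsub>A\<^esub>" for i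
    proof (rule ccontr)
      assume "i \<notin> J"
      then have "\<theta> i x = \<zero>\<^bsub>A\<^esub>" "\<theta> i y = \<zero>\<^bsub>A\<^esub>" using elim i(1) by blast+
      then show False using i \<theta>(3)[OF i(1)] by simp
    qed
    ultimately show ?case by blast
  qed
qed

lemma dual_basisI_expands:
  assumes "right_module A M" and functional: "\<And>i. i \<in> X \<Longrightarrow> \<theta> i \<in> rmod_hom A M (regular_rmodule A)"
    and generator: "\<And>i. i \<in> X \<Longrightarrow> e i \<in> carrier M"
    and expands: "\<And>x. x \<in> carrier M \<Longrightarrow> expands A M X \<theta> e x"
  shows "dual_basis A M X \<theta> e"
proof -
  interpret M: right_module A M by fact
  have "finite {i \<in> X. \<theta> i x \<noteq> \<zero>\<^bsub>A\<^esub>}"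
    and "(\<Oplus>\<^bsub>M\<^esub>i\<in>{i \<in> X. \<theta> i x \<noteq> \<zero>\<^bsub>A\<^esub>}. \<theta> i x \<odot>\<^bsub>M\<^esub> e i) = x" if x: "x \<in> carrier M" for x
  proof -
    from expands[OF x] obtain J where J: "finite J" "J \<subseteq> X"
      and large: "\<forall>Y. finite Y \<and> J \<subseteq> Y \<and> Y \<subseteq> X \<longrightarrow>
        {i \<in> X. \<theta> i x \<noteq> \<zero>\<^bsub>A\<^esub>} \<subseteq> Y \<and> (\<Oplus>\<^bsub>M\<^esub>i\<in>Y. \<theta> i x \<odot>\<^bsub>M\<^esub> e i) = x"
      unfolding expands_def eventually_finite_subsets_at_top by (elim exE conjE) (rule that)
    then have supp: "{i \<in> X. \<theta> i x \<noteq> \<zero>\<^bsub>A\<^esub>} \<subseteq> J" and sum: "(\<Oplus>\<^bsub>M\<^esub>i\<in>J. \<theta> i x \<odot>\<^bsub>M\<^esub> e i) = x"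
      using large[rule_format, of J] by simp_all
    show "finite {i \<in> X. \<theta> i x \<noteq> \<zero>\<^bsub>A\<^esub>}" by (rule finite_subset[OF supp J(1)])
    have "e i \<in> carrier M" "\<theta> i x \<in> carrier A" if "i \<in> J" for i
      using that J(2) generator rmod_hom_closed[OF functional x] by auto
    then have "(\<Oplus>\<^bsub>M\<^esub>i\<in>{i \<in> X. \<theta> i x \<noteq> \<zero>\<^bsub>A\<^esub>}. \<theta> i x \<odot>\<^bsub>M\<^esub> e i) = (\<Oplus>\<^bsub>M\<^esub>i\<in>J. \<theta> i x \<odot>\<^bsub>M\<^esub> e i)"
      using J supp by (intro M.M.add.finprod_mono_neutral_cong_left)
        (auto simp: M.smult_closed M.smult_zero_left)
    then show "(\<Oplus>\<^bsub>M\<^esub>i\<in>{i \<in> X. \<theta> i x \<noteq> \<zero>\<^bsub>A\<^esub>}. \<theta> i x \<odot>\<^bsub>M\<^esub> e i) = x" by (simp add: sum)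
  qed
  then show ?thesis
    using functional generator by unfold_locales
qed

lemma projective_rmodule_dual_basis:
  fixes M :: "('a, 'm) module"
  assumes "projective_rmodule A M"
  obtains X :: "'m set" and \<theta> e where "dual_basis A M X \<theta> e"
proof -
  obtain X :: "'m set" and \<iota> p where M: "right_module A M" and emb: "\<iota> \<in> rmod_hom A M (free_rmodule A X)"
    and proj: "p \<in> rmod_hom A (free_rmodule A X) M" and proj_emb: "\<And>x. x \<in> carrier M \<Longrightarrow> p (\<iota> x) = x"
    using assms by (auto simp: projective_rmodule_def)
  let ?F = "free_rmodule A X"
  interpret M: right_module A M by (rule M)
  interpret F: right_module A ?F by (rule M.R.free_rmodule_right_module)
  interpret p: abelian_group_hom ?F M p
    by (rule rmod_hom_abelian_group_hom[OF proj F.right_module_axioms M])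
  have coeff: "(\<lambda>x. \<iota> x i) \<in> rmod_hom A M (regular_rmodule A)" for i
    by (rule rmod_hom_comp[OF M.R.free_rmodule_eval_hom emb])
  have supp: "{i \<in> X. \<iota> x i \<noteq> \<zero>\<^bsub>A\<^esub>} = {i. \<iota> x i \<noteq> \<zero>\<^bsub>A\<^esub>}" "finite {i. \<iota> x i \<noteq> \<zero>\<^bsub>A\<^esub>}"
    if "x \<in> carrier M" for x
    using rmod_hom_closed[OF emb that] by (auto simp: free_rmodule_simps)
  have "dual_basis A M X (\<lambda>i x. \<iota> x i) (\<lambda>i. p (basis_elem A i))"
  proof unfold_locales
    fix x assume x: "x \<in> carrier M"
    have closed: "\<iota> x i \<in> carrier A" for i
      using rmod_hom_closed[OF coeff x] by simp
    have in_X: "i \<in> X" if "\<iota> x i \<noteq> \<zero>\<^bsub>A\<^esub>" for i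
      using supp(1)[OF x] that by blast
    have "x = p (\<Oplus>\<^bsub>?F\<^esub>i\<in>{i. \<iota> x i \<noteq> \<zero>\<^bsub>A\<^esub>}. \<iota> x i \<odot>\<^bsub>?F\<^esub> basis_elem A i)"
      using M.R.free_rmodule_expand[OF rmod_hom_closed[OF emb x]] proj_emb[OF x] by simp
    also have "\<dots> = (\<Oplus>\<^bsub>M\<^esub>i\<in>{i. \<iota> x i \<noteq> \<zero>\<^bsub>A\<^esub>}. p (\<iota> x i \<odot>\<^bsub>?F\<^esub> basis_elem A i))"
      using closed in_X by (intro p.hom_finsum) (auto simp: F.smult_closed M.R.basis_elem_closed)
    also have "\<dots> = (\<Oplus>\<^bsub>M\<^esub>i\<in>{i. \<iota> x i \<noteq> \<zero>\<^bsub>A\<^esub>}. \<iota> x i \<odot>\<^bsub>M\<^esub> p (basis_elem A i))"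
      using closed in_X
      by (intro M.M.finsum_cong') (auto simp: rmod_hom_smult[OF proj] M.R.basis_elem_closed M.smult_closed)
    finally show "(\<Oplus>\<^bsub>M\<^esub>i\<in>{i \<in> X. \<iota> x i \<noteq> \<zero>\<^bsub>A\<^esub>}. \<iota> x i \<odot>\<^bsub>M\<^esub> p (basis_elem A i)) = x"
      using supp[OF x] by simp
  qed (use coeff supp in \<open>auto simp: M.R.basis_elem_closed\<close>)
  then show thesis by (rule that)
qed

section \<open>Homological algebra\<close>

lemma cochain_map_hom: "cochain_map R C D f \<Longrightarrow> f k \<in> rmod_hom R (obj C k) (obj D k)"
  by (simp add: cochain_map_def)

lemma cochain_map_commute:
  "\<lbrakk>cochain_map R C D f; x \<in> carrier (obj C k)\<rbrakk> \<Longrightarrow>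
   f (k + 1) (differential C k x) = differential D k (f k x)"
  by (simp add: cochain_map_def)

lemma cochain_map_id: "cochain_map R D D (\<lambda>k x. x)"
  by (simp add: cochain_map_def rmod_homI)

lemma cochain_map_comp:
  assumes g: "cochain_map R D E g" and f: "cochain_map R C D f"
  shows "cochain_map R C E (\<lambda>k x. g k (f k x))"
  unfolding cochain_map_def
  using rmod_hom_comp[OF cochain_map_hom[OF g] cochain_map_hom[OF f]]
    cochain_map_commute[OF g rmod_hom_closed[OF cochain_map_hom[OF f]]] cochain_map_commute[OF f]
  by simp

locale cochain =
  fixes R :: "('a, 'r) ring_scheme" and D :: "('a, 'm) mod_complex"
  assumes complex: "cochain_complex R D"
begin

lemma obj_module: "right_module R (obj D k)"
  and differential_hom: "differential D k \<in> rmod_hom R (obj D k) (obj D (k + 1))"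
  and differential_differential: "x \<in> carrier (obj D k) \<Longrightarrow>
    differential D (k + 1) (differential D k x) = \<zero>\<^bsub>obj D (k + 1 + 1)\<^esub>"
  using complex by (auto simp: cochain_complex_def)

lemma differential_hom_pred: "differential D (k - 1) \<in> rmod_hom R (obj D (k - 1)) (obj D k)"
  using differential_hom[of "k - 1"] by simp

lemma differential_differential_pred:
  "x \<in> carrier (obj D (k - 1)) \<Longrightarrow> differential D k (differential D (k - 1) x) = \<zero>\<^bsub>obj D (k + 1)\<^esub>"
  using differential_differential[of x "k - 1"] by simp

lemmas differential_closed = rmod_hom_closed[OF differential_hom]
  and differential_closed_pred = rmod_hom_closed[OF differential_hom_pred]

lemma obj_abelian_group: "abelian_group (obj D k)"
  using obj_module[of k] by (simp add: right_module_def)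

lemma differential_abelian_group_hom: "abelian_group_hom (obj D k) (obj D (k + 1)) (differential D k)"
  and differential_abelian_group_hom_pred:
    "abelian_group_hom (obj D (k - 1)) (obj D k) (differential D (k - 1))"
  by (rule rmod_hom_abelian_group_hom differential_hom differential_hom_pred obj_module)+

end

lemma contractible_imp_acyclic:
  assumes "cochain_complex R D" and "contractible_complex R D"
  shows "acyclic_complex D"
  unfolding acyclic_complex_def
proof (intro allI equalityI subsetI)
  interpret cochain R D by (rule cochain.intro) fact
  obtain s where s: "\<And>k. s k \<in> rmod_hom R (obj D k) (obj D (k - 1))"
    and s_eq: "\<And>k x. x \<in> carrier (obj D k) \<Longrightarrow> x \<ominus>\<^bsub>obj D k\<^esub> \<zero>\<^bsub>obj D k\<^esub> =
      differential D (k - 1) (s k x) \<oplus>\<^bsub>obj D k\<^esub> s (k + 1) (differential D k x)"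
    using assms(2) by (auto simp: contractible_complex_def cochain_homotopic_def)
  fix k x
  interpret Dk: abelian_group "obj D k" by (rule obj_abelian_group)
  {
    assume "x \<in> {x \<in> carrier (obj D k). differential D k x = \<zero>\<^bsub>obj D (k + 1)\<^esub>}"
    then have x: "x \<in> carrier (obj D k)" and dx: "differential D k x = \<zero>\<^bsub>obj D (k + 1)\<^esub>" by auto
    have sx: "s k x \<in> carrier (obj D (k - 1))" by (rule rmod_hom_closed[OF s x])
    have "s (k + 1) \<in> rmod_hom R (obj D (k + 1)) (obj D k)" using s[of "k + 1"] by simp
    then have "s (k + 1) \<zero>\<^bsub>obj D (k + 1)\<^esub> = \<zero>\<^bsub>obj D k\<^esub>"
      by (rule rmod_hom_map_zero[OF _ obj_module obj_module])
    then have "x = differential D (k - 1) (s k x)"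
      using s_eq[OF x] x differential_closed_pred[OF sx] by (simp add: dx Dk.minus_zero_right)
    with sx show "x \<in> differential D (k - 1) ` carrier (obj D (k - 1))" by blast
  }
  {
    assume "x \<in> differential D (k - 1) ` carrier (obj D (k - 1))"
    then show "x \<in> {x \<in> carrier (obj D k). differential D k x = \<zero>\<^bsub>obj D (k + 1)\<^esub>}"
      using differential_closed_pred differential_differential_pred by auto
  }
qed

subsection \<open>Cochain maps homotopic to isomorphisms\<close>

lemma cochain_homotopic_on_cycle:
  assumes "cochain_complex R C" "cochain_complex R D" "cochain_map R C D f" "cochain_map R C D g"
    and "cochain_homotopic R C D f g"
    and c: "c \<in> carrier (obj C k)" "differential C k c = \<zero>\<^bsub>obj C (k + 1)\<^esub>"
  shows "\<exists>w\<in>carrier (obj D (k - 1)). f k c = g k c \<oplus>\<^bsub>obj D k\<^esub> differential D (k - 1) w"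
proof -
  interpret C: cochain R C by (rule cochain.intro) fact
  interpret D: cochain R D by (rule cochain.intro) fact
  interpret Dk: abelian_group "obj D k" by (rule D.obj_abelian_group)
  obtain s where s: "\<And>k. s k \<in> rmod_hom R (obj C k) (obj D (k - 1))"
    and s_eq: "\<And>k x. x \<in> carrier (obj C k) \<Longrightarrow> f k x \<ominus>\<^bsub>obj D k\<^esub> g k x =
      differential D (k - 1) (s k x) \<oplus>\<^bsub>obj D k\<^esub> s (k + 1) (differential C k x)"
    using assms(5) by (auto simp: cochain_homotopic_def)
  have fg: "f k c \<in> carrier (obj D k)" "g k c \<in> carrier (obj D k)"
    by (rule rmod_hom_closed[OF cochain_map_hom c(1)], fact)+
  have sc: "s k c \<in> carrier (obj D (k - 1))" by (rule rmod_hom_closed[OF s c(1)])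
  have "s (k + 1) \<in> rmod_hom R (obj C (k + 1)) (obj D k)" using s[of "k + 1"] by simp
  then have "s (k + 1) \<zero>\<^bsub>obj C (k + 1)\<^esub> = \<zero>\<^bsub>obj D k\<^esub>"
    by (rule rmod_hom_map_zero[OF _ C.obj_module D.obj_module])
  then have "f k c \<ominus>\<^bsub>obj D k\<^esub> g k c = differential D (k - 1) (s k c)"
    using s_eq[OF c(1)] D.differential_closed_pred[OF sc] by (simp add: c(2))
  then have "f k c = g k c \<oplus>\<^bsub>obj D k\<^esub> differential D (k - 1) (s k c)"
    using fg D.differential_closed_pred[OF sc] by (simp add: Dk.minus_eq_iff Dk.a_comm)
  with sc show ?thesis by blast
qed

lemma cycle_if_injective_image_cycle:
  assumes "cochain_complex R C" "cochain_complex R D" and h: "cochain_map R C D h"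
    and inj: "inj_on (h (k + 1)) (carrier (obj C (k + 1)))"
    and y: "y \<in> carrier (obj C k)" "differential D k (h k y) = \<zero>\<^bsub>obj D (k + 1)\<^esub>"
  shows "differential C k y = \<zero>\<^bsub>obj C (k + 1)\<^esub>"
proof -
  interpret C: cochain R C by (rule cochain.intro) fact
  interpret D: cochain R D by (rule cochain.intro) fact
  interpret Ck: abelian_group "obj C (k + 1)" by (rule C.obj_abelian_group)
  have "h (k + 1) (differential C k y) = h (k + 1) \<zero>\<^bsub>obj C (k + 1)\<^esub>"
    using cochain_map_commute[OF h y(1)] y(2)
      rmod_hom_map_zero[OF cochain_map_hom[OF h] C.obj_module D.obj_module] by simp
  then show ?thesis
    using inj C.differential_closed[OF y(1)] by (simp add: inj_on_eq_iff)
qed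

locale homotopic_to_bij = cochain R B
  for R :: "('a, 'r) ring_scheme" and B :: "('a, 'm) mod_complex" +
  fixes f g :: "int \<Rightarrow> 'm \<Rightarrow> 'm"
  assumes f: "cochain_map R B B f" and g: "cochain_map R B B g"
    and homotopic: "cochain_homotopic R B B f g"
    and bij: "bij_betw (g k) (carrier (obj B k)) (carrier (obj B k))"
begin

lemma f_hom: "abelian_group_hom (obj B k) (obj B k) (f k)"
  and g_hom: "abelian_group_hom (obj B k) (obj B k) (g k)"
  by (rule rmod_hom_abelian_group_hom[OF cochain_map_hom[OF f] obj_module obj_module]
      rmod_hom_abelian_group_hom[OF cochain_map_hom[OF g] obj_module obj_module])+

lemmas f_closed = abelian_group_hom.hom_closed[OF f_hom]
  and g_closed = abelian_group_hom.hom_closed[OF g_hom]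

lemma g_inj: "inj_on (g k) (carrier (obj B k))"
  by (rule bij_betw_imp_inj_on[OF bij])

lemma g_surj: "c \<in> carrier (obj B k) \<Longrightarrow> \<exists>v\<in>carrier (obj B k). g k v = c"
  using bij_betw_imp_surj_on[OF bij[of k]] by (metis imageE)

lemma cohomology_injective:
  assumes y: "y \<in> carrier (obj B (k + 1))" "differential B (k + 1) y = \<zero>\<^bsub>obj B (k + 1 + 1)\<^esub>"
    and x: "x \<in> carrier (obj B k)" "f (k + 1) y = differential B k x"
  shows "\<exists>v\<in>carrier (obj B k). differential B k v = y"
proof -
  interpret d: abelian_group_hom "obj B k" "obj B (k + 1)" "differential B k"
    by (rule differential_abelian_group_hom)
  obtain w where w: "w \<in> carrier (obj B k)"
    "differential B k x = g (k + 1) y \<oplus>\<^bsub>obj B (k + 1)\<^esub> differential B k w"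
    using cochain_homotopic_on_cycle[OF complex complex f g homotopic y] x(2) by auto
  obtain v where v: "v \<in> carrier (obj B k)" "g k v = x \<ominus>\<^bsub>obj B k\<^esub> w"
    using g_surj[of "x \<ominus>\<^bsub>obj B k\<^esub> w" k] x(1) w(1) by auto
  have "differential B k x \<ominus>\<^bsub>obj B (k + 1)\<^esub> differential B k w = g (k + 1) y"
    by (subst d.H.minus_eq_iff) (use w y x(1) g_closed[OF y(1)] in simp_all)
  then have "g (k + 1) (differential B k v) = g (k + 1) y"
    using cochain_map_commute[OF g v(1)] v(2) x(1) w(1) by (simp add: d.hom_minus)
  then have "differential B k v = y"
    using g_inj[of "k + 1"] y(1) differential_closed[OF v(1)] by (simp add: inj_on_eq_iff)
  with v(1) show ?thesis by blast
qed

lemma cohomology_surjective: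
  assumes c: "c \<in> carrier (obj B k)" "differential B k c = \<zero>\<^bsub>obj B (k + 1)\<^esub>"
  shows "\<exists>u\<in>carrier (obj B k). \<exists>w\<in>carrier (obj B (k - 1)).
    c = f k u \<oplus>\<^bsub>obj B k\<^esub> differential B (k - 1) w"
proof -
  interpret d: abelian_group_hom "obj B (k - 1)" "obj B k" "differential B (k - 1)"
    by (rule differential_abelian_group_hom_pred)
  obtain u where u: "u \<in> carrier (obj B k)" "g k u = c"
    using g_surj[OF c(1)] by blast
  have "differential B k u = \<zero>\<^bsub>obj B (k + 1)\<^esub>"
    by (rule cycle_if_injective_image_cycle[OF complex complex g g_inj u(1)]) (simp add: u(2) c(2))
  then obtain w where w: "w \<in> carrier (obj B (k - 1))"
    "f k u = c \<oplus>\<^bsub>obj B k\<^esub> differential B (k - 1) w"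
    using cochain_homotopic_on_cycle[OF complex complex f g homotopic u(1)] u(2) by auto
  have "f k u \<ominus>\<^bsub>obj B k\<^esub> differential B (k - 1) w = c"
    by (subst d.H.minus_eq_iff) (use c(1) w f_closed[OF u(1)] in simp_all)
  then have "c = f k u \<oplus>\<^bsub>obj B k\<^esub> differential B (k - 1) (\<ominus>\<^bsub>obj B (k - 1)\<^esub> w)"
    using w(1) by (simp add: a_minus_def)
  with u(1) w(1) show ?thesis by blast
qed

lemma cokernel_acyclic:
  assumes inj: "inj_on (f (k + 1 + 1)) (carrier (obj B (k + 1 + 1)))"
    and x: "x \<in> carrier (obj B k)" "differential B k x \<in> f (k + 1) ` carrier (obj B (k + 1))"
  shows "\<exists>v\<in>carrier (obj B k). \<exists>w\<in>carrier (obj B (k - 1)).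
    x = f k v \<oplus>\<^bsub>obj B k\<^esub> differential B (k - 1) w"
proof -
  interpret Bk: abelian_group "obj B k" by (rule obj_abelian_group)
  interpret d: abelian_group_hom "obj B k" "obj B (k + 1)" "differential B k"
    by (rule differential_abelian_group_hom)
  interpret d': abelian_group_hom "obj B (k - 1)" "obj B k" "differential B (k - 1)"
    by (rule differential_abelian_group_hom_pred)
  have f_add: "f k (v \<oplus>\<^bsub>obj B k\<^esub> u) = f k v \<oplus>\<^bsub>obj B k\<^esub> f k u"
    if "v \<in> carrier (obj B k)" "u \<in> carrier (obj B k)" for v u
    by (rule abelian_group_hom.hom_add[OF f_hom that])
  obtain y where y: "y \<in> carrier (obj B (k + 1))" "f (k + 1) y = differential B k x"
    using x(2) by auto
  have "differential B (k + 1) y = \<zero>\<^bsub>obj B (k + 1 + 1)\<^esub>"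
    by (rule cycle_if_injective_image_cycle[OF complex complex f inj y(1)])
      (simp only: y(2) differential_differential[OF x(1)])
  then obtain v where v: "v \<in> carrier (obj B k)" "differential B k v = y"
    using cohomology_injective[OF y(1) _ x(1) y(2)] by blast
  have "differential B k (x \<ominus>\<^bsub>obj B k\<^esub> f k v) = \<zero>\<^bsub>obj B (k + 1)\<^esub>"
    using cochain_map_commute[OF f v(1)] x(1) v y(2) f_closed[OF v(1)] f_closed[OF y(1)]
    by (simp add: d.hom_minus d.H.minus_self)
  then obtain u w where u: "u \<in> carrier (obj B k)" and w: "w \<in> carrier (obj B (k - 1))"
    and eq: "x \<ominus>\<^bsub>obj B k\<^esub> f k v = f k u \<oplus>\<^bsub>obj B k\<^esub> differential B (k - 1) w"
    using cohomology_surjective[of "x \<ominus>\<^bsub>obj B k\<^esub> f k v" k] x(1) f_closed[OF v(1)] by auto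
  have "x = (x \<ominus>\<^bsub>obj B k\<^esub> f k v) \<oplus>\<^bsub>obj B k\<^esub> f k v"
    using x(1) f_closed[OF v(1)] by (simp add: a_minus_def Bk.a_assoc Bk.l_neg)
  also have "\<dots> = f k (v \<oplus>\<^bsub>obj B k\<^esub> u) \<oplus>\<^bsub>obj B k\<^esub> differential B (k - 1) w"
    unfolding eq using u v(1) w f_closed by (simp add: f_add Bk.a_ac)
  finally show ?thesis using u v(1) w by (blast intro: Bk.a_closed)
qed

end

subsection \<open>Cochain maps from projective to acyclic complexes\<close>

lemma ex_int_downward_recursion:
  fixes B :: int
  assumes base: "\<And>k. B \<le> k \<Longrightarrow> P k (z k)"
    and step: "\<And>k y. \<lbrakk>k < B; P (k + 1) y\<rbrakk> \<Longrightarrow> \<exists>x. P k x \<and> Q k x y"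
  shows "\<exists>f. (\<forall>k. P k (f k)) \<and> (\<forall>k\<ge>B. f k = z k) \<and> (\<forall>k<B. Q k (f k) (f (k + 1)))"
proof -
  have "\<exists>f. \<forall>n. (P (B - int n) (f n) \<and> (n = 0 \<longrightarrow> f n = z B)) \<and> Q (B - int (Suc n)) (f (Suc n)) (f n)"
  proof (rule dependent_nat_choice)
    fix y n assume "P (B - int n) y \<and> (n = 0 \<longrightarrow> y = z B)"
    moreover have "B - int n = B - int (Suc n) + 1" by simp
    ultimately show "\<exists>x. (P (B - int (Suc n)) x \<and> (Suc n = 0 \<longrightarrow> x = z B)) \<and> Q (B - int (Suc n)) x y"
      using step[of "B - int (Suc n)" y] by (auto simp del: of_nat_Suc)
  qed (use base[of B] in auto)
  then obtain f where f: "\<And>n. P (B - int n) (f n)" "f 0 = z B"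
    "\<And>n. Q (B - int (Suc n)) (f (Suc n)) (f n)" by blast
  define g where "g k = (if B \<le> k then z k else f (nat (B - k)))" for k
  have g_below: "g k = f (nat (B - k))" if "k \<le> B" for k
    using that f(2) by (auto simp: g_def)
  have "P k (g k)" for k
    using base f(1)[of "nat (B - k)"] by (auto simp: g_def)
  moreover have "Q k (g k) (g (k + 1))" if "k < B" for k
  proof -
    define n where "n = nat (B - (k + 1))"
    have "B - int (Suc n) = k" "nat (B - k) = Suc n" "nat (B - (k + 1)) = n"
      using that by (auto simp: n_def)
    then show ?thesis using f(3)[of n] that by (simp add: g_below)
  qed
  ultimately show ?thesis by (intro exI[of _ g]) (simp add: g_def)
qed

lemma null_homotopy_extend:
  assumes "cochain_complex A P" "projective_rmodule A (obj P k)" "cochain_complex A E" "acyclic_complex E"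
    and u: "cochain_map A P E u"
    and \<tau>: "\<tau> \<in> rmod_hom A (obj P (k + 1)) (obj E k)"
    and \<tau>_boundary: "\<And>x. x \<in> carrier (obj P k) \<Longrightarrow>
      differential E k (\<tau> (differential P k x)) = u (k + 1) (differential P k x)"
  shows "\<exists>\<sigma>\<in>rmod_hom A (obj P k) (obj E (k - 1)). \<forall>x\<in>carrier (obj P k).
    differential E (k - 1) (\<sigma> x) = u k x \<ominus>\<^bsub>obj E k\<^esub> \<tau> (differential P k x)"
proof -
  interpret P: cochain A P by (rule cochain.intro) fact
  interpret E: cochain A E by (rule cochain.intro) fact
  interpret dE: abelian_group_hom "obj E k" "obj E (k + 1)" "differential E k"
    by (rule E.differential_abelian_group_hom)
  let ?f = "\<lambda>x. u k x \<ominus>\<^bsub>obj E k\<^esub> \<tau> (differential P k x)"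
  have f: "?f \<in> rmod_hom A (obj P k) (obj E k)"
    by (intro rmod_hom_minus E.obj_module cochain_map_hom[OF u] rmod_hom_comp[OF \<tau> P.differential_hom])
  have "?f x \<in> differential E (k - 1) ` carrier (obj E (k - 1))" if x: "x \<in> carrier (obj P k)" for x
  proof -
    have closed: "u k x \<in> carrier (obj E k)" "\<tau> (differential P k x) \<in> carrier (obj E k)"
      "u (k + 1) (differential P k x) \<in> carrier (obj E (k + 1))"
      using rmod_hom_closed[OF cochain_map_hom[OF u]] rmod_hom_closed[OF \<tau>] x P.differential_closed[OF x]
      by simp_all
    then have "differential E k (?f x) = \<zero>\<^bsub>obj E (k + 1)\<^esub>"
      using x \<tau>_boundary[OF x] cochain_map_commute[OF u x] by (simp add: dE.hom_minus dE.H.minus_self)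
    moreover have "?f x \<in> carrier (obj E k)" using closed by simp
    ultimately show ?thesis
      using assms(4) unfolding acyclic_complex_def by blast
  qed
  moreover obtain X :: "'c set" and \<theta> e where "dual_basis A (obj P k) X \<theta> e"
    using projective_rmodule_dual_basis[OF assms(2)] by blast
  ultimately show ?thesis
    by (intro dual_basis.lift_along[OF _ E.obj_module E.obj_module E.differential_hom_pred f]) auto
qed

lemma ex_null_homotopy_below:
  assumes "cochain_complex A P" and bounded: "\<And>k. B \<le> k \<Longrightarrow> carrier (obj P k) = {\<zero>\<^bsub>obj P k\<^esub>}"
    and projective: "\<And>k. projective_rmodule A (obj P k)"
    and "cochain_complex A E" and acyclic: "acyclic_complex E" and u: "cochain_map A P E u"
  shows "\<exists>\<sigma>. (\<forall>k. \<sigma> k \<in> rmod_hom A (obj P k) (obj E (k - 1))) \<and>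
    (\<forall>k\<ge>B. \<sigma> k = (\<lambda>x. \<zero>\<^bsub>obj E (k - 1)\<^esub>)) \<and>
    (\<forall>k<B. \<forall>x\<in>carrier (obj P k).
       differential E (k - 1) (\<sigma> k x) = u k x \<ominus>\<^bsub>obj E k\<^esub> \<sigma> (k + 1) (differential P k x))"
proof -
  interpret P: cochain A P by (rule cochain.intro) fact
  interpret E: cochain A E by (rule cochain.intro) fact
  have hom_zero: "h \<zero>\<^bsub>obj P j\<^esub> = \<zero>\<^bsub>obj E k\<^esub>" if "h \<in> rmod_hom A (obj P j) (obj E k)" for h j k
    using that by (rule rmod_hom_map_zero[OF _ P.obj_module E.obj_module])
  let ?P = "\<lambda>k \<sigma>. \<sigma> \<in> rmod_hom A (obj P k) (obj E (k - 1)) \<and> (\<forall>y\<in>carrier (obj P (k - 1)).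
    differential E (k - 1) (\<sigma> (differential P (k - 1) y)) = u k (differential P (k - 1) y))"
  let ?Q = "\<lambda>k \<sigma> \<tau>. \<forall>x\<in>carrier (obj P k).
    differential E (k - 1) (\<sigma> x) = u k x \<ominus>\<^bsub>obj E k\<^esub> \<tau> (differential P k x)"
  have "\<exists>\<sigma>. (\<forall>k. ?P k (\<sigma> k)) \<and> (\<forall>k\<ge>B. \<sigma> k = (\<lambda>x. \<zero>\<^bsub>obj E (k - 1)\<^esub>)) \<and> (\<forall>k<B. ?Q k (\<sigma> k) (\<sigma> (k + 1)))"
  proof (rule ex_int_downward_recursion)
    fix k assume "B \<le> k"
    then have "differential P (k - 1) y = \<zero>\<^bsub>obj P k\<^esub>" if "y \<in> carrier (obj P (k - 1))" for y
      using P.differential_closed_pred[OF that] bounded by auto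
    then show "?P k (\<lambda>x. \<zero>\<^bsub>obj E (k - 1)\<^esub>)"
      by (simp add: rmod_hom_zero E.obj_module hom_zero[OF cochain_map_hom[OF u]]
        abelian_group_hom.hom_zero[OF E.differential_abelian_group_hom_pred])
  next
    fix k \<tau> assume \<tau>: "?P (k + 1) \<tau>"
    then have \<tau>_hom: "\<tau> \<in> rmod_hom A (obj P (k + 1)) (obj E k)" by simp
    obtain \<sigma> where \<sigma>: "\<sigma> \<in> rmod_hom A (obj P k) (obj E (k - 1))" "?Q k \<sigma> \<tau>"
      using \<tau> null_homotopy_extend[OF assms(1) projective assms(4) acyclic u \<tau>_hom] by auto
    have "differential E (k - 1) (\<sigma> (differential P (k - 1) y)) = u k (differential P (k - 1) y)"
      if y: "y \<in> carrier (obj P (k - 1))" for y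
    proof -
      interpret Ek: abelian_group "obj E k" by (rule E.obj_abelian_group)
      have "u k (differential P (k - 1) y) \<in> carrier (obj E k)"
        by (intro rmod_hom_closed[OF cochain_map_hom[OF u]] P.differential_closed_pred y)
      then show ?thesis
        using \<sigma>(2) P.differential_closed_pred[OF y]
        by (simp add: P.differential_differential_pred[OF y] hom_zero[OF \<tau>_hom] Ek.minus_zero_right)
    qed
    with \<sigma> show "\<exists>\<sigma>. ?P k \<sigma> \<and> ?Q k \<sigma> \<tau>" by blast
  qed
  then show ?thesis by blast
qed

lemma projective_to_acyclic_null_homotopic:
  assumes "cochain_complex A P" and bounded: "\<And>k. B \<le> k \<Longrightarrow> carrier (obj P k) = {\<zero>\<^bsub>obj P k\<^esub>}"
    and "\<And>k. projective_rmodule A (obj P k)"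
    and "cochain_complex A E" and "acyclic_complex E" and u: "cochain_map A P E u"
  shows "cochain_homotopic A P E u (\<lambda>k x. \<zero>\<^bsub>obj E k\<^esub>)"
proof -
  interpret P: cochain A P by (rule cochain.intro) fact
  interpret E: cochain A E by (rule cochain.intro) fact
  obtain \<sigma> where \<sigma>: "\<And>k. \<sigma> k \<in> rmod_hom A (obj P k) (obj E (k - 1))"
    "\<And>k. B \<le> k \<Longrightarrow> \<sigma> k = (\<lambda>x. \<zero>\<^bsub>obj E (k - 1)\<^esub>)"
    "\<And>k x. \<lbrakk>k < B; x \<in> carrier (obj P k)\<rbrakk> \<Longrightarrow>
       differential E (k - 1) (\<sigma> k x) = u k x \<ominus>\<^bsub>obj E k\<^esub> \<sigma> (k + 1) (differential P k x)"
    using ex_null_homotopy_below[OF assms] by blast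
  have "u k x \<ominus>\<^bsub>obj E k\<^esub> \<zero>\<^bsub>obj E k\<^esub> =
      differential E (k - 1) (\<sigma> k x) \<oplus>\<^bsub>obj E k\<^esub> \<sigma> (k + 1) (differential P k x)"
    if x: "x \<in> carrier (obj P k)" for k x
  proof -
    interpret Ek: abelian_group "obj E k" by (rule E.obj_abelian_group)
    have closed: "u k x \<in> carrier (obj E k)" "\<sigma> (k + 1) (differential P k x) \<in> carrier (obj E k)"
      using rmod_hom_closed[OF cochain_map_hom[OF u] x]
        rmod_hom_closed[OF \<sigma>(1)[of "k + 1"] P.differential_closed[OF x]] by simp_all
    show ?thesis
    proof (cases "k < B")
      case True
      then show ?thesis
        using \<sigma>(3) x closed by (simp add: a_minus_def Ek.a_assoc Ek.l_neg)
    next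
      case False
      then have "x = \<zero>\<^bsub>obj P k\<^esub>" using bounded x by auto
      with False show ?thesis
        by (simp add: \<sigma>(2) rmod_hom_map_zero[OF cochain_map_hom[OF u] P.obj_module E.obj_module] Ek.minus_self
          abelian_group_hom.hom_zero[OF E.differential_abelian_group_hom_pred])
    qed
  qed
  then show ?thesis
    using \<sigma>(1) unfolding cochain_homotopic_def by blast
qed

subsection \<open>Subcomplexes\<close>

lemma submodule_right_module:
  assumes "right_module R M" "submodule U R M"
  shows "right_module R (M\<lparr>carrier := U\<rparr>)"
proof -
  interpret M: right_module R M by fact
  interpret U: submodule U R M by fact
  have mem: "x \<in> U \<Longrightarrow> x \<in> carrier M" for x using U.mem_carrier by simp
  have "abelian_group (M\<lparr>carrier := U\<rparr>)"
  proof (rule abelian_groupI)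
    fix x assume x: "x \<in> carrier (M\<lparr>carrier := U\<rparr>)"
    then have "\<ominus>\<^bsub>M\<^esub> x \<in> U" using U.m_inv_closed[of x] by (simp add: a_inv_def)
    with x mem show "\<exists>y\<in>carrier (M\<lparr>carrier := U\<rparr>). y \<oplus>\<^bsub>M\<lparr>carrier := U\<rparr>\<^esub> x = \<zero>\<^bsub>M\<lparr>carrier := U\<rparr>\<^esub>"
      by (intro bexI[of _ "\<ominus>\<^bsub>M\<^esub> x"]) (simp_all add: M.M.l_neg)
  qed (use mem U.m_closed U.one_closed in \<open>simp_all add: M.M.a_ac\<close>)
  then show ?thesis
    by (intro right_module.intro right_module_axioms.intro M.R.ring_axioms)
      (use mem in \<open>simp_all add: M.smult_l_distr M.smult_r_distr M.smult_assoc M.smult_one\<close>)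
qed

definition subcomplex :: "('a, 'r) ring_scheme \<Rightarrow> ('a, 'm) mod_complex \<Rightarrow> (int \<Rightarrow> 'm set) \<Rightarrow> bool" where
  "subcomplex R D U \<longleftrightarrow>
     (\<forall>k. submodule (U k) R (obj D k)) \<and> (\<forall>k. differential D k ` U k \<subseteq> U (k + 1))"

lemma projective_to_acyclic_subcomplex_null_homotopic:
  assumes P: "cochain_complex A P" "\<And>k. B \<le> k \<Longrightarrow> carrier (obj P k) = {\<zero>\<^bsub>obj P k\<^esub>}"
      "\<And>k. projective_rmodule A (obj P k)"
    and "cochain_complex A D" and sub: "subcomplex A D U"
    and acyclic: "\<And>k z. \<lbrakk>z \<in> U k; differential D k z = \<zero>\<^bsub>obj D (k + 1)\<^esub>\<rbrakk> \<Longrightarrow>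
      z \<in> differential D (k - 1) ` U (k - 1)"
    and u: "cochain_map A P D u" "\<And>k x. x \<in> carrier (obj P k) \<Longrightarrow> u k x \<in> U k"
  shows "cochain_homotopic A P D u (\<lambda>k x. \<zero>\<^bsub>obj D k\<^esub>)"
proof -
  interpret D: cochain A D by (rule cochain.intro) fact
  define E where "E = \<lparr>obj = \<lambda>k. (obj D k)\<lparr>carrier := U k\<rparr>, differential = differential D\<rparr>"
  have E: "obj E k = (obj D k)\<lparr>carrier := U k\<rparr>" "differential E = differential D" for k
    by (simp_all add: E_def)
  have U: "submodule (U k) A (obj D k)" "\<And>x. x \<in> U k \<Longrightarrow> differential D k x \<in> U (k + 1)" for k
    using sub by (auto simp: subcomplex_def)
  have mem: "x \<in> carrier (obj D k)" if "x \<in> U k" for x k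
    using that subgroup.mem_carrier[OF submodule.axioms(1)[OF U(1)]] by simp
  have complex: "cochain_complex A E"
    unfolding cochain_complex_def E
    using U mem D.obj_module rmod_hom_add[OF D.differential_hom] rmod_hom_smult[OF D.differential_hom]
      D.differential_differential
    by (auto intro!: submodule_right_module rmod_homI)
  have "acyclic_complex E"
    unfolding acyclic_complex_def E
    using U(2)[of _ "_ - 1"] acyclic mem D.differential_differential_pred by fastforce
  moreover have "cochain_map A P E u"
    using u unfolding cochain_map_def rmod_hom_def E by auto
  ultimately have "cochain_homotopic A P E u (\<lambda>k x. \<zero>\<^bsub>obj E k\<^esub>)"
    by (intro projective_to_acyclic_null_homotopic[OF P complex])
  then obtain \<sigma> where \<sigma>: "\<And>k. \<sigma> k \<in> rmod_hom A (obj P k) (obj E (k - 1))"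
    and eq: "\<And>k x. x \<in> carrier (obj P k) \<Longrightarrow> u k x \<ominus>\<^bsub>obj E k\<^esub> \<zero>\<^bsub>obj E k\<^esub> =
      differential E (k - 1) (\<sigma> k x) \<oplus>\<^bsub>obj E k\<^esub> \<sigma> (k + 1) (differential P k x)"
    by (auto simp: cochain_homotopic_def)
  have "u k x \<ominus>\<^bsub>obj E k\<^esub> \<zero>\<^bsub>obj E k\<^esub> = u k x \<ominus>\<^bsub>obj D k\<^esub> \<zero>\<^bsub>obj D k\<^esub>"
    if "x \<in> carrier (obj P k)" for k x
  proof -
    interpret Dk: abelian_group "obj D k" by (rule D.obj_abelian_group)
    interpret Ek: abelian_group "obj E k"
      by (rule cochain.obj_abelian_group[OF cochain.intro[OF complex]])
    show ?thesis
      using Dk.minus_zero_right Ek.minus_zero_right u(2)[OF that] mem by (simp add: E)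
  qed
  moreover have "\<sigma> k \<in> rmod_hom A (obj P k) (obj D (k - 1))" for k
    using \<sigma>[of k] mem by (auto simp: rmod_hom_def E)
  ultimately show ?thesis
    unfolding cochain_homotopic_def using eq by (intro exI[of _ \<sigma>]) (simp add: E)
qed

section \<open>Change of rings\<close>

lemma restrict_scalars_simps [simp]:
  "carrier (restrict_scalars \<phi> M) = carrier M" "\<zero>\<^bsub>restrict_scalars \<phi> M\<^esub> = \<zero>\<^bsub>M\<^esub>"
  "x \<oplus>\<^bsub>restrict_scalars \<phi> M\<^esub> y = x \<oplus>\<^bsub>M\<^esub> y" "a \<odot>\<^bsub>restrict_scalars \<phi> M\<^esub> x = \<phi> a \<odot>\<^bsub>M\<^esub> x"
  by (simp_all add: restrict_scalars_def)

lemma restrict_scalars_minus [simp]: "x \<ominus>\<^bsub>restrict_scalars \<phi> M\<^esub> y = x \<ominus>\<^bsub>M\<^esub> y"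
  by (simp add: restrict_scalars_def a_minus_def a_inv_def m_inv_def)

lemma restrict_scalars_id: "restrict_scalars (\<lambda>a. a) M = M"
  by (cases M) (simp add: restrict_scalars_def)

lemma restrict_scalars_abelian_group:
  assumes "abelian_group M"
  shows "abelian_group (restrict_scalars \<phi> M)"
proof -
  interpret M: abelian_group M by fact
  show ?thesis
    by (rule abelian_groupI) (auto simp: M.a_ac intro: M.l_neg)
qed

lemma restrict_scalars_finsum:
  assumes "abelian_group M" "f \<in> I \<rightarrow> carrier M"
  shows "(\<Oplus>\<^bsub>restrict_scalars \<phi> M\<^esub>i\<in>I. f i) = (\<Oplus>\<^bsub>M\<^esub>i\<in>I. f i)"
proof (rule abelian_group_hom.hom_finsum)
  show "abelian_group_hom (restrict_scalars \<phi> M) M (\<lambda>x. x)"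
    by (intro abelian_group_homI_additive restrict_scalars_abelian_group assms(1)) simp_all
qed (use assms(2) in simp)

lemma restrict_complex_simps [simp]:
  "obj (restrict_complex \<phi> D) k = restrict_scalars \<phi> (obj D k)"
  "differential (restrict_complex \<phi> D) = differential D"
  by (simp_all add: restrict_complex_def)

lemma restrict_scalars_right_module:
  assumes "ring A" "\<phi> \<in> ring_hom A S" "right_module S M"
  shows "right_module A (restrict_scalars \<phi> M)"
proof -
  interpret M: right_module S M by fact
  note \<phi> = ring_hom_closed[OF assms(2)] ring_hom_add[OF assms(2)] ring_hom_mult[OF assms(2)]
    ring_hom_one[OF assms(2)]
  show ?thesis
    by (intro right_module.intro right_module_axioms.intro assms(1) restrict_scalars_abelian_group
        M.M.abelian_group_axioms)
      (simp_all add: \<phi> M.smult_closed M.smult_l_distr M.smult_r_distr M.smult_assoc M.smult_one)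
qed

lemma restrict_scalars_rmod_hom:
  "\<lbrakk>\<phi> \<in> ring_hom A S; h \<in> rmod_hom S M N\<rbrakk> \<Longrightarrow>
   h \<in> rmod_hom A (restrict_scalars \<phi> M) (restrict_scalars \<phi> N)"
  by (intro rmod_homI) (simp_all add: rmod_hom_closed rmod_hom_add rmod_hom_smult ring_hom_closed)

lemma restrict_complex_cochain_complex:
  assumes "ring A" "\<phi> \<in> ring_hom A S" "cochain_complex S D"
  shows "cochain_complex A (restrict_complex \<phi> D)"
proof -
  interpret cochain S D by (rule cochain.intro) fact
  show ?thesis
    unfolding cochain_complex_def restrict_complex_simps restrict_scalars_simps
    using restrict_scalars_right_module[OF assms(1,2) obj_module]
      restrict_scalars_rmod_hom[OF assms(2) differential_hom] differential_differential by blast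
qed

lemma smult_rmod_hom_restrict_scalars:
  assumes "right_module S M" "\<phi> \<in> ring_hom A S" "a \<in> carrier S"
    and "\<And>r. r \<in> carrier A \<Longrightarrow> \<phi> r \<otimes>\<^bsub>S\<^esub> a = a \<otimes>\<^bsub>S\<^esub> \<phi> r"
  shows "(\<lambda>x. a \<odot>\<^bsub>M\<^esub> x) \<in> rmod_hom A (restrict_scalars \<phi> M) (restrict_scalars \<phi> M)"
proof -
  interpret M: right_module S M by fact
  show ?thesis
    using assms(2-)
    by (intro rmod_homI)
      (simp_all add: M.smult_closed M.smult_r_distr ring_hom_closed flip: M.smult_assoc)
qed

section \<open>Extension of scalars\<close>

lemma frag_extend_free_Abelian_group_closed:
  assumes "u \<in> carrier (free_Abelian_group A)"
    and "\<And>a. a \<in> A \<Longrightarrow> \<kappa> a \<in> carrier (free_Abelian_group B)"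
  shows "frag_extend \<kappa> u \<in> carrier (free_Abelian_group B)"
proof -
  have "(\<Union>a\<in>Poly_Mapping.keys u. Poly_Mapping.keys (\<kappa> a)) \<subseteq> B"
    using assms unfolding carrier_free_Abelian_group_iff by blast
  then show ?thesis
    using keys_frag_extend[of \<kappa> u] by (auto simp: carrier_free_Abelian_group_iff)
qed

lemma frag_extend_generate:
  assumes generators: "\<And>u. u \<in> K \<Longrightarrow> frag_extend \<kappa> u \<in> L"
    and K: "K \<subseteq> carrier (free_Abelian_group A)" and L: "subgroup L (free_Abelian_group B)"
    and u: "u \<in> generate (free_Abelian_group A) K"
  shows "frag_extend \<kappa> u \<in> L"
  using u
proof (induction rule: generate.induct)
  case one
  then show ?case using subgroup.one_closed[OF L] by simp
next
  case (incl h)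
  then show ?case by (rule generators)
next
  case (inv h)
  have h: "h \<in> carrier (free_Abelian_group A)" "frag_extend \<kappa> h \<in> L"
    using inv K generators by blast+
  moreover have "frag_extend \<kappa> h \<in> carrier (free_Abelian_group B)"
    using subgroup.subset[OF L] h(2) by blast
  ultimately show ?case
    using subgroup.m_inv_closed[OF L h(2)] by (simp add: frag_extend_minus)
next
  case (eng h1 h2)
  then show ?case using subgroup.m_closed[OF L] by (simp add: frag_extend_add)
qed

lemma tensor_rels_cases [consumes 1, case_names left right balanced]:
  assumes "u \<in> tensor_rels A S \<phi> M"
  obtains x y s where "u = frag_of (x \<oplus>\<^bsub>M\<^esub> y, s) - frag_of (x, s) - frag_of (y, s)"
      "x \<in> carrier M" "y \<in> carrier M" "s \<in> carrier S"
    | x s t where "u = frag_of (x, s \<oplus>\<^bsub>S\<^esub> t) - frag_of (x, s) - frag_of (x, t)"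
      "x \<in> carrier M" "s \<in> carrier S" "t \<in> carrier S"
    | a x s where "u = frag_of (a \<odot>\<^bsub>M\<^esub> x, s) - frag_of (x, \<phi> a \<otimes>\<^bsub>S\<^esub> s)"
      "a \<in> carrier A" "x \<in> carrier M" "s \<in> carrier S"
  using assms unfolding tensor_rels_def by blast

lemma tensor_rels_add_left: "\<lbrakk>x \<in> carrier M; y \<in> carrier M; s \<in> carrier S\<rbrakk> \<Longrightarrow>
    frag_of (x \<oplus>\<^bsub>M\<^esub> y, s) - frag_of (x, s) - frag_of (y, s) \<in> tensor_rels A S \<phi> M"
  and tensor_rels_add_right: "\<lbrakk>x \<in> carrier M; s \<in> carrier S; t \<in> carrier S\<rbrakk> \<Longrightarrow>
    frag_of (x, s \<oplus>\<^bsub>S\<^esub> t) - frag_of (x, s) - frag_of (x, t) \<in> tensor_rels A S \<phi> M"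
  and tensor_rels_balanced: "\<lbrakk>a \<in> carrier A; x \<in> carrier M; s \<in> carrier S\<rbrakk> \<Longrightarrow>
    frag_of (a \<odot>\<^bsub>M\<^esub> x, s) - frag_of (x, \<phi> a \<otimes>\<^bsub>S\<^esub> s) \<in> tensor_rels A S \<phi> M"
  unfolding tensor_rels_def by blast+

type_synonym ('m, 's) tensor_elem = "('m \<times> 's \<Rightarrow>\<^sub>0 int) set"

locale tensor = S: ring S + M: right_module A M
  for A :: "('a, 'r) ring_scheme" and S :: "('s, 't) ring_scheme" and \<phi> :: "'a \<Rightarrow> 's"
    and M :: "('a, 'm) module" +
  assumes phi_hom: "\<phi> \<in> ring_hom A S"
begin

abbreviation "gens \<equiv> tensor_gens M S"
abbreviation "null \<equiv> tensor_null A S \<phi> M"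
abbreviation "MS \<equiv> extend_scalars A S \<phi> M"
abbreviation cls :: "('m \<times> 's \<Rightarrow>\<^sub>0 int) \<Rightarrow> ('m, 's) tensor_elem" where "cls u \<equiv> null #>\<^bsub>gens\<^esub> u"

definition tens :: "'m \<Rightarrow> 's \<Rightarrow> ('m, 's) tensor_elem" where
  "tens x s = cls (frag_of (x, s))"

lemmas phi_closed = ring_hom_closed[OF phi_hom]

lemma gens_comm_group: "comm_group gens"
  by (simp add: tensor_gens_def abelian_free_Abelian_group)

lemma gens_group: "group gens"
  by (simp add: tensor_gens_def)

lemma gens_simps: "x \<otimes>\<^bsub>gens\<^esub> y = x + y" "\<one>\<^bsub>gens\<^esub> = 0" "x \<in> carrier gens \<Longrightarrow> inv\<^bsub>gens\<^esub> x = - x"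
  by (simp_all add: tensor_gens_def)

lemma gens_closed [simp]:
  "0 \<in> carrier gens"
  "\<lbrakk>x \<in> carrier M; s \<in> carrier S\<rbrakk> \<Longrightarrow> frag_of (x, s) \<in> carrier gens"
  "\<lbrakk>u \<in> carrier gens; v \<in> carrier gens\<rbrakk> \<Longrightarrow> u + v \<in> carrier gens"
  "u \<in> carrier gens \<Longrightarrow> - u \<in> carrier gens"
  "\<lbrakk>u \<in> carrier gens; v \<in> carrier gens\<rbrakk> \<Longrightarrow> u - v \<in> carrier gens"
proof -
  interpret group gens by (rule gens_group)
  show "0 \<in> carrier gens" using one_closed by (simp add: gens_simps)
  show "\<lbrakk>x \<in> carrier M; s \<in> carrier S\<rbrakk> \<Longrightarrow> frag_of (x, s) \<in> carrier gens"
    by (simp add: tensor_gens_def)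
  show add: "\<lbrakk>u \<in> carrier gens; v \<in> carrier gens\<rbrakk> \<Longrightarrow> u + v \<in> carrier gens" for u v
    using m_closed[of u v] by (simp add: gens_simps)
  show neg: "u \<in> carrier gens \<Longrightarrow> - u \<in> carrier gens" for u
    by (simp add: tensor_gens_def)
  show "\<lbrakk>u \<in> carrier gens; v \<in> carrier gens\<rbrakk> \<Longrightarrow> u - v \<in> carrier gens"
    using add[of u "- v"] neg by simp
qed

lemma rels_subset: "tensor_rels A S \<phi> M \<subseteq> carrier gens"
  unfolding tensor_rels_def by (auto intro!: gens_closed M.smult_closed phi_closed)

lemma null_subgroup: "subgroup null gens"
  unfolding tensor_null_def by (rule group.generate_is_subgroup[OF gens_group rels_subset])

lemma null_normal: "null \<lhd> gens"
  by (rule comm_group.subgroup_imp_normal[OF gens_comm_group null_subgroup])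

lemma rels_in_null: "u \<in> tensor_rels A S \<phi> M \<Longrightarrow> u \<in> null"
  unfolding tensor_null_def by (rule generate.incl)

lemma cls_eq_iff:
  assumes "u \<in> carrier gens" "v \<in> carrier gens"
  shows "cls u = cls v \<longleftrightarrow> u - v \<in> null"
proof -
  have "u \<in> cls v \<longleftrightarrow> u - v \<in> null"
    using subgroup.rcos_module[OF null_subgroup gens_group assms(2,1)] assms by (simp add: gens_simps)
  moreover have "u \<in> cls v \<longleftrightarrow> cls u = cls v"
    using assms group.repr_independence[OF gens_group _ _ null_subgroup]
      group.rcos_self[OF gens_group _ null_subgroup] by metis
  ultimately show ?thesis by simp
qed

lemma in_cls_iff:
  assumes "u \<in> carrier gens"
  shows "v \<in> cls u \<longleftrightarrow> v \<in> carrier gens \<and> cls v = cls u"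
proof
  assume v: "v \<in> cls u"
  have "cls u \<subseteq> carrier gens"
    using assms subgroup.subset[OF null_subgroup]
    by (rule monoid.r_coset_subset_G[OF group.is_monoid[OF gens_group], rotated])
  with v show "v \<in> carrier gens \<and> cls v = cls u"
    using group.repr_independence[OF gens_group v assms null_subgroup] by auto
next
  assume "v \<in> carrier gens \<and> cls v = cls u"
  then show "v \<in> cls u"
    using group.rcos_self[OF gens_group _ null_subgroup, of v] by simp
qed

lemma MS_simps:
  "carrier MS = cls ` carrier gens" "\<zero>\<^bsub>MS\<^esub> = cls 0"
  "\<lbrakk>u \<in> carrier gens; v \<in> carrier gens\<rbrakk> \<Longrightarrow> cls u \<oplus>\<^bsub>MS\<^esub> cls v = cls (u + v)"
proof -
  show "carrier MS = cls ` carrier gens"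
    by (auto simp: extend_scalars_def Let_def FactGroup_def RCOSETS_def)
  have "cls 0 = null"
    using group.coset_join2[OF gens_group gens_closed(1) null_subgroup] subgroup.one_closed[OF null_subgroup]
    by (simp add: gens_simps)
  then show "\<zero>\<^bsub>MS\<^esub> = cls 0"
    by (simp add: extend_scalars_def Let_def FactGroup_def)
  show "cls u \<oplus>\<^bsub>MS\<^esub> cls v = cls (u + v)" if "u \<in> carrier gens" "v \<in> carrier gens"
    using normal.rcos_sum[OF null_normal that]
    by (simp add: extend_scalars_def Let_def FactGroup_def gens_simps)
qed

lemma MS_abelian_group: "abelian_group MS"
proof (rule abelian_groupI)
  fix x y z assume "x \<in> carrier MS" "y \<in> carrier MS" "z \<in> carrier MS"
  then obtain u v w where uvw: "x = cls u" "y = cls v" "z = cls w"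
    "u \<in> carrier gens" "v \<in> carrier gens" "w \<in> carrier gens"
    by (auto simp: MS_simps)
  show "x \<oplus>\<^bsub>MS\<^esub> y \<in> carrier MS" "x \<oplus>\<^bsub>MS\<^esub> y \<oplus>\<^bsub>MS\<^esub> z = x \<oplus>\<^bsub>MS\<^esub> (y \<oplus>\<^bsub>MS\<^esub> z)"
    "x \<oplus>\<^bsub>MS\<^esub> y = y \<oplus>\<^bsub>MS\<^esub> x" "\<zero>\<^bsub>MS\<^esub> \<oplus>\<^bsub>MS\<^esub> x = x"
    using uvw by (auto simp: MS_simps ac_simps)
  show "\<exists>y\<in>carrier MS. y \<oplus>\<^bsub>MS\<^esub> x = \<zero>\<^bsub>MS\<^esub>"
    using uvw by (intro bexI[of _ "cls (- u)"]) (auto simp: MS_simps)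
qed (use gens_closed in \<open>auto simp: MS_simps\<close>)

sublocale MS: abelian_group MS
  by (rule MS_abelian_group)

lemma tens_closed [intro, simp]: "\<lbrakk>x \<in> carrier M; s \<in> carrier S\<rbrakk> \<Longrightarrow> tens x s \<in> carrier MS"
  by (auto simp: tens_def MS_simps)

lemma tens_add_left:
  "\<lbrakk>x \<in> carrier M; y \<in> carrier M; s \<in> carrier S\<rbrakk> \<Longrightarrow> tens (x \<oplus>\<^bsub>M\<^esub> y) s = tens x s \<oplus>\<^bsub>MS\<^esub> tens y s"
  using rels_in_null[OF tensor_rels_add_left[of x M y s]]
  by (simp add: tens_def MS_simps cls_eq_iff diff_diff_eq)

lemma tens_add_right:
  "\<lbrakk>x \<in> carrier M; s \<in> carrier S; t \<in> carrier S\<rbrakk> \<Longrightarrow> tens x (s \<oplus>\<^bsub>S\<^esub> t) = tens x s \<oplus>\<^bsub>MS\<^esub> tens x t"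
  using rels_in_null[OF tensor_rels_add_right[of x M s S t]]
  by (simp add: tens_def MS_simps cls_eq_iff diff_diff_eq)

lemma tens_balanced:
  "\<lbrakk>x \<in> carrier M; s \<in> carrier S; a \<in> carrier A\<rbrakk> \<Longrightarrow> tens (a \<odot>\<^bsub>M\<^esub> x) s = tens x (\<phi> a \<otimes>\<^bsub>S\<^esub> s)"
  using rels_in_null[OF tensor_rels_balanced[of a A x M s]]
  by (simp add: tens_def cls_eq_iff M.smult_closed phi_closed)

lemma tens_left_hom: "s \<in> carrier S \<Longrightarrow> abelian_group_hom M MS (\<lambda>x. tens x s)"
  by (rule abelian_group_homI_additive)
    (auto simp: tens_add_left MS_abelian_group M.M.abelian_group_axioms)

lemma tens_right_hom: "x \<in> carrier M \<Longrightarrow> abelian_group_hom S MS (\<lambda>s. tens x s)"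
  by (rule abelian_group_homI_additive)
    (auto simp: tens_add_right MS_abelian_group S.abelian_group_axioms)

lemma tensor_induct [consumes 1, case_names tens add]:
  assumes U: "U \<in> carrier MS"
    and tens: "\<And>x s. \<lbrakk>x \<in> carrier M; s \<in> carrier S\<rbrakk> \<Longrightarrow> P (tens x s)"
    and add: "\<And>U V. \<lbrakk>U \<in> carrier MS; V \<in> carrier MS; P U; P V\<rbrakk> \<Longrightarrow> P (U \<oplus>\<^bsub>MS\<^esub> V)"
  shows "P U"
proof -
  obtain u where u: "u \<in> carrier gens" "U = cls u"
    using U by (auto simp: MS_simps)
  have neg: "P (cls (- frag_of (x, s)))" if "x \<in> carrier M" "s \<in> carrier S" for x s
  proof -
    have "cls (- frag_of (x, s)) = \<ominus>\<^bsub>MS\<^esub> tens x s"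
      using that by (intro MS.minus_equality[symmetric]) (auto simp: tens_def MS_simps)
    then show ?thesis
      using tens[of "\<ominus>\<^bsub>M\<^esub> x" s] abelian_group_hom.hom_a_inv[OF tens_left_hom, of s x] that by simp
  qed
  have "Poly_Mapping.keys u \<subseteq> carrier M \<times> carrier S"
    using u by (simp add: tensor_gens_def)
  then have "u \<in> carrier gens \<and> P (cls u) \<and> P (cls (- u))"
  proof (induction u rule: frag_induction)
    case zero
    have "tens \<zero>\<^bsub>M\<^esub> \<zero>\<^bsub>S\<^esub> = \<zero>\<^bsub>MS\<^esub>"
      by (rule abelian_group_hom.hom_zero[OF tens_left_hom]) simp
    then show ?case
      using tens[of "\<zero>\<^bsub>M\<^esub>" "\<zero>\<^bsub>S\<^esub>"] by (simp add: MS_simps)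
  next
    case (diff u v)
    then have "P (cls u \<oplus>\<^bsub>MS\<^esub> cls (- v))" "P (cls (- u) \<oplus>\<^bsub>MS\<^esub> cls v)"
      by (simp_all add: add MS_simps(1))
    then show ?case
      using diff by (simp add: MS_simps add.commute)
  next
    case (one a)
    then show ?case
      using tens neg by (cases a) (auto simp: tens_def)
  qed
  then show ?thesis using u by simp
qed

lemma tensor_hom_eqI:
  assumes "abelian_group_hom MS G f" "abelian_group_hom MS G g"
    and "\<And>x s. \<lbrakk>x \<in> carrier M; s \<in> carrier S\<rbrakk> \<Longrightarrow> f (tens x s) = g (tens x s)"
    and "U \<in> carrier MS"
  shows "f U = g U"
  using assms(4)
proof (induction rule: tensor_induct)
  case (add U V)
  then show ?case
    by (simp add: abelian_group_hom.hom_add[OF assms(1)] abelian_group_hom.hom_add[OF assms(2)])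
qed (rule assms(3))

lemma gens_hom_vanishes_on_null:
  fixes G :: "('g, 'h) ring_scheme"
  assumes "abelian_group G" and h: "h \<in> hom gens (add_monoid G)"
    and left: "\<And>x y s. \<lbrakk>x \<in> carrier M; y \<in> carrier M; s \<in> carrier S\<rbrakk> \<Longrightarrow>
              h (frag_of (x \<oplus>\<^bsub>M\<^esub> y, s)) = h (frag_of (x, s)) \<oplus>\<^bsub>G\<^esub> h (frag_of (y, s))"
    and right: "\<And>x s t. \<lbrakk>x \<in> carrier M; s \<in> carrier S; t \<in> carrier S\<rbrakk> \<Longrightarrow>
              h (frag_of (x, s \<oplus>\<^bsub>S\<^esub> t)) = h (frag_of (x, s)) \<oplus>\<^bsub>G\<^esub> h (frag_of (x, t))"
    and balanced: "\<And>a x s. \<lbrakk>a \<in> carrier A; x \<in> carrier M; s \<in> carrier S\<rbrakk> \<Longrightarrow>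
              h (frag_of (a \<odot>\<^bsub>M\<^esub> x, s)) = h (frag_of (x, \<phi> a \<otimes>\<^bsub>S\<^esub> s))"
  shows "null \<subseteq> kernel gens (add_monoid G) h"
proof -
  interpret G: abelian_group G by fact
  interpret h: group_hom gens "add_monoid G" h
    by (simp add: group_hom_def group_hom_axioms_def gens_group h G.a_group)
  have h_closed: "u \<in> carrier gens \<Longrightarrow> h u \<in> carrier G" for u
    using h.hom_closed by simp
  have h_diff: "h (u - v) = h u \<ominus>\<^bsub>G\<^esub> h v" if "u \<in> carrier gens" "v \<in> carrier gens" for u v
  proof -
    have "h u = h (u - v) \<oplus>\<^bsub>G\<^esub> h v"
      using h.hom_mult[of "u - v" v] that by (simp add: gens_simps)
    then show ?thesis
      using that by (simp add: G.minus_eq_iff h_closed eq_commute[of "h (u - v)"])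
  qed
  have cancel: "c \<oplus>\<^bsub>G\<^esub> d \<ominus>\<^bsub>G\<^esub> c \<ominus>\<^bsub>G\<^esub> d = \<zero>\<^bsub>G\<^esub>" if "c \<in> carrier G" "d \<in> carrier G" for c d
    using that by (simp add: G.minus_eq_iff G.a_comm)
  have "tensor_rels A S \<phi> M \<subseteq> kernel gens (add_monoid G) h"
  proof
    fix u assume u: "u \<in> tensor_rels A S \<phi> M"
    then have "h u = \<zero>\<^bsub>G\<^esub>"
    proof (cases rule: tensor_rels_cases)
      case (left x y s)
      then show ?thesis by (simp add: h_diff h_closed assms(3) cancel)
    next
      case (right x s t)
      then show ?thesis by (simp add: h_diff h_closed assms(4) cancel)
    next
      case (balanced a x s)
      then show ?thesis
        by (simp add: h_diff h_closed assms(5) phi_closed M.smult_closed G.minus_self)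
    qed
    with u rels_subset show "u \<in> kernel gens (add_monoid G) h" by (auto simp: kernel_def)
  qed
  then show ?thesis
    unfolding tensor_null_def
    by (rule group.generate_subgroup_incl[OF gens_group _ h.subgroup_kernel])
qed

lemma ex_tensor_lift:
  fixes G :: "('g, 'h) ring_scheme"
  assumes "abelian_group G"
    and closed: "\<And>x s. \<lbrakk>x \<in> carrier M; s \<in> carrier S\<rbrakk> \<Longrightarrow> \<beta> x s \<in> carrier G"
    and left: "\<And>x y s. \<lbrakk>x \<in> carrier M; y \<in> carrier M; s \<in> carrier S\<rbrakk> \<Longrightarrow>
              \<beta> (x \<oplus>\<^bsub>M\<^esub> y) s = \<beta> x s \<oplus>\<^bsub>G\<^esub> \<beta> y s"
    and right: "\<And>x s t. \<lbrakk>x \<in> carrier M; s \<in> carrier S; t \<in> carrier S\<rbrakk> \<Longrightarrow>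
              \<beta> x (s \<oplus>\<^bsub>S\<^esub> t) = \<beta> x s \<oplus>\<^bsub>G\<^esub> \<beta> x t"
    and balanced: "\<And>a x s. \<lbrakk>a \<in> carrier A; x \<in> carrier M; s \<in> carrier S\<rbrakk> \<Longrightarrow>
              \<beta> (a \<odot>\<^bsub>M\<^esub> x) s = \<beta> x (\<phi> a \<otimes>\<^bsub>S\<^esub> s)"
  shows "\<exists>h. abelian_group_hom MS G h \<and> (\<forall>x\<in>carrier M. \<forall>s\<in>carrier S. h (tens x s) = \<beta> x s)"
proof -
  interpret G: abelian_group G by fact
  have "comm_group (add_monoid G)" by (rule G.a_comm_group)
  then obtain h where hom: "h \<in> hom gens (add_monoid G)"
    and h: "\<And>p. p \<in> carrier M \<times> carrier S \<Longrightarrow> h (frag_of p) = (case p of (x, s) \<Rightarrow> \<beta> x s)"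
  proof (rule comm_group.free_Abelian_group_universal)
    show "(\<lambda>(x, s). \<beta> x s) ` (carrier M \<times> carrier S) \<subseteq> carrier (add_monoid G)"
      using closed by auto
  qed (auto simp: tensor_gens_def)
  interpret h: group_hom gens "add_monoid G" h
    by (simp add: group_hom_def group_hom_axioms_def gens_group hom G.a_group)
  have "null \<subseteq> kernel gens (add_monoid G) h"
    by (rule gens_hom_vanishes_on_null[OF assms(1) hom])
      (simp_all add: h left right balanced M.smult_closed phi_closed)
  then obtain g where g: "g \<in> hom (gens Mod null) (add_monoid G)" "\<And>u. u \<in> carrier gens \<Longrightarrow> g (cls u) = h u"
    using h.FactGroup_universal_kernel[OF null_normal] by metis
  have "h (u + v) = h u \<oplus>\<^bsub>G\<^esub> h v" "h u \<in> carrier G" if "u \<in> carrier gens" "v \<in> carrier gens" for u v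
    using h.hom_mult[OF that] h.hom_closed[OF that(1)] by (simp_all add: gens_simps)
  then have "abelian_group_hom MS G g"
    by (intro abelian_group_homI_additive MS_abelian_group assms(1)) (auto simp: MS_simps g)
  then show ?thesis
    by (intro exI[of _ g]) (simp add: tens_def g h)
qed

end

locale tensor_pair = M: tensor A S \<phi> M + M': tensor A S \<phi> M'
  for A :: "('a, 'r) ring_scheme" and S :: "('s, 't) ring_scheme" and \<phi> :: "'a \<Rightarrow> 's"
    and M :: "('a, 'm) module" and M' :: "('a, 'p) module"

locale induced_map = tensor_pair A S \<phi> M M'
  for A :: "('a, 'r) ring_scheme" and S :: "('s, 't) ring_scheme" and \<phi> :: "'a \<Rightarrow> 's"
    and M :: "('a, 'm) module" and M' :: "('a, 'p) module" +
  fixes h :: "'m \<Rightarrow> 'p" and \<mu> :: "'s \<Rightarrow> 's"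
  assumes h: "h \<in> rmod_hom A M M'" and \<mu>: "s \<in> carrier S \<Longrightarrow> \<mu> s \<in> carrier S"
    and \<mu>_add: "\<lbrakk>s \<in> carrier S; t \<in> carrier S\<rbrakk> \<Longrightarrow> \<mu> (s \<oplus>\<^bsub>S\<^esub> t) = \<mu> s \<oplus>\<^bsub>S\<^esub> \<mu> t"
    and \<mu>_mult: "\<lbrakk>a \<in> carrier S; s \<in> carrier S\<rbrakk> \<Longrightarrow> \<mu> (a \<otimes>\<^bsub>S\<^esub> s) = a \<otimes>\<^bsub>S\<^esub> \<mu> s"
begin

abbreviation induced :: "('m \<times> 's \<Rightarrow>\<^sub>0 int) \<Rightarrow> ('p \<times> 's \<Rightarrow>\<^sub>0 int)" where
  "induced \<equiv> frag_extend (\<lambda>(x, s). frag_of (h x, \<mu> s))"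

lemma induced_closed: "u \<in> carrier M.gens \<Longrightarrow> induced u \<in> carrier M'.gens"
  using \<mu> rmod_hom_closed[OF h] unfolding tensor_gens_def
  by (intro frag_extend_free_Abelian_group_closed) auto

lemma induced_rels:
  assumes "u \<in> tensor_rels A S \<phi> M"
  shows "induced u \<in> tensor_rels A S \<phi> M'"
  using assms
proof (cases rule: tensor_rels_cases)
  case (left x y s)
  then show ?thesis
    using tensor_rels_add_left[of "h x" M' "h y" "\<mu> s" S A \<phi>]
    by (simp add: frag_extend_diff rmod_hom_add[OF h] rmod_hom_closed[OF h] \<mu>)
next
  case (right x s t)
  then show ?thesis
    using tensor_rels_add_right[of "h x" M' "\<mu> s" S "\<mu> t" A \<phi>]
    by (simp add: frag_extend_diff rmod_hom_closed[OF h] \<mu> \<mu>_add)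
next
  case (balanced a x s)
  then show ?thesis
    using tensor_rels_balanced[of a A "h x" M' "\<mu> s" S \<phi>]
    by (simp add: frag_extend_diff rmod_hom_smult[OF h] rmod_hom_closed[OF h] \<mu> \<mu>_mult M.phi_closed)
qed

lemma induced_null:
  assumes "u \<in> M.null"
  shows "induced u \<in> M'.null"
proof (rule frag_extend_generate[OF M'.rels_in_null[OF induced_rels]])
  show "tensor_rels A S \<phi> M \<subseteq> carrier (free_Abelian_group (carrier M \<times> carrier S))"
    using M.rels_subset by (simp add: tensor_gens_def)
  show "subgroup M'.null (free_Abelian_group (carrier M' \<times> carrier S))"
    using M'.null_subgroup by (simp add: tensor_gens_def)
  show "u \<in> generate (free_Abelian_group (carrier M \<times> carrier S)) (tensor_rels A S \<phi> M)"
    using assms by (simp add: tensor_null_def tensor_gens_def)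
qed

lemma induced_cls:
  assumes u: "u \<in> carrier M.gens"
  shows "(\<Union>v\<in>M.cls u. M'.cls (induced v)) = M'.cls (induced u)"
proof -
  have "M'.cls (induced v) = M'.cls (induced u)" if "v \<in> M.cls u" for v
  proof -
    have v: "v \<in> carrier M.gens" "v - u \<in> M.null"
      using that u M.cls_eq_iff[of v u] by (auto simp: M.in_cls_iff)
    then have "induced v - induced u \<in> M'.null"
      using induced_null[of "v - u"] by (simp add: frag_extend_diff)
    then show ?thesis using M'.cls_eq_iff[OF induced_closed[OF v(1)] induced_closed[OF u]] by simp
  qed
  moreover have "u \<in> M.cls u" using u by (simp add: M.in_cls_iff)
  ultimately show ?thesis by blast
qed

end

context tensor
begin

lemma MS_smult_cls:
  assumes "t \<in> carrier S" "u \<in> carrier gens"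
  shows "frag_extend (\<lambda>(x, s). frag_of (x, s \<otimes>\<^bsub>S\<^esub> t)) u \<in> carrier gens"
    and "t \<odot>\<^bsub>MS\<^esub> cls u = cls (frag_extend (\<lambda>(x, s). frag_of (x, s \<otimes>\<^bsub>S\<^esub> t)) u)"
proof -
  interpret induced_map A S \<phi> M M "\<lambda>x. x" "\<lambda>s. s \<otimes>\<^bsub>S\<^esub> t"
    using assms(1) by unfold_locales (simp_all add: rmod_homI S.l_distr S.m_assoc)
  show "induced u \<in> carrier gens" by (rule induced_closed[OF assms(2)])
  show "t \<odot>\<^bsub>MS\<^esub> cls u = cls (induced u)"
    using induced_cls[OF assms(2)] by (simp add: extend_scalars_def Let_def)
qed

lemma MS_smult_tens:
  "\<lbrakk>t \<in> carrier S; x \<in> carrier M; s \<in> carrier S\<rbrakk> \<Longrightarrow> t \<odot>\<^bsub>MS\<^esub> tens x s = tens x (s \<otimes>\<^bsub>S\<^esub> t)"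
  by (simp add: tens_def MS_smult_cls)

lemma MS_smult_hom: "t \<in> carrier S \<Longrightarrow> abelian_group_hom MS MS (\<lambda>U. t \<odot>\<^bsub>MS\<^esub> U)"
  by (rule abelian_group_homI_additive)
    (auto simp: MS_abelian_group MS_simps MS_smult_cls frag_extend_add)

lemma MS_right_module: "right_module S MS"
proof (unfold_locales)
  note smult_closed = abelian_group_hom.hom_closed[OF MS_smult_hom]
    and smult_add = abelian_group_hom.hom_add[OF MS_smult_hom]
  show "a \<odot>\<^bsub>MS\<^esub> x \<in> carrier MS" if "a \<in> carrier S" "x \<in> carrier MS" for a x
    by (rule smult_closed[OF that])
  show "a \<odot>\<^bsub>MS\<^esub> (x \<oplus>\<^bsub>MS\<^esub> y) = a \<odot>\<^bsub>MS\<^esub> x \<oplus>\<^bsub>MS\<^esub> a \<odot>\<^bsub>MS\<^esub> y"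
    if "a \<in> carrier S" "x \<in> carrier MS" "y \<in> carrier MS" for a x y
    by (rule smult_add[OF that])
  show "(a \<oplus>\<^bsub>S\<^esub> b) \<odot>\<^bsub>MS\<^esub> x = a \<odot>\<^bsub>MS\<^esub> x \<oplus>\<^bsub>MS\<^esub> b \<odot>\<^bsub>MS\<^esub> x"
    if "a \<in> carrier S" "b \<in> carrier S" "x \<in> carrier MS" for a b x
    using that(3)
  proof (induction rule: tensor_induct)
    case (tens x s)
    then show ?case using that by (simp add: MS_smult_tens S.r_distr tens_add_right)
  next
    case (add U V)
    then show ?case using that by (simp add: smult_add smult_closed MS.a_ac)
  qed
  show "(a \<otimes>\<^bsub>S\<^esub> b) \<odot>\<^bsub>MS\<^esub> x = b \<odot>\<^bsub>MS\<^esub> (a \<odot>\<^bsub>MS\<^esub> x)"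
    if "a \<in> carrier S" "b \<in> carrier S" "x \<in> carrier MS" for a b x
    using that(3)
  proof (induction rule: tensor_induct)
    case (tens x s)
    then show ?case using that by (simp add: MS_smult_tens S.m_assoc)
  next
    case (add U V)
    then show ?case using that by (simp add: smult_add smult_closed)
  qed
  show "\<one>\<^bsub>S\<^esub> \<odot>\<^bsub>MS\<^esub> x = x" if "x \<in> carrier MS" for x
    using that
  proof (induction rule: tensor_induct)
    case (tens x s)
    then show ?case by (simp add: MS_smult_tens)
  next
    case (add U V)
    then show ?case by (simp add: smult_add)
  qed
qed

sublocale MS: right_module S MS
  by (rule MS_right_module)

lemma tens_one_rmod_hom: "(\<lambda>x. tens x \<one>\<^bsub>S\<^esub>) \<in> rmod_hom A M (restrict_scalars \<phi> MS)"
  by (rule rmod_homI) (simp_all add: tens_add_left tens_balanced MS_smult_tens phi_closed)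

lemma ex_extend_linear:
  fixes N :: "('s, 'p) module"
  assumes N: "right_module S N" and \<sigma>: "\<sigma> \<in> rmod_hom A M (restrict_scalars \<phi> N)"
  shows "\<exists>h\<in>rmod_hom S MS N. \<forall>x\<in>carrier M. \<forall>s\<in>carrier S. h (tens x s) = s \<odot>\<^bsub>N\<^esub> \<sigma> x"
proof -
  interpret N: right_module S N by (rule N)
  have \<sigma>_simps: "x \<in> carrier M \<Longrightarrow> \<sigma> x \<in> carrier N"
    "\<lbrakk>x \<in> carrier M; y \<in> carrier M\<rbrakk> \<Longrightarrow> \<sigma> (x \<oplus>\<^bsub>M\<^esub> y) = \<sigma> x \<oplus>\<^bsub>N\<^esub> \<sigma> y"
    "\<lbrakk>a \<in> carrier A; x \<in> carrier M\<rbrakk> \<Longrightarrow> \<sigma> (a \<odot>\<^bsub>M\<^esub> x) = \<phi> a \<odot>\<^bsub>N\<^esub> \<sigma> x" for x y a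
    using rmod_hom_closed[OF \<sigma>] rmod_hom_add[OF \<sigma>] rmod_hom_smult[OF \<sigma>] by simp_all
  obtain h where h: "abelian_group_hom MS N h"
    "\<And>x s. \<lbrakk>x \<in> carrier M; s \<in> carrier S\<rbrakk> \<Longrightarrow> h (tens x s) = s \<odot>\<^bsub>N\<^esub> \<sigma> x"
    using ex_tensor_lift[OF N.M.abelian_group_axioms, of "\<lambda>x s. s \<odot>\<^bsub>N\<^esub> \<sigma> x"]
    by (auto simp: \<sigma>_simps phi_closed N.smult_closed N.smult_l_distr N.smult_r_distr N.smult_assoc)
  interpret h: abelian_group_hom MS N h by (rule h(1))
  have "h (t \<odot>\<^bsub>MS\<^esub> U) = t \<odot>\<^bsub>N\<^esub> h U" if t: "t \<in> carrier S" and U: "U \<in> carrier MS" for t U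
    using U
  proof (induction rule: tensor_induct)
    case (tens x s)
    then show ?case using t by (simp add: MS_smult_tens h(2) \<sigma>_simps N.smult_assoc)
  next
    case (add U V)
    then show ?case using t by (simp add: MS.smult_r_distr MS.smult_closed N.smult_r_distr)
  qed
  then have "h \<in> rmod_hom S MS N" by (intro rmod_homI) simp_all
  then show ?thesis using h(2) by blast
qed

definition extend_linear :: "('s, 'p) module \<Rightarrow> ('m \<Rightarrow> 'p) \<Rightarrow> ('m, 's) tensor_elem \<Rightarrow> 'p" where
  "extend_linear N \<sigma> = (SOME h. h \<in> rmod_hom S MS N \<and>
     (\<forall>x\<in>carrier M. \<forall>s\<in>carrier S. h (tens x s) = s \<odot>\<^bsub>N\<^esub> \<sigma> x))"

lemma
  assumes "right_module S N" "\<sigma> \<in> rmod_hom A M (restrict_scalars \<phi> N)"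
  shows extend_linear_rmod_hom: "extend_linear N \<sigma> \<in> rmod_hom S MS N"
    and extend_linear_tens: "\<lbrakk>x \<in> carrier M; s \<in> carrier S\<rbrakk> \<Longrightarrow>
      extend_linear N \<sigma> (tens x s) = s \<odot>\<^bsub>N\<^esub> \<sigma> x"
  using someI_ex[OF ex_extend_linear[OF assms, unfolded Bex_def]] by (auto simp: extend_linear_def)

abbreviation extend_functional :: "('m \<Rightarrow> 'a) \<Rightarrow> ('m, 's) tensor_elem \<Rightarrow> 's" where
  "extend_functional \<theta> \<equiv> extend_linear (regular_rmodule S) (\<lambda>x. \<phi> (\<theta> x))"

lemma
  assumes "\<theta> \<in> rmod_hom A M (regular_rmodule A)"
  shows extend_functional_rmod_hom: "extend_functional \<theta> \<in> rmod_hom S MS (regular_rmodule S)"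
    and extend_functional_tens: "\<lbrakk>x \<in> carrier M; s \<in> carrier S\<rbrakk> \<Longrightarrow>
      extend_functional \<theta> (tens x s) = \<phi> (\<theta> x) \<otimes>\<^bsub>S\<^esub> s"
proof -
  have "(\<lambda>x. \<phi> (\<theta> x)) \<in> rmod_hom A M (restrict_scalars \<phi> (regular_rmodule S))"
    using rmod_hom_closed[OF assms] rmod_hom_add[OF assms] rmod_hom_smult[OF assms]
    by (intro rmod_homI)
      (simp_all add: phi_closed ring_hom_add[OF phi_hom] ring_hom_mult[OF phi_hom])
  note linear = S.regular_rmodule_right_module this
  show "extend_functional \<theta> \<in> rmod_hom S MS (regular_rmodule S)"
    by (rule extend_linear_rmod_hom[OF linear])
  show "\<lbrakk>x \<in> carrier M; s \<in> carrier S\<rbrakk> \<Longrightarrow> extend_functional \<theta> (tens x s) = \<phi> (\<theta> x) \<otimes>\<^bsub>S\<^esub> s"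
    by (simp add: extend_linear_tens[OF linear])
qed

lemma extend_functional_hom:
  "\<theta> \<in> rmod_hom A M (regular_rmodule A) \<Longrightarrow> abelian_group_hom MS S (extend_functional \<theta>)"
  by (rule functional_abelian_group_hom[OF extend_functional_rmod_hom MS_right_module])

end

locale tensor_map = tensor_pair A S \<phi> M M'
  for A :: "('a, 'r) ring_scheme" and S :: "('s, 't) ring_scheme" and \<phi> :: "'a \<Rightarrow> 's"
    and M :: "('a, 'm) module" and M' :: "('a, 'p) module" +
  fixes h :: "'m \<Rightarrow> 'p"
  assumes hom: "h \<in> rmod_hom A M M'"
begin

lemma extend_map_cls:
  assumes "u \<in> carrier M.gens"
  shows "frag_extend (\<lambda>(x, s). frag_of (h x, s)) u \<in> carrier M'.gens"
    and "extend_map A S \<phi> M' h (M.cls u) = M'.cls (frag_extend (\<lambda>(x, s). frag_of (h x, s)) u)"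
proof -
  interpret induced_map A S \<phi> M M' h "\<lambda>s. s"
    by unfold_locales (simp_all add: hom)
  show "induced u \<in> carrier M'.gens" by (rule induced_closed[OF assms])
  show "extend_map A S \<phi> M' h (M.cls u) = M'.cls (induced u)"
    using induced_cls[OF assms] by (simp add: extend_map_def)
qed

lemma extend_map_tens:
  "\<lbrakk>x \<in> carrier M; s \<in> carrier S\<rbrakk> \<Longrightarrow> extend_map A S \<phi> M' h (M.tens x s) = M'.tens (h x) s"
  by (simp add: M.tens_def M'.tens_def extend_map_cls)

lemma extend_map_rmod_hom: "extend_map A S \<phi> M' h \<in> rmod_hom S M.MS M'.MS"
proof -
  have "abelian_group_hom M.MS M'.MS (extend_map A S \<phi> M' h)"
    by (rule abelian_group_homI_additive)
      (auto simp: M.MS_abelian_group M'.MS_abelian_group M.MS_simps M'.MS_simps extend_map_cls frag_extend_add)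
  then interpret abelian_group_hom M.MS M'.MS "extend_map A S \<phi> M' h" .
  have "extend_map A S \<phi> M' h (a \<odot>\<^bsub>M.MS\<^esub> U) = a \<odot>\<^bsub>M'.MS\<^esub> extend_map A S \<phi> M' h U"
    if "a \<in> carrier S" "U \<in> carrier M.MS" for a U
    using that(2)
  proof (induction rule: M.tensor_induct)
    case (tens x s)
    then show ?case
      using that(1) rmod_hom_closed[OF hom] by (simp add: M.MS_smult_tens M'.MS_smult_tens extend_map_tens)
  next
    case (add U V)
    then show ?case
      using that(1) by (simp add: M.MS.smult_r_distr M'.MS.smult_r_distr M.MS.smult_closed)
  qed
  then show ?thesis by (intro rmod_homI) simp_all
qed

end

lemma (in tensor) dual_basis_extend_scalars:
  assumes "dual_basis A M X \<theta> e"
  shows "dual_basis S MS X (\<lambda>i. extend_functional (\<theta> i)) (\<lambda>i. tens (e i) \<one>\<^bsub>S\<^esub>)"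
proof (rule dual_basisI_expands)
  interpret dual_basis A M X \<theta> e by fact
  let ?\<Theta> = "\<lambda>i. extend_functional (\<theta> i)"
  show \<Theta>: "?\<Theta> i \<in> rmod_hom S MS (regular_rmodule S)" if "i \<in> X" for i
    by (rule extend_functional_rmod_hom[OF functional[OF that]])
  show generator: "tens (e i) \<one>\<^bsub>S\<^esub> \<in> carrier MS" if "i \<in> X" for i
    using generator_closed[OF that] by simp
  show "expands S MS X ?\<Theta> (\<lambda>i. tens (e i) \<one>\<^bsub>S\<^esub>) U" if "U \<in> carrier MS" for U
    using that
  proof (induction rule: tensor_induct)
    case (tens x s)
    have closed: "i \<in> X \<Longrightarrow> \<theta> i x \<odot>\<^bsub>M\<^esub> e i \<in> carrier M" for i
      using tens(1) by (simp add: M.smult_closed functional_closed generator_closed)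
    have "\<phi> \<zero>\<^bsub>A\<^esub> = \<zero>\<^bsub>S\<^esub>"
      using phi_hom by (rule ring_hom_zero) (rule M.R.ring_axioms S.ring_axioms)+
    moreover have "\<forall>\<^sub>F J in finite_subsets_at_top X. J \<subseteq> X"
      by (rule eventually_finite_subsets_at_top_weakI)
    with expands[OF tens(1), unfolded expands_def] show ?case
      unfolding expands_def
    proof eventually_elim
      case (elim J)
      then have in_X: "i \<in> X" if "i \<in> J" for i using that by blast
      have "(\<Oplus>\<^bsub>MS\<^esub>i\<in>J. ?\<Theta> i (tens x s) \<odot>\<^bsub>MS\<^esub> tens (e i) \<one>\<^bsub>S\<^esub>) = (\<Oplus>\<^bsub>MS\<^esub>i\<in>J. tens (\<theta> i x \<odot>\<^bsub>M\<^esub> e i) s)"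
        by (rule MS.finsum_cong')
          (simp_all add: in_X tens closed functional_closed generator_closed phi_closed
            extend_functional_tens[OF functional] MS_smult_tens tens_balanced)
      also have "\<dots> = tens (\<Oplus>\<^bsub>M\<^esub>i\<in>J. \<theta> i x \<odot>\<^bsub>M\<^esub> e i) s"
        using in_X closed
        by (intro abelian_group_hom.hom_finsum[OF tens_left_hom[OF tens(2)], symmetric]) auto
      finally show ?case
        using elim tens \<open>\<phi> \<zero>\<^bsub>A\<^esub> = \<zero>\<^bsub>S\<^esub>\<close> by (auto simp: extend_functional_tens[OF functional])
    qed
  qed (rule expands_add[OF MS_right_module \<Theta> generator])
qed (rule MS_right_module)

lemma extend_complex_simps [simp]:
  "obj (extend_complex A S \<phi> D) k = extend_scalars A S \<phi> (obj D k)"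
  "differential (extend_complex A S \<phi> D) k = extend_map A S \<phi> (obj D (k + 1)) (differential D k)"
  by (simp_all add: extend_complex_def)

locale extension =
  fixes A :: "('a, 'r) ring_scheme" and S :: "('s, 't) ring_scheme" and \<phi> :: "'a \<Rightarrow> 's"
  assumes target_ring: "ring S" and extension_hom: "\<phi> \<in> ring_hom A S"
begin

lemma tensorI: "right_module A M \<Longrightarrow> tensor A S \<phi> M"
  by (simp add: tensor_def tensor_axioms_def target_ring extension_hom)

lemma tensor_mapI:
  "\<lbrakk>right_module A M; right_module A N; h \<in> rmod_hom A M N\<rbrakk> \<Longrightarrow> tensor_map A S \<phi> M N h"
  by (simp add: tensor_map_def tensor_map_axioms_def tensor_pair_def tensorI)

abbreviation tens :: "('a, 'm) module \<Rightarrow> 'm \<Rightarrow> 's \<Rightarrow> ('m, 's) tensor_elem" where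
  "tens M \<equiv> tensor.tens A S \<phi> M"

lemmas extend_map_tens = tensor_map.extend_map_tens[OF tensor_mapI]
  and extend_map_rmod_hom = tensor_map.extend_map_rmod_hom[OF tensor_mapI]
  and extend_scalars_right_module = tensor.MS_right_module[OF tensorI]

lemma rmod_hom_tensor_eqI:
  assumes "right_module A M" "right_module S N" "f \<in> rmod_hom S (extend_scalars A S \<phi> M) N"
    "g \<in> rmod_hom S (extend_scalars A S \<phi> M) N" "U \<in> carrier (extend_scalars A S \<phi> M)"
    and "\<And>x s. \<lbrakk>x \<in> carrier M; s \<in> carrier S\<rbrakk> \<Longrightarrow> f (tens M x s) = g (tens M x s)"
  shows "f U = g U"
  by (rule tensor.tensor_hom_eqI[OF tensorI])
    (rule assms rmod_hom_abelian_group_hom extend_scalars_right_module | assumption)+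

lemma extend_map_id:
  assumes M: "right_module A M" and U: "U \<in> carrier (extend_scalars A S \<phi> M)"
  shows "extend_map A S \<phi> M (\<lambda>x. x) U = U"
proof (rule rmod_hom_tensor_eqI[OF M extend_scalars_right_module[OF M] _ _ U])
  have id: "(\<lambda>x. x) \<in> rmod_hom A M M" by (rule rmod_homI) simp_all
  show "extend_map A S \<phi> M (\<lambda>x. x) \<in> rmod_hom S (extend_scalars A S \<phi> M) (extend_scalars A S \<phi> M)"
    by (rule extend_map_rmod_hom[OF M M id])
  show "(\<lambda>U. U) \<in> rmod_hom S (extend_scalars A S \<phi> M) (extend_scalars A S \<phi> M)"
    by (rule rmod_homI) simp_all
  show "extend_map A S \<phi> M (\<lambda>x. x) (tens M x s) = tens M x s" if "x \<in> carrier M" "s \<in> carrier S" for x s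
    by (rule extend_map_tens[OF M M id that])
qed

lemma extend_complex_cochain_complex:
  assumes "cochain_complex A D"
  shows "cochain_complex S (extend_complex A S \<phi> D)"
  unfolding cochain_complex_def extend_complex_simps
proof (intro conjI allI ballI)
  interpret D: cochain A D by (rule cochain.intro) fact
  note d_hom = extend_map_rmod_hom[OF D.obj_module D.obj_module D.differential_hom]
  fix k
  show "right_module S (extend_scalars A S \<phi> (obj D k))"
    by (rule extend_scalars_right_module[OF D.obj_module])
  show "extend_map A S \<phi> (obj D (k + 1)) (differential D k) \<in>
      rmod_hom S (extend_scalars A S \<phi> (obj D k)) (extend_scalars A S \<phi> (obj D (k + 1)))"
    by (rule d_hom)
  fix U assume U: "U \<in> carrier (extend_scalars A S \<phi> (obj D k))"
  let ?N = "extend_scalars A S \<phi> (obj D (k + 1 + 1))"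
  show "extend_map A S \<phi> (obj D (k + 1 + 1)) (differential D (k + 1))
      (extend_map A S \<phi> (obj D (k + 1)) (differential D k) U) = \<zero>\<^bsub>?N\<^esub>"
  proof (rule rmod_hom_tensor_eqI[OF D.obj_module extend_scalars_right_module[OF D.obj_module] _ _ U])
    show "(\<lambda>U. extend_map A S \<phi> (obj D (k + 1 + 1)) (differential D (k + 1))
        (extend_map A S \<phi> (obj D (k + 1)) (differential D k) U))
        \<in> rmod_hom S (extend_scalars A S \<phi> (obj D k)) ?N"
      by (rule rmod_hom_comp[OF d_hom d_hom])
    show "(\<lambda>U. \<zero>\<^bsub>?N\<^esub>) \<in> rmod_hom S (extend_scalars A S \<phi> (obj D k)) ?N"
      by (rule rmod_hom_zero[OF extend_scalars_right_module[OF D.obj_module]])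
    fix x s assume xs: "x \<in> carrier (obj D k)" "s \<in> carrier S"
    show "extend_map A S \<phi> (obj D (k + 1 + 1)) (differential D (k + 1))
        (extend_map A S \<phi> (obj D (k + 1)) (differential D k) (tens (obj D k) x s)) = \<zero>\<^bsub>?N\<^esub>"
      using xs D.differential_closed[OF xs(1)] D.differential_differential[OF xs(1)]
        abelian_group_hom.hom_zero[OF tensor.tens_left_hom[OF tensorI[OF D.obj_module] xs(2)]]
      by (simp only: extend_map_tens[OF D.obj_module D.obj_module D.differential_hom])
  qed
qed

lemma extend_cochain_map:
  assumes "cochain_complex A C" "cochain_complex A D" "cochain_map A C D f"
  shows "cochain_map S (extend_complex A S \<phi> C) (extend_complex A S \<phi> D)
    (\<lambda>k. extend_map A S \<phi> (obj D k) (f k))"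
  unfolding cochain_map_def extend_complex_simps
proof (intro conjI allI ballI)
  interpret C: cochain A C by (rule cochain.intro) fact
  interpret D: cochain A D by (rule cochain.intro) fact
  note f_hom = cochain_map_hom[OF assms(3)]
  note d_map = C.obj_module C.obj_module C.differential_hom
    and d'_map = D.obj_module D.obj_module D.differential_hom
    and f_map = C.obj_module D.obj_module f_hom
  fix k
  show "extend_map A S \<phi> (obj D k) (f k) \<in>
      rmod_hom S (extend_scalars A S \<phi> (obj C k)) (extend_scalars A S \<phi> (obj D k))"
    by (rule extend_map_rmod_hom[OF f_map])
  fix U assume U: "U \<in> carrier (extend_scalars A S \<phi> (obj C k))"
  show "extend_map A S \<phi> (obj D (k + 1)) (f (k + 1)) (extend_map A S \<phi> (obj C (k + 1)) (differential C k) U)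
      = extend_map A S \<phi> (obj D (k + 1)) (differential D k) (extend_map A S \<phi> (obj D k) (f k) U)"
  proof (rule rmod_hom_tensor_eqI[OF C.obj_module extend_scalars_right_module[OF D.obj_module] _ _ U])
    fix x s assume "x \<in> carrier (obj C k)" "s \<in> carrier S"
    then show "extend_map A S \<phi> (obj D (k + 1)) (f (k + 1))
        (extend_map A S \<phi> (obj C (k + 1)) (differential C k) (tens (obj C k) x s))
      = extend_map A S \<phi> (obj D (k + 1)) (differential D k)
        (extend_map A S \<phi> (obj D k) (f k) (tens (obj C k) x s))"
      by (simp add: extend_map_tens[OF d_map] extend_map_tens[OF d'_map] extend_map_tens[OF f_map]
          C.differential_closed rmod_hom_closed[OF f_hom] cochain_map_commute[OF assms(3)])
  qed (rule rmod_hom_comp[OF extend_map_rmod_hom[OF f_map] extend_map_rmod_hom[OF d_map]]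
      rmod_hom_comp[OF extend_map_rmod_hom[OF d'_map] extend_map_rmod_hom[OF f_map]])+
qed

lemma extend_map_homotopy:
  assumes M: "right_module A M" "right_module A M'" and N: "right_module A N" "right_module A N'"
    and f: "f \<in> rmod_hom A M N" and g: "g \<in> rmod_hom A M N"
    and d: "d \<in> rmod_hom A M M'" and d': "d' \<in> rmod_hom A N' N"
    and s: "s \<in> rmod_hom A M N'" and s': "s' \<in> rmod_hom A M' N"
    and eq: "\<And>x. x \<in> carrier M \<Longrightarrow> f x \<ominus>\<^bsub>N\<^esub> g x = d' (s x) \<oplus>\<^bsub>N\<^esub> s' (d x)"
    and U: "U \<in> carrier (extend_scalars A S \<phi> M)"
  shows "extend_map A S \<phi> N f U \<ominus>\<^bsub>extend_scalars A S \<phi> N\<^esub> extend_map A S \<phi> N g U =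
    extend_map A S \<phi> N d' (extend_map A S \<phi> N' s U) \<oplus>\<^bsub>extend_scalars A S \<phi> N\<^esub>
    extend_map A S \<phi> N s' (extend_map A S \<phi> M' d U)"
proof (rule rmod_hom_tensor_eqI[OF M(1) extend_scalars_right_module[OF N(1)] _ _ U])
  interpret N: tensor A S \<phi> N by (rule tensorI[OF N(1)])
  note f_map = M(1) N(1) f and g_map = M(1) N(1) g and d_map = M d and s_map = M(1) N(2) s
    and d'_map = N(2,1) d' and s'_map = M(2) N(1) s'
  show "(\<lambda>U. extend_map A S \<phi> N f U \<ominus>\<^bsub>N.MS\<^esub> extend_map A S \<phi> N g U)
      \<in> rmod_hom S (extend_scalars A S \<phi> M) N.MS"
    by (rule rmod_hom_minus[OF N.MS_right_module extend_map_rmod_hom[OF f_map] extend_map_rmod_hom[OF g_map]])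
  show "(\<lambda>U. extend_map A S \<phi> N d' (extend_map A S \<phi> N' s U) \<oplus>\<^bsub>N.MS\<^esub>
      extend_map A S \<phi> N s' (extend_map A S \<phi> M' d U)) \<in> rmod_hom S (extend_scalars A S \<phi> M) N.MS"
    by (rule rmod_hom_plus[OF N.MS_right_module
          rmod_hom_comp[OF extend_map_rmod_hom[OF d'_map] extend_map_rmod_hom[OF s_map]]
          rmod_hom_comp[OF extend_map_rmod_hom[OF s'_map] extend_map_rmod_hom[OF d_map]]])
  fix x t assume x: "x \<in> carrier M" and t: "t \<in> carrier S"
  interpret left: abelian_group_hom N N.MS "\<lambda>x. N.tens x t" by (rule N.tens_left_hom[OF t])
  note closed = rmod_hom_closed[OF f x] rmod_hom_closed[OF g x] rmod_hom_closed[OF s x] rmod_hom_closed[OF d x]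
  have "N.tens (f x) t \<ominus>\<^bsub>N.MS\<^esub> N.tens (g x) t = N.tens (d' (s x)) t \<oplus>\<^bsub>N.MS\<^esub> N.tens (s' (d x)) t"
    using left.hom_minus[of "f x" "g x"] closed eq[OF x] rmod_hom_closed[OF d'] rmod_hom_closed[OF s'] by simp
  then show "extend_map A S \<phi> N f (tens M x t) \<ominus>\<^bsub>N.MS\<^esub> extend_map A S \<phi> N g (tens M x t) =
      extend_map A S \<phi> N d' (extend_map A S \<phi> N' s (tens M x t)) \<oplus>\<^bsub>N.MS\<^esub>
      extend_map A S \<phi> N s' (extend_map A S \<phi> M' d (tens M x t))"
    using x t closed
    by (simp add: extend_map_tens[OF f_map] extend_map_tens[OF g_map] extend_map_tens[OF s_map]
        extend_map_tens[OF s'_map] extend_map_tens[OF d_map] extend_map_tens[OF d'_map])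
qed

lemma extend_cochain_homotopic:
  assumes "cochain_complex A C" "cochain_complex A D" and f: "cochain_map A C D f"
    and g: "cochain_map A C D g" and "cochain_homotopic A C D f g"
  shows "cochain_homotopic S (extend_complex A S \<phi> C) (extend_complex A S \<phi> D)
    (\<lambda>k. extend_map A S \<phi> (obj D k) (f k)) (\<lambda>k. extend_map A S \<phi> (obj D k) (g k))"
proof -
  interpret C: cochain A C by (rule cochain.intro) fact
  interpret D: cochain A D by (rule cochain.intro) fact
  obtain s where s: "\<And>k. s k \<in> rmod_hom A (obj C k) (obj D (k - 1))"
    and s_eq: "\<And>k x. x \<in> carrier (obj C k) \<Longrightarrow> f k x \<ominus>\<^bsub>obj D k\<^esub> g k x =
      differential D (k - 1) (s k x) \<oplus>\<^bsub>obj D k\<^esub> s (k + 1) (differential C k x)"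
    using assms(5) by (auto simp: cochain_homotopic_def)
  have s': "s (k + 1) \<in> rmod_hom A (obj C (k + 1)) (obj D k)" for k
    using s[of "k + 1"] by simp
  have "extend_map A S \<phi> (obj D (k - 1)) (s k) \<in>
      rmod_hom S (extend_scalars A S \<phi> (obj C k)) (extend_scalars A S \<phi> (obj D (k - 1)))" for k
    by (rule extend_map_rmod_hom[OF C.obj_module D.obj_module s])
  moreover note extend_map_homotopy[OF C.obj_module C.obj_module D.obj_module D.obj_module
      cochain_map_hom[OF f] cochain_map_hom[OF g] C.differential_hom D.differential_hom_pred s s' s_eq]
  ultimately show ?thesis
    unfolding cochain_homotopic_def
    by (intro exI[of _ "\<lambda>k. extend_map A S \<phi> (obj D (k - 1)) (s k)"]) simp
qed

lemma extend_linear_contraction: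
  assumes M: "right_module A M" "right_module A M'" and N: "right_module S N"
    and d: "d \<in> rmod_hom A M M'" and d': "d' \<in> rmod_hom S N (extend_scalars A S \<phi> M)"
    and \<sigma>: "\<sigma> \<in> rmod_hom A M (restrict_scalars \<phi> N)"
    and \<sigma>': "\<sigma>' \<in> rmod_hom A M' (restrict_scalars \<phi> (extend_scalars A S \<phi> M))"
    and eq: "\<And>x. x \<in> carrier M \<Longrightarrow>
      tens M x \<one>\<^bsub>S\<^esub> = d' (\<sigma> x) \<oplus>\<^bsub>extend_scalars A S \<phi> M\<^esub> \<sigma>' (d x)"
    and U: "U \<in> carrier (extend_scalars A S \<phi> M)"
  shows "U = d' (tensor.extend_linear A S \<phi> M N \<sigma> U) \<oplus>\<^bsub>extend_scalars A S \<phi> M\<^esub>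
    tensor.extend_linear A S \<phi> M' (extend_scalars A S \<phi> M) \<sigma>' (extend_map A S \<phi> M' d U)"
proof (rule rmod_hom_tensor_eqI[OF M(1) extend_scalars_right_module[OF M(1)] _ _ U])
  interpret M: tensor A S \<phi> M by (rule tensorI[OF M(1)])
  interpret M': tensor A S \<phi> M' by (rule tensorI[OF M(2)])
  show "(\<lambda>U. U) \<in> rmod_hom S M.MS M.MS" by (rule rmod_homI) simp_all
  show "(\<lambda>U. d' (M.extend_linear N \<sigma> U) \<oplus>\<^bsub>M.MS\<^esub> M'.extend_linear M.MS \<sigma>' (extend_map A S \<phi> M' d U))
      \<in> rmod_hom S M.MS M.MS"
    by (rule rmod_hom_plus[OF M.MS_right_module rmod_hom_comp[OF d' M.extend_linear_rmod_hom[OF N \<sigma>]]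
          rmod_hom_comp[OF M'.extend_linear_rmod_hom[OF M.MS_right_module \<sigma>'] extend_map_rmod_hom[OF M d]]])
  fix x s assume x: "x \<in> carrier M" and s: "s \<in> carrier S"
  have \<sigma>x: "\<sigma> x \<in> carrier N" "\<sigma>' (d x) \<in> carrier M.MS"
    using rmod_hom_closed[OF \<sigma> x] rmod_hom_closed[OF \<sigma>' rmod_hom_closed[OF d x]] by simp_all
  have "M.tens x s = s \<odot>\<^bsub>M.MS\<^esub> M.tens x \<one>\<^bsub>S\<^esub>"
    using x s by (simp add: M.MS_smult_tens)
  also have "\<dots> = s \<odot>\<^bsub>M.MS\<^esub> d' (\<sigma> x) \<oplus>\<^bsub>M.MS\<^esub> s \<odot>\<^bsub>M.MS\<^esub> \<sigma>' (d x)"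
    unfolding eq[OF x] using s \<sigma>x rmod_hom_closed[OF d'] by (intro M.MS.smult_r_distr) simp_all
  also have "s \<odot>\<^bsub>M.MS\<^esub> d' (\<sigma> x) = d' (M.extend_linear N \<sigma> (M.tens x s))"
    using x s \<sigma>x by (simp add: M.extend_linear_tens[OF N \<sigma>] rmod_hom_smult[OF d'])
  also have "s \<odot>\<^bsub>M.MS\<^esub> \<sigma>' (d x) = M'.extend_linear M.MS \<sigma>' (extend_map A S \<phi> M' d (M.tens x s))"
    using x s
    by (simp add: extend_map_tens[OF M d] M'.extend_linear_tens[OF M.MS_right_module \<sigma>'] rmod_hom_closed[OF d])
  finally show "M.tens x s = d' (M.extend_linear N \<sigma> (M.tens x s)) \<oplus>\<^bsub>M.MS\<^esub>
      M'.extend_linear M.MS \<sigma>' (extend_map A S \<phi> M' d (M.tens x s))" .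
qed

lemma contractible_extend_complex:
  assumes "cochain_complex A D"
    and "cochain_homotopic A D (restrict_complex \<phi> (extend_complex A S \<phi> D))
      (\<lambda>k x. tens (obj D k) x \<one>\<^bsub>S\<^esub>) (\<lambda>k x. \<zero>\<^bsub>extend_scalars A S \<phi> (obj D k)\<^esub>)"
  shows "contractible_complex S (extend_complex A S \<phi> D)"
proof -
  interpret D: cochain A D by (rule cochain.intro) fact
  let ?T = "\<lambda>k. extend_scalars A S \<phi> (obj D k)"
  have minus_zero: "U \<ominus>\<^bsub>?T k\<^esub> \<zero>\<^bsub>?T k\<^esub> = U" if "U \<in> carrier (?T k)" for U k
    using tensor.MS_abelian_group[OF tensorI[OF D.obj_module]] that by (rule abelian_group.minus_zero_right)
  have tens_closed: "tens (obj D k) x \<one>\<^bsub>S\<^esub> \<in> carrier (?T k)" if "x \<in> carrier (obj D k)" for k x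
    using tensor.tens_closed[OF tensorI[OF D.obj_module] that] ring.ring_simprules(6)[OF target_ring] by simp
  obtain \<sigma> where \<sigma>: "\<And>k. \<sigma> k \<in> rmod_hom A (obj D k) (restrict_scalars \<phi> (?T (k - 1)))"
    and null_homotopy: "\<forall>k. \<forall>x\<in>carrier (obj D k). tens (obj D k) x \<one>\<^bsub>S\<^esub> \<ominus>\<^bsub>?T k\<^esub> \<zero>\<^bsub>?T k\<^esub> =
      extend_map A S \<phi> (obj D k) (differential D (k - 1)) (\<sigma> k x) \<oplus>\<^bsub>?T k\<^esub> \<sigma> (k + 1) (differential D k x)"
    using assms(2) by (auto simp: cochain_homotopic_def)
  have \<sigma>_eq: "tens (obj D k) x \<one>\<^bsub>S\<^esub> =
      extend_map A S \<phi> (obj D k) (differential D (k - 1)) (\<sigma> k x) \<oplus>\<^bsub>?T k\<^esub> \<sigma> (k + 1) (differential D k x)"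
    if "x \<in> carrier (obj D k)" for k x
    using null_homotopy that minus_zero[OF tens_closed[OF that]] by simp
  have \<sigma>': "\<sigma> (k + 1) \<in> rmod_hom A (obj D (k + 1)) (restrict_scalars \<phi> (?T k))" for k
    using \<sigma>[of "k + 1"] by simp
  note T_module = extend_scalars_right_module[OF D.obj_module]
  let ?h = "\<lambda>k. tensor.extend_linear A S \<phi> (obj D k) (?T (k - 1)) (\<sigma> k)"
  have "?h k \<in> rmod_hom S (?T k) (?T (k - 1))" for k
    by (rule tensor.extend_linear_rmod_hom[OF tensorI[OF D.obj_module] T_module \<sigma>])
  moreover note extend_linear_contraction[OF D.obj_module D.obj_module T_module D.differential_hom
      extend_map_rmod_hom[OF D.obj_module D.obj_module D.differential_hom_pred] \<sigma> \<sigma>' \<sigma>_eq]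
  ultimately show ?thesis
    unfolding contractible_complex_def cochain_homotopic_def
    by (intro exI[of _ ?h]) (simp add: minus_zero)
qed

end

section \<open>Novikov rings\<close>

definition supp_bound :: "('a, 'r) ring_scheme \<Rightarrow> int \<Rightarrow> (int ^ 'n \<Rightarrow> 'a) \<Rightarrow> bool" where
  "supp_bound R k f \<longleftrightarrow> (\<forall>a. f a \<noteq> \<zero>\<^bsub>R\<^esub> \<longrightarrow> (\<forall>i. - k \<le> a $ i))"

lemma supp_bound_mono: "\<lbrakk>supp_bound R k f; k \<le> l\<rbrakk> \<Longrightarrow> supp_bound R l f"
  unfolding supp_bound_def by (meson minus_le_iff neg_le_iff_le order_trans)

definition monomial :: "('a, 'r) ring_scheme \<Rightarrow> int ^ 'n \<Rightarrow> 'a \<Rightarrow> (int ^ 'n \<Rightarrow> 'a)" where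
  "monomial R a r = (\<lambda>b. if b = a then r else \<zero>\<^bsub>R\<^esub>)"

lemma laurent_const_eq_monomial: "laurent_const R r = monomial R 0 r"
  by (simp add: laurent_const_def monomial_def)

definition vec_box :: "int \<Rightarrow> int ^ 'n \<Rightarrow> (int ^ 'n) set" where
  "vec_box k a = {b. \<forall>i. - k \<le> b $ i \<and> b $ i \<le> a $ i + k}"

lemma finite_vec_box: "finite (vec_box k (a :: int ^ 'n::finite))"
proof (rule finite_subset)
  show "vec_box k a \<subseteq> vec_lambda ` (\<Pi>\<^sub>E i\<in>UNIV. {- k..a $ i + k})"
  proof
    fix b assume "b \<in> vec_box k a"
    then show "b \<in> vec_lambda ` (\<Pi>\<^sub>E i\<in>UNIV. {- k..a $ i + k})"
      by (intro image_eqI[of _ _ "vec_nth b"]) (auto simp: vec_box_def)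
  qed
  show "finite (vec_lambda ` (\<Pi>\<^sub>E i\<in>UNIV. {- k..a $ i + k}) :: (int ^ 'n) set)"
    by (intro finite_imageI finite_PiE) auto
qed

context ring
begin

abbreviation "Nov \<equiv> novikov_ring R :: (int ^ 'n::finite \<Rightarrow> 'a) ring"
abbreviation "Lau \<equiv> laurent_ring R :: (int ^ 'n::finite \<Rightarrow> 'a) ring"

lemma novikov_simps:
  "\<one>\<^bsub>Nov\<^esub> = monomial R 0 \<one>" "\<zero>\<^bsub>Nov\<^esub> = (\<lambda>a. \<zero>)" "f \<oplus>\<^bsub>Nov\<^esub> g = (\<lambda>a. f a \<oplus> g a)"
  by (simp_all add: novikov_ring_def monomial_def)

lemma laurent_simps:
  "\<one>\<^bsub>Lau\<^esub> = \<one>\<^bsub>Nov\<^esub>" "\<zero>\<^bsub>Lau\<^esub> = \<zero>\<^bsub>Nov\<^esub>" "f \<oplus>\<^bsub>Lau\<^esub> g = f \<oplus>\<^bsub>Nov\<^esub> g" "f \<otimes>\<^bsub>Lau\<^esub> g = f \<otimes>\<^bsub>Nov\<^esub> g"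
  by (simp_all add: laurent_ring_def)

lemma novikov_carrier_iff:
  fixes f :: "int ^ 'n::finite \<Rightarrow> 'a"
  shows "f \<in> carrier Nov \<longleftrightarrow> (\<forall>a. f a \<in> carrier R) \<and> (\<exists>k. supp_bound R k f)"
proof -
  have "supp_bound R (int (nat k)) f" if "supp_bound R k f" for k
    by (rule supp_bound_mono[OF that]) simp
  moreover have "(\<forall>a\<in>supp R f. \<forall>i. 0 \<le> int k + a $ i) \<longleftrightarrow> supp_bound R (int k) f" for k
  proof -
    have "0 \<le> int k + x \<longleftrightarrow> - int k \<le> x" for x by linarith
    then show ?thesis by (simp add: supp_bound_def supp_def)
  qed
  ultimately have "(\<exists>k::nat. \<forall>a\<in>supp R f. \<forall>i. 0 \<le> int k + a $ i) \<longleftrightarrow> (\<exists>k. supp_bound R k f)"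
    by blast
  then show ?thesis
    by (auto simp: novikov_ring_def)
qed

lemma laurent_carrier_iff: "f \<in> carrier Lau \<longleftrightarrow> (\<forall>a. f a \<in> carrier R) \<and> finite {a. f a \<noteq> \<zero>}"
  by (auto simp: laurent_ring_def supp_def)

lemma novikov_coeff_closed: "f \<in> carrier Nov \<Longrightarrow> f a \<in> carrier R"
  by (simp add: novikov_carrier_iff)

lemma laurent_coeff_closed: "f \<in> carrier Lau \<Longrightarrow> f a \<in> carrier R"
  by (simp add: laurent_carrier_iff)

lemma laurent_subset_novikov: "carrier Lau \<subseteq> carrier Nov"
proof
  fix f :: "int ^ 'n \<Rightarrow> 'a" assume f: "f \<in> carrier Lau"
  let ?S = "insert 0 ((\<lambda>(a, i). - a $ i) ` ({a. f a \<noteq> \<zero>} \<times> UNIV))"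
  have "finite ?S" using f by (simp add: laurent_carrier_iff)
  then have "- a $ i \<le> Max ?S" if "f a \<noteq> \<zero>" for a i
    using that by (intro Max_ge) auto
  then have "supp_bound R (Max ?S) f"
    unfolding supp_bound_def by (meson minus_le_iff)
  then show "f \<in> carrier Nov"
    using f by (auto simp: novikov_carrier_iff laurent_carrier_iff)
qed

lemma monomial_laurent: "r \<in> carrier R \<Longrightarrow> monomial R a r \<in> carrier Lau"
  by (auto simp: laurent_carrier_iff monomial_def)

lemma monomial_novikov: "r \<in> carrier R \<Longrightarrow> monomial R a r \<in> carrier Nov"
  using monomial_laurent laurent_subset_novikov by blast

lemma novikov_mult_eq:
  fixes f g :: "int ^ 'n::finite \<Rightarrow> 'a"
  assumes f: "\<And>a. f a \<in> carrier R" and g: "\<And>a. g a \<in> carrier R" and B: "finite B"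
    and sub: "\<And>b. \<lbrakk>f b \<noteq> \<zero>; g (a - b) \<noteq> \<zero>\<rbrakk> \<Longrightarrow> b \<in> B"
  shows "(f \<otimes>\<^bsub>Nov\<^esub> g) a = (\<Oplus>b\<in>B. f b \<otimes> g (a - b))"
proof -
  have "(f \<otimes>\<^bsub>Nov\<^esub> g) a = (\<Oplus>b\<in>{b. b \<in> supp R f \<and> a - b \<in> supp R g}. f b \<otimes> g (a - b))"
    by (simp add: novikov_ring_def)
  also have "\<dots> = (\<Oplus>b\<in>B. f b \<otimes> g (a - b))"
  proof (rule add.finprod_mono_neutral_cong_left[OF B])
    show "{b. b \<in> supp R f \<and> a - b \<in> supp R g} \<subseteq> B"
      using sub by (auto simp: supp_def)
    show "f b \<otimes> g (a - b) = \<zero>" if "b \<in> B - {b. b \<in> supp R f \<and> a - b \<in> supp R g}" for b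
      using that f[of b] g[of "a - b"] by (auto simp: supp_def)
  qed (auto simp: f g)
  finally show ?thesis .
qed

lemma novikov_mult_nonzero:
  fixes f g :: "int ^ 'n::finite \<Rightarrow> 'a"
  assumes "(f \<otimes>\<^bsub>Nov\<^esub> g) a \<noteq> \<zero>" "\<And>a. f a \<in> carrier R" "\<And>a. g a \<in> carrier R"
  shows "\<exists>b. f b \<noteq> \<zero> \<and> g (a - b) \<noteq> \<zero>"
proof (rule ccontr)
  assume "\<not> ?thesis"
  then have "(f \<otimes>\<^bsub>Nov\<^esub> g) a = (\<Oplus>b\<in>{}. f b \<otimes> g (a - b))"
    using assms by (intro novikov_mult_eq) auto
  with assms(1) show False by simp
qed

lemma novikov_mult_box:
  fixes f g :: "int ^ 'n::finite \<Rightarrow> 'a"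
  assumes f: "\<And>a. f a \<in> carrier R" "supp_bound R k f" and g: "\<And>a. g a \<in> carrier R" "supp_bound R k g"
  shows "(f \<otimes>\<^bsub>Nov\<^esub> g) a = (\<Oplus>b\<in>vec_box k a. f b \<otimes> g (a - b))"
proof (rule novikov_mult_eq[OF f(1) g(1) finite_vec_box])
  fix b assume "f b \<noteq> \<zero>" "g (a - b) \<noteq> \<zero>"
  then have "- k \<le> b $ i" "- k \<le> a $ i - b $ i" for i
    using f g by (auto simp: supp_bound_def)
  then show "b \<in> vec_box k a" by (smt (verit) mem_Collect_eq vec_box_def)
qed

lemma novikov_mult_coeff_closed:
  assumes "f \<in> carrier Nov" "g \<in> carrier Nov"
  shows "(f \<otimes>\<^bsub>Nov\<^esub> g) a \<in> carrier R"
  using assms[THEN novikov_coeff_closed] by (auto simp: novikov_ring_def intro!: finsum_closed)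

lemma novikov_mult_closed:
  assumes "f \<in> carrier Nov" "g \<in> carrier Nov"
  shows "f \<otimes>\<^bsub>Nov\<^esub> g \<in> carrier Nov"
proof -
  note closed = assms[THEN novikov_coeff_closed]
  obtain k l where kl: "supp_bound R k f" "supp_bound R l g"
    using assms by (auto simp: novikov_carrier_iff)
  have "supp_bound R (k + l) (f \<otimes>\<^bsub>Nov\<^esub> g)"
    unfolding supp_bound_def
  proof (intro allI impI)
    fix a i assume "(f \<otimes>\<^bsub>Nov\<^esub> g) a \<noteq> \<zero>"
    then obtain b where "f b \<noteq> \<zero>" "g (a - b) \<noteq> \<zero>"
      using novikov_mult_nonzero closed by blast
    then have "- k \<le> b $ i" "- l \<le> (a - b) $ i"
      using kl by (auto simp: supp_bound_def)
    then show "- (k + l) \<le> a $ i" by simp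
  qed
  then show ?thesis
    using novikov_mult_coeff_closed[OF assms] by (auto simp: novikov_carrier_iff)
qed

lemma novikov_mult_assoc_left:
  fixes f g h :: "int ^ 'n::finite \<Rightarrow> 'a"
  assumes fgh: "f \<in> carrier Nov" "g \<in> carrier Nov" "h \<in> carrier Nov" and X: "finite X"
    and mem: "\<And>b c. \<lbrakk>f c \<noteq> \<zero>; g (b - c) \<noteq> \<zero>; h (a - b) \<noteq> \<zero>\<rbrakk> \<Longrightarrow> b \<in> X \<and> c \<in> X"
  shows "((f \<otimes>\<^bsub>Nov\<^esub> g) \<otimes>\<^bsub>Nov\<^esub> h) a = (\<Oplus>b\<in>X. \<Oplus>c\<in>X. f c \<otimes> (g (b - c) \<otimes> h (a - b)))"
proof -
  note closed [simp] = fgh[THEN novikov_coeff_closed] novikov_mult_coeff_closed[OF fgh(1,2)]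
  have "((f \<otimes>\<^bsub>Nov\<^esub> g) \<otimes>\<^bsub>Nov\<^esub> h) a = (\<Oplus>b\<in>X. (f \<otimes>\<^bsub>Nov\<^esub> g) b \<otimes> h (a - b))"
    by (rule novikov_mult_eq) (use X mem novikov_mult_nonzero[of f g] closed in blast)+
  also have "\<dots> = (\<Oplus>b\<in>X. \<Oplus>c\<in>X. f c \<otimes> (g (b - c) \<otimes> h (a - b)))"
  proof (rule finsum_cong')
    fix b assume "b \<in> X"
    show "(f \<otimes>\<^bsub>Nov\<^esub> g) b \<otimes> h (a - b) = (\<Oplus>c\<in>X. f c \<otimes> (g (b - c) \<otimes> h (a - b)))"
    proof (cases "h (a - b) = \<zero>")
      case False
      then have "(f \<otimes>\<^bsub>Nov\<^esub> g) b = (\<Oplus>c\<in>X. f c \<otimes> g (b - c))"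
        using mem by (intro novikov_mult_eq X) auto
      then show ?thesis
        by (simp add: finsum_ldistr[OF X] m_assoc Pi_def)
    qed simp
  qed (auto intro: finsum_closed)
  finally show ?thesis .
qed

lemma novikov_mult_assoc_right:
  fixes f g h :: "int ^ 'n::finite \<Rightarrow> 'a"
  assumes fgh: "f \<in> carrier Nov" "g \<in> carrier Nov" "h \<in> carrier Nov" and X: "finite X"
    and mem: "\<And>b c. \<lbrakk>f c \<noteq> \<zero>; g (b - c) \<noteq> \<zero>; h (a - b) \<noteq> \<zero>\<rbrakk> \<Longrightarrow> b \<in> X \<and> c \<in> X"
  shows "(f \<otimes>\<^bsub>Nov\<^esub> (g \<otimes>\<^bsub>Nov\<^esub> h)) a = (\<Oplus>c\<in>X. \<Oplus>b\<in>X. f c \<otimes> (g (b - c) \<otimes> h (a - b)))"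
proof -
  note closed [simp] = fgh[THEN novikov_coeff_closed] novikov_mult_coeff_closed[OF fgh(2,3)]
  have mem': "d + c \<in> X \<and> c \<in> X" if "f c \<noteq> \<zero>" "g d \<noteq> \<zero>" "h (a - c - d) \<noteq> \<zero>" for c d
    using mem[of c "d + c"] that by (simp add: algebra_simps)
  have "(f \<otimes>\<^bsub>Nov\<^esub> (g \<otimes>\<^bsub>Nov\<^esub> h)) a = (\<Oplus>c\<in>X. f c \<otimes> (g \<otimes>\<^bsub>Nov\<^esub> h) (a - c))"
    by (rule novikov_mult_eq) (use X mem' novikov_mult_nonzero[of g h] closed in blast)+
  also have "\<dots> = (\<Oplus>c\<in>X. \<Oplus>b\<in>X. f c \<otimes> (g (b - c) \<otimes> h (a - b)))"
  proof (rule finsum_cong')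
    fix c assume "c \<in> X"
    show "f c \<otimes> (g \<otimes>\<^bsub>Nov\<^esub> h) (a - c) = (\<Oplus>b\<in>X. f c \<otimes> (g (b - c) \<otimes> h (a - b)))"
    proof (cases "f c = \<zero>")
      case False
      have "(g \<otimes>\<^bsub>Nov\<^esub> h) (a - c) = (\<Oplus>d\<in>(\<lambda>b. b - c) ` X. g d \<otimes> h (a - c - d))"
      proof (rule novikov_mult_eq)
        fix d assume "g d \<noteq> \<zero>" "h (a - c - d) \<noteq> \<zero>"
        then show "d \<in> (\<lambda>b. b - c) ` X"
          using mem' False by (intro image_eqI[of _ _ "d + c"]) auto
      qed (auto simp: X)
      also have "\<dots> = (\<Oplus>b\<in>X. g (b - c) \<otimes> h (a - b))"
        by (subst finsum_reindex) (auto simp: inj_on_def algebra_simps)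
      finally show ?thesis
        by (simp add: finsum_rdistr[OF X] Pi_def)
    qed simp
  qed (auto intro: finsum_closed)
  finally show ?thesis .
qed

lemma novikov_mult_assoc:
  fixes f g h :: "int ^ 'n::finite \<Rightarrow> 'a"
  assumes fgh: "f \<in> carrier Nov" "g \<in> carrier Nov" "h \<in> carrier Nov"
  shows "(f \<otimes>\<^bsub>Nov\<^esub> g) \<otimes>\<^bsub>Nov\<^esub> h = f \<otimes>\<^bsub>Nov\<^esub> (g \<otimes>\<^bsub>Nov\<^esub> h)"
proof
  fix a :: "int ^ 'n"
  obtain kf kg kh where bounds: "supp_bound R kf f" "supp_bound R kg g" "supp_bound R kh h"
    using fgh by (auto simp: novikov_carrier_iff)
  define k where "k = max 0 (max kf (max kg kh))"
  have k: "0 \<le> k" and bound: "supp_bound R k f" "supp_bound R k g" "supp_bound R k h"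
    using bounds by (auto intro: supp_bound_mono simp: k_def)
  have mem: "b \<in> vec_box (3 * k) a \<and> c \<in> vec_box (3 * k) a"
    if "f c \<noteq> \<zero>" "g (b - c) \<noteq> \<zero>" "h (a - b) \<noteq> \<zero>" for b c
  proof -
    have "- k \<le> c $ i" "- k \<le> b $ i - c $ i" "- k \<le> a $ i - b $ i" for i
      using bound that by (auto simp: supp_bound_def)
    then have "- (3*k) \<le> c $ i \<and> c $ i \<le> a $ i + 3*k \<and> - (3*k) \<le> b $ i \<and> b $ i \<le> a $ i + 3*k" for i
      using k by (smt (verit))
    then show ?thesis by (simp add: vec_box_def)
  qed
  let ?X = "vec_box (3 * k) a"
  have "((f \<otimes>\<^bsub>Nov\<^esub> g) \<otimes>\<^bsub>Nov\<^esub> h) a = (\<Oplus>b\<in>?X. \<Oplus>c\<in>?X. f c \<otimes> (g (b - c) \<otimes> h (a - b)))"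
    by (rule novikov_mult_assoc_left[OF fgh finite_vec_box]) (rule mem)
  also have "\<dots> = (\<Oplus>c\<in>?X. \<Oplus>b\<in>?X. f c \<otimes> (g (b - c) \<otimes> h (a - b)))"
    by (rule finsum_swap) (simp_all add: finite_vec_box fgh[THEN novikov_coeff_closed])
  also have "\<dots> = (f \<otimes>\<^bsub>Nov\<^esub> (g \<otimes>\<^bsub>Nov\<^esub> h)) a"
    by (rule novikov_mult_assoc_right[OF fgh finite_vec_box, symmetric]) (rule mem)
  finally show "((f \<otimes>\<^bsub>Nov\<^esub> g) \<otimes>\<^bsub>Nov\<^esub> h) a = (f \<otimes>\<^bsub>Nov\<^esub> (g \<otimes>\<^bsub>Nov\<^esub> h)) a" .
qed

lemma monomial_mult:
  assumes "r \<in> carrier R" "\<And>a. f a \<in> carrier R"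
  shows "monomial R a r \<otimes>\<^bsub>Nov\<^esub> f = (\<lambda>b. r \<otimes> f (b - a))"
    and "f \<otimes>\<^bsub>Nov\<^esub> monomial R a r = (\<lambda>b. f (b - a) \<otimes> r)"
proof -
  show "monomial R a r \<otimes>\<^bsub>Nov\<^esub> f = (\<lambda>b. r \<otimes> f (b - a))"
  proof
    fix b
    have "(monomial R a r \<otimes>\<^bsub>Nov\<^esub> f) b = (\<Oplus>c\<in>{a}. monomial R a r c \<otimes> f (b - c))"
      using assms by (intro novikov_mult_eq) (auto simp: monomial_def split: if_splits)
    then show "(monomial R a r \<otimes>\<^bsub>Nov\<^esub> f) b = r \<otimes> f (b - a)"
      using assms by (simp add: monomial_def)
  qed
  show "f \<otimes>\<^bsub>Nov\<^esub> monomial R a r = (\<lambda>b. f (b - a) \<otimes> r)"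
  proof
    fix b
    have "(f \<otimes>\<^bsub>Nov\<^esub> monomial R a r) b = (\<Oplus>c\<in>{b - a}. f c \<otimes> monomial R a r (b - c))"
      using assms by (intro novikov_mult_eq) (auto simp: monomial_def split: if_splits)
    then show "(f \<otimes>\<^bsub>Nov\<^esub> monomial R a r) b = f (b - a) \<otimes> r"
      using assms by (simp add: monomial_def)
  qed
qed

lemma monomial_mult_monomial:
  "\<lbrakk>r \<in> carrier R; s \<in> carrier R\<rbrakk> \<Longrightarrow>
   monomial R a r \<otimes>\<^bsub>Nov\<^esub> monomial R b s = monomial R (a + b) (r \<otimes> s)"
  by (subst monomial_mult) (auto simp: monomial_def algebra_simps)

lemma monomial_one_central:
  "f \<in> carrier Nov \<Longrightarrow> monomial R a \<one> \<otimes>\<^bsub>Nov\<^esub> f = f \<otimes>\<^bsub>Nov\<^esub> monomial R a \<one>"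
  by (simp add: monomial_mult novikov_coeff_closed)

lemma novikov_add_closed:
  assumes "f \<in> carrier Nov" "g \<in> carrier Nov"
  shows "f \<oplus>\<^bsub>Nov\<^esub> g \<in> carrier Nov"
proof -
  obtain k l where "supp_bound R k f" "supp_bound R l g"
    using assms by (auto simp: novikov_carrier_iff)
  then have bound: "supp_bound R (max k l) f" "supp_bound R (max k l) g"
    by (auto intro: supp_bound_mono)
  have "supp_bound R (max k l) (\<lambda>a. f a \<oplus> g a)"
    unfolding supp_bound_def
  proof (intro allI impI)
    fix a i assume "f a \<oplus> g a \<noteq> \<zero>"
    then have "f a \<noteq> \<zero> \<or> g a \<noteq> \<zero>" by auto
    then show "- max k l \<le> a $ i" using bound unfolding supp_bound_def by blast
  qed
  then show ?thesis
    using assms by (auto simp: novikov_carrier_iff novikov_simps)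
qed

lemma novikov_abelian_group: "abelian_group Nov"
proof (rule abelian_groupI)
  fix f assume f: "f \<in> carrier Nov"
  then obtain k where "supp_bound R k f"
    by (auto simp: novikov_carrier_iff)
  then have "supp_bound R k (\<lambda>a. \<ominus> f a)"
    using novikov_coeff_closed[OF f] by (auto simp: supp_bound_def)
  then show "\<exists>g\<in>carrier Nov. g \<oplus>\<^bsub>Nov\<^esub> f = \<zero>\<^bsub>Nov\<^esub>"
    using f by (intro bexI[of _ "\<lambda>a. \<ominus> f a"]) (auto simp: novikov_carrier_iff novikov_simps l_neg)
qed (auto simp: novikov_add_closed[unfolded novikov_simps] novikov_simps novikov_coeff_closed a_ac
    novikov_carrier_iff[of "\<lambda>a. \<zero>"] supp_bound_def)

lemma novikov_distr:
  fixes f g h :: "int ^ 'n::finite \<Rightarrow> 'a"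
  assumes fgh: "f \<in> carrier Nov" "g \<in> carrier Nov" "h \<in> carrier Nov"
  shows "(f \<oplus>\<^bsub>Nov\<^esub> g) \<otimes>\<^bsub>Nov\<^esub> h = f \<otimes>\<^bsub>Nov\<^esub> h \<oplus>\<^bsub>Nov\<^esub> g \<otimes>\<^bsub>Nov\<^esub> h"
    and "h \<otimes>\<^bsub>Nov\<^esub> (f \<oplus>\<^bsub>Nov\<^esub> g) = h \<otimes>\<^bsub>Nov\<^esub> f \<oplus>\<^bsub>Nov\<^esub> h \<otimes>\<^bsub>Nov\<^esub> g"
proof -
  obtain kf kg kh where bounds: "supp_bound R kf f" "supp_bound R kg g" "supp_bound R kh h"
    using fgh by (auto simp: novikov_carrier_iff)
  define k where "k = max kf (max kg kh)"
  have f: "supp_bound R k f" and g: "supp_bound R k g" and h: "supp_bound R k h"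
    using bounds by (auto intro: supp_bound_mono simp: k_def)
  then have fg: "supp_bound R k (f \<oplus>\<^bsub>Nov\<^esub> g)"
    unfolding supp_bound_def novikov_simps by (metis l_zero zero_closed)
  note closed = fgh[THEN novikov_coeff_closed] novikov_add_closed[OF fgh(1,2), THEN novikov_coeff_closed]
  show "(f \<oplus>\<^bsub>Nov\<^esub> g) \<otimes>\<^bsub>Nov\<^esub> h = f \<otimes>\<^bsub>Nov\<^esub> h \<oplus>\<^bsub>Nov\<^esub> g \<otimes>\<^bsub>Nov\<^esub> h"
  proof
    fix a
    show "((f \<oplus>\<^bsub>Nov\<^esub> g) \<otimes>\<^bsub>Nov\<^esub> h) a = (f \<otimes>\<^bsub>Nov\<^esub> h \<oplus>\<^bsub>Nov\<^esub> g \<otimes>\<^bsub>Nov\<^esub> h) a"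
      unfolding novikov_mult_box[OF closed(4) fg closed(3) h]
      unfolding novikov_simps(3)
      unfolding novikov_mult_box[OF closed(1) f closed(3) h] novikov_mult_box[OF closed(2) g closed(3) h]
      by (subst finsum_addf[symmetric]) (auto simp: closed l_distr intro!: finsum_cong')
  qed
  show "h \<otimes>\<^bsub>Nov\<^esub> (f \<oplus>\<^bsub>Nov\<^esub> g) = h \<otimes>\<^bsub>Nov\<^esub> f \<oplus>\<^bsub>Nov\<^esub> h \<otimes>\<^bsub>Nov\<^esub> g"
  proof
    fix a
    show "(h \<otimes>\<^bsub>Nov\<^esub> (f \<oplus>\<^bsub>Nov\<^esub> g)) a = (h \<otimes>\<^bsub>Nov\<^esub> f \<oplus>\<^bsub>Nov\<^esub> h \<otimes>\<^bsub>Nov\<^esub> g) a"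
      unfolding novikov_mult_box[OF closed(3) h closed(4) fg]
      unfolding novikov_simps(3)
      unfolding novikov_mult_box[OF closed(3) h closed(1) f] novikov_mult_box[OF closed(3) h closed(2) g]
      by (subst finsum_addf[symmetric]) (auto simp: closed r_distr intro!: finsum_cong')
  qed
qed

lemma novikov_ring: "ring (novikov_ring R :: (int ^ 'n::finite \<Rightarrow> 'a) ring)"
proof (rule ringI)
  show "monoid Nov"
  proof (rule monoidI)
    show "\<one>\<^bsub>Nov\<^esub> \<in> carrier Nov"
      by (simp add: novikov_simps monomial_novikov)
  qed (auto simp: novikov_mult_closed novikov_mult_assoc novikov_simps monomial_mult novikov_coeff_closed)
qed (simp_all add: novikov_abelian_group novikov_distr)

lemma laurent_inclusion_ring_hom: "(\<lambda>f. f) \<in> ring_hom Lau Nov"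
  using laurent_subset_novikov by (intro ring_hom_memI) (auto simp: laurent_simps)

lemma laurent_const_ring_hom: "laurent_const R \<in> ring_hom R Lau"
  by (intro ring_hom_memI)
    (simp_all add: laurent_const_eq_monomial monomial_laurent laurent_simps monomial_mult_monomial
      novikov_simps(1), auto simp: monomial_def novikov_simps)

lemma novikov_coeff_abelian_group_hom: "abelian_group_hom Nov R (\<lambda>f. f a)"
  by (rule abelian_group_homI_additive)
    (simp_all add: novikov_abelian_group abelian_group_axioms novikov_coeff_closed novikov_simps)

lemma laurent_induct [consumes 1, case_names zero add]:
  assumes "f \<in> carrier Lau"
    and zero: "P \<zero>\<^bsub>Lau\<^esub>"
    and add: "\<And>f a r. \<lbrakk>f \<in> carrier Lau; r \<in> carrier R; P f\<rbrakk> \<Longrightarrow> P (f \<oplus>\<^bsub>Lau\<^esub> monomial R a r)"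
  shows "P f"
proof -
  have "finite {a. f a \<noteq> \<zero>}" using assms by (simp add: laurent_carrier_iff)
  then show ?thesis
    using assms(1)
  proof (induction "{a. f a \<noteq> \<zero>}" arbitrary: f rule: finite_induct)
    case empty
    then have "f = \<zero>\<^bsub>Lau\<^esub>" by (auto simp: laurent_simps novikov_simps)
    then show ?case using zero by simp
  next
    case (insert a A)
    let ?g = "f(a := \<zero>)"
    have closed: "\<And>b. f b \<in> carrier R" using insert.prems by (simp add: laurent_carrier_iff)
    have A: "A = {b. ?g b \<noteq> \<zero>}" using insert.hyps by (auto split: if_splits)
    then have g: "?g \<in> carrier Lau" using insert.hyps closed by (auto simp: laurent_carrier_iff)
    have "f = ?g \<oplus>\<^bsub>Lau\<^esub> monomial R a (f a)"
      by (rule ext) (simp add: laurent_simps novikov_simps monomial_def closed)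
    then show ?case
      using add[OF g closed insert.hyps(3)[OF A g]] by metis
  qed
qed

end

subsection \<open>Laurent series in one of the variables\<close>

definition axis_series_ring :: "('a, 'r) ring_scheme \<Rightarrow> 'n \<Rightarrow> (int ^ 'n \<Rightarrow> 'a) ring" where
  "axis_series_ring R k =
     (novikov_ring R)\<lparr>carrier := {f \<in> carrier (novikov_ring R). \<forall>a. f a \<noteq> \<zero>\<^bsub>R\<^esub> \<longrightarrow> a = axis k (a $ k)}\<rparr>"

lemma axis_eq_iff: "a = axis k (a $ k) \<longleftrightarrow> (\<forall>i. i \<noteq> k \<longrightarrow> a $ i = 0)"
  for a :: "int ^ 'n::finite"
  by (auto simp: vec_eq_iff axis_def)

lemma axis_zero [simp]: "axis k 0 = (0 :: int ^ 'n::finite)"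
  by (simp add: axis_eq_0_iff)

lemma axis_add: "axis k l + axis k m = (axis k (l + m) :: int ^ 'n::finite)"
  and axis_diff: "axis k l - axis k m = (axis k (l - m) :: int ^ 'n::finite)"
  by (auto simp: vec_eq_iff axis_def)

context ring
begin

context
  fixes k :: "'n::finite"
begin

abbreviation "Axis \<equiv> axis_series_ring R k"

lemma axis_series_simps:
  "\<one>\<^bsub>Axis\<^esub> = \<one>\<^bsub>Nov\<^esub>" "\<zero>\<^bsub>Axis\<^esub> = \<zero>\<^bsub>Nov\<^esub>" "f \<oplus>\<^bsub>Axis\<^esub> g = f \<oplus>\<^bsub>Nov\<^esub> g"
  "f \<otimes>\<^bsub>Axis\<^esub> g = f \<otimes>\<^bsub>Nov\<^esub> g"
  by (simp_all add: axis_series_ring_def)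

lemma axis_series_carrier_iff:
  "f \<in> carrier Axis \<longleftrightarrow> f \<in> carrier Nov \<and> (\<forall>a. f a \<noteq> \<zero> \<longrightarrow> a = axis k (a $ k))"
  by (simp add: axis_series_ring_def)

lemma axis_series_subset_novikov: "carrier Axis \<subseteq> carrier Nov"
  by (auto simp: axis_series_carrier_iff)

lemma axis_series_subring: "subring (carrier Axis) Nov"
proof -
  interpret Nov: ring "Nov :: (int ^ 'n \<Rightarrow> 'a) ring" by (rule novikov_ring)
  show ?thesis
  proof (rule Nov.subringI)
    show "carrier Axis \<subseteq> carrier Nov" by (rule axis_series_subset_novikov)
    show "\<one>\<^bsub>Nov\<^esub> \<in> carrier Axis"
      using Nov.one_closed by (auto simp: axis_series_carrier_iff novikov_simps monomial_def axis_eq_iff)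
  next
    fix f assume f: "f \<in> carrier Axis"
    then have "f \<in> carrier Nov" by (simp add: axis_series_carrier_iff)
    then have "(\<ominus>\<^bsub>Nov\<^esub> f) a = \<ominus> f a" for a
      by (rule abelian_group_hom.hom_a_inv[OF novikov_coeff_abelian_group_hom])
    with f show "\<ominus>\<^bsub>Nov\<^esub> f \<in> carrier Axis"
      by (force simp: axis_series_carrier_iff)
  next
    fix f g assume f: "f \<in> carrier Axis" and g: "g \<in> carrier Axis"
    then have fg: "f \<in> carrier Nov" "g \<in> carrier Nov" by (simp_all add: axis_series_carrier_iff)
    have "\<forall>a. (f \<oplus>\<^bsub>Nov\<^esub> g) a \<noteq> \<zero> \<longrightarrow> a = axis k (a $ k)"
      using f g unfolding axis_series_carrier_iff novikov_simps by (metis l_zero zero_closed)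
    with fg show "f \<oplus>\<^bsub>Nov\<^esub> g \<in> carrier Axis" by (simp add: axis_series_carrier_iff)
    have "a = axis k (a $ k)" if nonzero: "(f \<otimes>\<^bsub>Nov\<^esub> g) a \<noteq> \<zero>" for a
    proof -
      obtain b where b: "f b \<noteq> \<zero>" "g (a - b) \<noteq> \<zero>"
        using novikov_mult_nonzero[OF nonzero] fg novikov_coeff_closed by blast
      then have "b = axis k (b $ k)" "a - b = axis k ((a - b) $ k)"
        using f g unfolding axis_series_carrier_iff by blast+
      then show ?thesis unfolding axis_eq_iff by auto
    qed
    with fg show "f \<otimes>\<^bsub>Nov\<^esub> g \<in> carrier Axis" by (simp add: axis_series_carrier_iff)
  qed
qed

lemma axis_series_ring: "ring Axis"
  using ring.subring_is_ring[OF novikov_ring axis_series_subring] by (simp add: axis_series_ring_def)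

lemma axis_series_eqI:
  assumes "f \<in> carrier Axis" "g \<in> carrier Axis" "\<And>l. f (axis k l) = g (axis k l)"
  shows "f = g"
proof
  fix a show "f a = g a"
    using assms by (cases "a = axis k (a $ k)") (metis, metis axis_series_carrier_iff)
qed

lemma axis_series_bounded_below:
  assumes "f \<in> carrier Axis"
  shows "\<exists>b. \<forall>l<b. f (axis k l) = \<zero>"
proof -
  obtain m where "supp_bound R m f"
    using assms by (auto simp: axis_series_carrier_iff novikov_carrier_iff)
  then have "f (axis k l) = \<zero>" if "l < - m" for l
    using that unfolding supp_bound_def by (metis axis_nth not_less)
  then show ?thesis by blast
qed

lemma axis_series_family_bounded_below:
  assumes "finite I" "\<And>i. i \<in> I \<Longrightarrow> f i \<in> carrier Axis"
  shows "\<exists>b. \<forall>i\<in>I. \<forall>l<b. f i (axis k l) = \<zero>"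
  using assms
proof (induction I rule: finite_induct)
  case (insert i I)
  then obtain b c where "\<forall>i\<in>I. \<forall>l<b. f i (axis k l) = \<zero>" "\<forall>l<c. f i (axis k l) = \<zero>"
    using axis_series_bounded_below[of "f i"] by auto
  then show ?case by (intro exI[of _ "min b c"]) simp
qed simp

lemma axis_monomial_axis_series: "r \<in> carrier R \<Longrightarrow> monomial R (axis k l) r \<in> carrier Axis"
  by (simp add: axis_series_carrier_iff monomial_novikov) (simp add: monomial_def)

lemma laurent_const_axis_series_ring_hom: "laurent_const R \<in> ring_hom R Axis"
proof (rule ring_hom_memI)
  show "laurent_const R r \<in> carrier Axis" if "r \<in> carrier R" for r
    using axis_monomial_axis_series[OF that, of 0] by (simp add: laurent_const_eq_monomial)
qed (use ring_hom_mult[OF laurent_const_ring_hom] ring_hom_add[OF laurent_const_ring_hom]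
    ring_hom_one[OF laurent_const_ring_hom] in \<open>simp_all add: axis_series_simps laurent_simps\<close>)

lemma axis_series_coeff_abelian_group_hom: "abelian_group_hom Axis R (\<lambda>f. f a)"
  using axis_series_subset_novikov
  by (intro abelian_group_homI_additive ring.axioms(1)[OF axis_series_ring] abelian_group_axioms)
    (auto simp: novikov_coeff_closed axis_series_simps novikov_simps)

definition axis_series :: "(int \<Rightarrow> 'a) \<Rightarrow> int ^ 'n \<Rightarrow> 'a" where
  "axis_series \<phi> = (\<lambda>a. if a = axis k (a $ k) then \<phi> (a $ k) else \<zero>)"

lemma axis_series_axis: "axis_series \<phi> (axis k l) = \<phi> l"
  by (simp add: axis_series_def)

lemma axis_series_closed:
  assumes "\<And>l. \<phi> l \<in> carrier R" "\<And>l. l < b \<Longrightarrow> \<phi> l = \<zero>"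
  shows "axis_series \<phi> \<in> carrier Axis"
proof -
  have "supp_bound R (max 0 (- b)) (axis_series \<phi>)"
    unfolding supp_bound_def
  proof (intro allI impI)
    fix a j assume "axis_series \<phi> a \<noteq> \<zero>"
    then have a: "a = axis k (a $ k)" "\<phi> (a $ k) \<noteq> \<zero>"
      by (auto simp: axis_series_def split: if_splits)
    then have "b \<le> a $ k" using assms(2) by force
    moreover have "a $ j = 0 \<or> j = k" using a(1) unfolding axis_eq_iff by blast
    ultimately show "- max 0 (- b) \<le> a $ j" by auto
  qed
  then show ?thesis
    using assms(1) by (auto simp: axis_series_carrier_iff novikov_carrier_iff axis_series_def split: if_splits)
qed

subsection \<open>Linear systems over Laurent series\<close>

text \<open>
  The system \<open>\<phi> = \<psi> + x N \<phi>\<close> determines the coefficient of \<open>x\<^sup>l\<close> in \<open>\<phi>\<close> from the one of \<open>x\<^sup>l\<^sup>-\<^sup>1\<close>, so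
  \<open>1 - x N\<close> is invertible for every square matrix \<open>N\<close> over \<open>R\<close>.
\<close>

abbreviation "Var \<equiv> monomial R (axis k 1) \<one>"

lemma matrix_term_closed:
  assumes "i \<in> I" "\<And>i. i \<in> I \<Longrightarrow> c i \<in> carrier R" "\<And>i. i \<in> I \<Longrightarrow> \<phi> i \<in> carrier Axis"
  shows "laurent_const R (c i) \<otimes>\<^bsub>Axis\<^esub> \<phi> i \<in> carrier Axis"
proof -
  interpret Axis: ring Axis by (rule axis_series_ring)
  show ?thesis
    using assms ring_hom_closed[OF laurent_const_axis_series_ring_hom] by simp
qed

lemma linear_system_coeff:
  assumes c: "\<And>i. i \<in> I \<Longrightarrow> c i \<in> carrier R" and \<phi>: "\<And>i. i \<in> I \<Longrightarrow> \<phi> i \<in> carrier Axis"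
  shows "((\<Oplus>\<^bsub>Axis\<^esub>i\<in>I. laurent_const R (c i) \<otimes>\<^bsub>Axis\<^esub> \<phi> i) \<otimes>\<^bsub>Axis\<^esub> Var) (axis k l) =
    (\<Oplus>i\<in>I. c i \<otimes> \<phi> i (axis k (l - 1)))"
proof -
  interpret Axis: ring Axis by (rule axis_series_ring)
  let ?s = "\<Oplus>\<^bsub>Axis\<^esub>i\<in>I. laurent_const R (c i) \<otimes>\<^bsub>Axis\<^esub> \<phi> i"
  note term_closed = matrix_term_closed[OF _ c \<phi>]
  have coeff: "\<phi> i a \<in> carrier R" if "i \<in> I" for i a
    using \<phi>[OF that] axis_series_subset_novikov novikov_coeff_closed by blast
  have "?s \<in> carrier Axis" using term_closed by (intro Axis.finsum_closed) auto
  then have "\<And>a. ?s a \<in> carrier R" using axis_series_subset_novikov novikov_coeff_closed by blast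
  then have "(?s \<otimes>\<^bsub>Axis\<^esub> Var) (axis k l) = ?s (axis k (l - 1))"
    by (simp add: axis_series_simps monomial_mult axis_diff)
  also have "\<dots> = (\<Oplus>i\<in>I. (laurent_const R (c i) \<otimes>\<^bsub>Axis\<^esub> \<phi> i) (axis k (l - 1)))"
    using term_closed by (intro abelian_group_hom.hom_finsum[OF axis_series_coeff_abelian_group_hom]) auto
  also have "\<dots> = (\<Oplus>i\<in>I. c i \<otimes> \<phi> i (axis k (l - 1)))"
    using c coeff
    by (intro finsum_cong') (auto simp: axis_series_simps laurent_const_eq_monomial monomial_mult)
  finally show ?thesis .
qed

lemma ex_matrix_recursion:
  fixes c :: "'i \<Rightarrow> int \<Rightarrow> 'a"
  assumes N: "\<And>i j. \<lbrakk>i \<in> I; j \<in> I\<rbrakk> \<Longrightarrow> N j i \<in> carrier R"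
    and c: "\<And>j l. j \<in> I \<Longrightarrow> c j l \<in> carrier R" "\<And>j l. \<lbrakk>j \<in> I; l < b\<rbrakk> \<Longrightarrow> c j l = \<zero>"
  shows "\<exists>w. \<forall>j\<in>I. (\<forall>l. w j l \<in> carrier R) \<and> (\<forall>l<b. w j l = \<zero>) \<and>
    (\<forall>l. w j l = c j l \<oplus> (\<Oplus>i\<in>I. N j i \<otimes> w i (l - 1)))"
proof -
  define v where "v = rec_nat (\<lambda>j. \<zero>) (\<lambda>n v j. c j (b + int n) \<oplus> (\<Oplus>i\<in>I. N j i \<otimes> v i))"
  have v_simps: "v 0 j = \<zero>" "v (Suc n) j = c j (b + int n) \<oplus> (\<Oplus>i\<in>I. N j i \<otimes> v n i)" for n j
    by (simp_all add: v_def)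
  have v_closed: "v n j \<in> carrier R" if "j \<in> I" for n j
    using that by (induction n arbitrary: j) (auto simp: v_simps c(1) N intro!: finsum_closed)
  define w where "w j l = v (nat (l + 1 - b)) j" for j l
  have w_zero: "w j l = \<zero>" if "l < b" for j l
    using that by (simp add: w_def v_simps)
  have "w j l = c j l \<oplus> (\<Oplus>i\<in>I. N j i \<otimes> w i (l - 1))" if j: "j \<in> I" for j l
  proof (cases "l < b")
    case True
    then have "(\<Oplus>i\<in>I. N j i \<otimes> w i (l - 1)) = \<zero>"
      using j N by (intro add.finprod_one_eqI) (simp add: w_zero)
    with True show ?thesis using j by (simp add: w_zero c(2))
  next
    case False
    then have "nat (l + 1 - b) = Suc (nat (l - b))" "b + int (nat (l - b)) = l" "l - 1 + 1 - b = l - b"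
      by auto
    then show ?thesis by (simp add: w_def v_simps)
  qed
  moreover have "w j l \<in> carrier R" if "j \<in> I" for j l
    unfolding w_def by (rule v_closed[OF that])
  ultimately show ?thesis using w_zero by (intro exI[of _ w]) blast
qed

lemma linear_system_solvable:
  assumes N: "\<And>i j. \<lbrakk>i \<in> I; j \<in> I\<rbrakk> \<Longrightarrow> N j i \<in> carrier R" and "finite I"
    and \<psi>: "\<And>j. j \<in> I \<Longrightarrow> \<psi> j \<in> carrier Axis"
  shows "\<exists>\<phi>. \<forall>j\<in>I. \<phi> j \<in> carrier Axis \<and>
    \<phi> j = \<psi> j \<oplus>\<^bsub>Axis\<^esub> (\<Oplus>\<^bsub>Axis\<^esub>i\<in>I. laurent_const R (N j i) \<otimes>\<^bsub>Axis\<^esub> \<phi> i) \<otimes>\<^bsub>Axis\<^esub> Var"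
proof -
  interpret Axis: ring Axis by (rule axis_series_ring)
  have \<psi>_closed: "\<psi> j a \<in> carrier R" if "j \<in> I" for j a
    using \<psi>[OF that] axis_series_subset_novikov novikov_coeff_closed by blast
  obtain b where "\<And>j l. \<lbrakk>j \<in> I; l < b\<rbrakk> \<Longrightarrow> \<psi> j (axis k l) = \<zero>"
    using axis_series_family_bounded_below[of I \<psi>] \<psi> \<open>finite I\<close> by blast
  then obtain w where w: "\<And>j l. j \<in> I \<Longrightarrow> w j l \<in> carrier R" "\<And>j l. \<lbrakk>j \<in> I; l < b\<rbrakk> \<Longrightarrow> w j l = \<zero>"
    and w_eq: "\<forall>j\<in>I. \<forall>l. w j l = \<psi> j (axis k l) \<oplus> (\<Oplus>i\<in>I. N j i \<otimes> w i (l - 1))"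
    using ex_matrix_recursion[of I N "\<lambda>j l. \<psi> j (axis k l)" b] N \<psi>_closed by blast
  define \<phi> where "\<phi> j = axis_series (w j)" for j
  have \<phi>: "\<phi> j \<in> carrier Axis" if "j \<in> I" for j
    unfolding \<phi>_def using w that by (intro axis_series_closed) auto
  have "\<phi> j = \<psi> j \<oplus>\<^bsub>Axis\<^esub> (\<Oplus>\<^bsub>Axis\<^esub>i\<in>I. laurent_const R (N j i) \<otimes>\<^bsub>Axis\<^esub> \<phi> i) \<otimes>\<^bsub>Axis\<^esub> Var"
    (is "_ = ?rhs j") if j: "j \<in> I" for j
  proof (rule axis_series_eqI)
    show "?rhs j \<in> carrier Axis"
      using j N \<psi> \<phi> matrix_term_closed[of _ I "N j" \<phi>] axis_monomial_axis_series[of \<one> 1]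
      by (auto intro!: Axis.finsum_closed)
    show "\<phi> j (axis k l) = ?rhs j (axis k l)" for l
      using linear_system_coeff[of I "N j" \<phi> l] j N \<phi> w_eq[rule_format, OF j, of l]
      by (simp add: axis_series_simps novikov_simps \<phi>_def axis_series_axis)
  qed (rule \<phi>[OF j])
  with \<phi> show ?thesis by blast
qed

lemma linear_system_unique:
  assumes N: "\<And>i j. \<lbrakk>i \<in> I; j \<in> I\<rbrakk> \<Longrightarrow> N j i \<in> carrier R" and "finite I"
    and \<phi>: "\<And>j. j \<in> I \<Longrightarrow> \<phi> j \<in> carrier Axis"
    and eq: "\<And>j. j \<in> I \<Longrightarrow>
      \<phi> j = (\<Oplus>\<^bsub>Axis\<^esub>i\<in>I. laurent_const R (N j i) \<otimes>\<^bsub>Axis\<^esub> \<phi> i) \<otimes>\<^bsub>Axis\<^esub> Var"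
    and j: "j \<in> I"
  shows "\<phi> j = \<zero>\<^bsub>Axis\<^esub>"
proof (rule axis_series_eqI[OF \<phi>[OF j]])
  interpret Axis: ring Axis by (rule axis_series_ring)
  show "\<zero>\<^bsub>Axis\<^esub> \<in> carrier Axis" by simp
  obtain b where b: "\<And>j l. \<lbrakk>j \<in> I; l < b\<rbrakk> \<Longrightarrow> \<phi> j (axis k l) = \<zero>"
    using axis_series_family_bounded_below[of I \<phi>] \<phi> \<open>finite I\<close> by blast
  have zero: "\<forall>j\<in>I. \<phi> j (axis k (b + int n - 1)) = \<zero>" for n
  proof (induction n)
    case (Suc n)
    have "\<phi> j (axis k (b + int (Suc n) - 1)) = \<zero>" if j: "j \<in> I" for j
    proof -
      have "\<phi> j (axis k (b + int (Suc n) - 1)) = (\<Oplus>i\<in>I. N j i \<otimes> \<phi> i (axis k (b + int n - 1)))"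
        using linear_system_coeff[of I "N j" \<phi> "b + int (Suc n) - 1"] j N \<phi> eq[OF j] by simp
      also have "\<dots> = \<zero>"
        using Suc j N by (intro add.finprod_one_eqI) simp
      finally show ?thesis .
    qed
    then show ?case by blast
  qed (simp add: b)
  show "\<phi> j (axis k l) = \<zero>\<^bsub>Axis\<^esub> (axis k l)" for l
    using b[OF j, of l] zero[of "nat (l - b + 1)"] j
    by (cases "l < b") (auto simp: axis_series_simps novikov_simps)
qed

end

end

section \<open>Perturbations of finite rank\<close>

locale axis_tensor = R: ring R + tensor R "axis_series_ring R k" "laurent_const R" M
  for R :: "('a, 'r) ring_scheme" and k :: "'n::finite" and M :: "('a, 'm) module"
begin

abbreviation "S \<equiv> axis_series_ring R k"
abbreviation var :: "int ^ 'n \<Rightarrow> 'a" where "var \<equiv> monomial R (axis k 1) \<one>\<^bsub>R\<^esub>"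

lemma var_closed [simp]: "var \<in> carrier S"
  by (simp add: R.axis_monomial_axis_series)

lemma var_central:
  "s \<in> carrier S \<Longrightarrow> s \<otimes>\<^bsub>S\<^esub> var = var \<otimes>\<^bsub>S\<^esub> s"
  using R.monomial_one_central[of s] R.axis_series_subset_novikov[of k] by (auto simp: R.axis_series_simps)

lemma var_smult_rmod_hom: "(\<lambda>b. var \<odot>\<^bsub>MS\<^esub> b) \<in> rmod_hom S MS MS"
  using smult_rmod_hom_restrict_scalars[OF MS_right_module, of "\<lambda>a. a" S var]
  by (simp add: restrict_scalars_id var_central ring_hom_def)

end

text \<open>
  Here \<open>X - var e\<close> equals \<open>X\<close> composed with a perturbation of the identity by the finite rank map
  \<open>var X' e\<close>, so solving \<open>(X - var e) v = u\<close> amounts to a finite linear system for the coordinates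
  \<open>f i v\<close>.
\<close>

locale finite_rank_perturbation = axis_tensor R k M
  for R :: "('a, 'r) ring_scheme" and k :: "'n::finite" and M :: "('a, 'm) module" +
  fixes X X' e :: "'m \<Rightarrow> 'm" and I :: "'i set" and f :: "'i \<Rightarrow> 'm \<Rightarrow> 'a" and g :: "'i \<Rightarrow> 'm"
  assumes X: "X \<in> rmod_hom R M M" and X': "X' \<in> rmod_hom R M M" and e: "e \<in> rmod_hom R M M"
    and X_X': "x \<in> carrier M \<Longrightarrow> X (X' x) = x" and X'_X: "x \<in> carrier M \<Longrightarrow> X' (X x) = x"
    and finite_I: "finite I" and f: "i \<in> I \<Longrightarrow> f i \<in> rmod_hom R M (regular_rmodule R)"
    and g: "i \<in> I \<Longrightarrow> g i \<in> carrier M"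
    and e_eq: "x \<in> carrier M \<Longrightarrow> e x = (\<Oplus>\<^bsub>M\<^esub>i\<in>I. f i x \<odot>\<^bsub>M\<^esub> g i)"
begin

sublocale XB: tensor_map R "axis_series_ring R k" "laurent_const R" M M X
  by unfold_locales (rule X)

sublocale X'B: tensor_map R "axis_series_ring R k" "laurent_const R" M M X'
  by unfold_locales (rule X')

sublocale eB: tensor_map R "axis_series_ring R k" "laurent_const R" M M e
  by unfold_locales (rule e)

abbreviation "XB \<equiv> extend_map R S (laurent_const R) M X"
abbreviation "X'B \<equiv> extend_map R S (laurent_const R) M X'"
abbreviation "eB \<equiv> extend_map R S (laurent_const R) M e"

definition coordinate :: "'i \<Rightarrow> ('m, int ^ 'n \<Rightarrow> 'a) tensor_elem \<Rightarrow> int ^ 'n \<Rightarrow> 'a" where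
  "coordinate i = extend_functional (f i)"

definition combination :: "('i \<Rightarrow> int ^ 'n \<Rightarrow> 'a) \<Rightarrow> ('m, int ^ 'n \<Rightarrow> 'a) tensor_elem" where
  "combination \<phi> = (\<Oplus>\<^bsub>MS\<^esub>i\<in>I. tens (g i) (\<phi> i))"

lemma coordinate_hom: "i \<in> I \<Longrightarrow> abelian_group_hom MS S (coordinate i)"
  unfolding coordinate_def by (rule extend_functional_hom[OF f])

lemma coordinate_closed: "\<lbrakk>i \<in> I; b \<in> carrier MS\<rbrakk> \<Longrightarrow> coordinate i b \<in> carrier S"
  by (rule abelian_group_hom.hom_closed[OF coordinate_hom])

lemma coordinate_tens:
  "\<lbrakk>i \<in> I; x \<in> carrier M; s \<in> carrier S\<rbrakk> \<Longrightarrow>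
   coordinate i (tens x s) = laurent_const R (f i x) \<otimes>\<^bsub>S\<^esub> s"
  unfolding coordinate_def by (rule extend_functional_tens[OF f])

lemma coordinate_smult:
  "\<lbrakk>i \<in> I; s \<in> carrier S; b \<in> carrier MS\<rbrakk> \<Longrightarrow>
   coordinate i (s \<odot>\<^bsub>MS\<^esub> b) = coordinate i b \<otimes>\<^bsub>S\<^esub> s"
  unfolding coordinate_def using rmod_hom_smult[OF extend_functional_rmod_hom[OF f]] by simp

lemma combination_closed:
  "(\<And>i. i \<in> I \<Longrightarrow> \<phi> i \<in> carrier S) \<Longrightarrow> combination \<phi> \<in> carrier MS"
  unfolding combination_def by (intro MS.finsum_closed) (auto simp: g)

lemma matrix_closed: "\<lbrakk>i \<in> I; j \<in> I\<rbrakk> \<Longrightarrow> f j (X' (g i)) \<in> carrier R"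
  using rmod_hom_closed[OF f rmod_hom_closed[OF X' g]] by simp

lemma coordinate_X'B_combination:
  assumes \<phi>: "\<And>i. i \<in> I \<Longrightarrow> \<phi> i \<in> carrier S" and j: "j \<in> I"
  shows "coordinate j (X'B (combination \<phi>)) =
    (\<Oplus>\<^bsub>S\<^esub>i\<in>I. laurent_const R (f j (X' (g i))) \<otimes>\<^bsub>S\<^esub> \<phi> i)"
proof -
  interpret X'B: abelian_group_hom MS MS X'B
    by (rule rmod_hom_abelian_group_hom[OF X'B.extend_map_rmod_hom MS_right_module MS_right_module])
  have "X'B (combination \<phi>) = (\<Oplus>\<^bsub>MS\<^esub>i\<in>I. X'B (tens (g i) (\<phi> i)))"
    unfolding combination_def using \<phi> g by (intro X'B.hom_finsum) auto
  also have "\<dots> = (\<Oplus>\<^bsub>MS\<^esub>i\<in>I. tens (X' (g i)) (\<phi> i))"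
    using \<phi> g by (intro MS.finsum_cong') (auto simp: X'B.extend_map_tens rmod_hom_closed[OF X'])
  finally have "coordinate j (X'B (combination \<phi>)) =
      (\<Oplus>\<^bsub>S\<^esub>i\<in>I. coordinate j (tens (X' (g i)) (\<phi> i)))"
    using \<phi> g by (simp add: abelian_group_hom.hom_finsum[OF coordinate_hom[OF j]] rmod_hom_closed[OF X'])
  also have "\<dots> = (\<Oplus>\<^bsub>S\<^esub>i\<in>I.
      laurent_const R (f j (X' (g i))) \<otimes>\<^bsub>S\<^esub> \<phi> i)"
    using \<phi> g j matrix_closed by (intro S.finsum_cong')
      (auto simp: coordinate_tens rmod_hom_closed[OF X'] phi_closed)
  finally show ?thesis .
qed

lemma eB_eq: "b \<in> carrier MS \<Longrightarrow> eB b = combination (\<lambda>i. coordinate i b)"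
proof (induction rule: tensor_induct)
  case (tens x s)
  have fx: "f i x \<in> carrier R" if "i \<in> I" for i
    using rmod_hom_closed[OF f[OF that] tens(1)] by simp
  have "eB (tens x s) = tens (\<Oplus>\<^bsub>M\<^esub>i\<in>I. f i x \<odot>\<^bsub>M\<^esub> g i) s"
    using tens by (simp add: eB.extend_map_tens e_eq)
  also have "\<dots> = (\<Oplus>\<^bsub>MS\<^esub>i\<in>I. tens (f i x \<odot>\<^bsub>M\<^esub> g i) s)"
    using fx g by (intro abelian_group_hom.hom_finsum[OF tens_left_hom[OF tens(2)]]) (auto simp: M.smult_closed)
  also have "\<dots> = combination (\<lambda>i. coordinate i (tens x s))"
    unfolding combination_def using fx g tens
    by (intro MS.finsum_cong') (auto simp: coordinate_tens tens_balanced phi_closed)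
  finally show ?case .
next
  case (add U V)
  have "eB (U \<oplus>\<^bsub>MS\<^esub> V) = combination (\<lambda>i. coordinate i U) \<oplus>\<^bsub>MS\<^esub> combination (\<lambda>i. coordinate i V)"
    using add rmod_hom_add[OF eB.extend_map_rmod_hom] by simp
  also have "\<dots> = (\<Oplus>\<^bsub>MS\<^esub>i\<in>I. tens (g i) (coordinate i U) \<oplus>\<^bsub>MS\<^esub> tens (g i) (coordinate i V))"
    unfolding combination_def using add.hyps g coordinate_closed
    by (intro MS.finsum_addf[symmetric]) auto
  also have "\<dots> = combination (\<lambda>i. coordinate i (U \<oplus>\<^bsub>MS\<^esub> V))"
    unfolding combination_def using add.hyps g coordinate_closed
    by (intro MS.finsum_cong')
      (auto simp: abelian_group_hom.hom_add[OF coordinate_hom] tens_add_right)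
  finally show ?case .
qed

lemma XB_X'B: "b \<in> carrier MS \<Longrightarrow> XB (X'B b) = b"
  and X'B_XB: "b \<in> carrier MS \<Longrightarrow> X'B (XB b) = b"
proof -
  have id: "abelian_group_hom MS MS (\<lambda>b. b)"
    by (rule abelian_group_homI_additive) (auto simp: MS_abelian_group)
  note comp = rmod_hom_abelian_group_hom[OF rmod_hom_comp MS_right_module MS_right_module]
  show "XB (X'B b) = b" if "b \<in> carrier MS"
    by (rule tensor_hom_eqI[OF comp[OF XB.extend_map_rmod_hom X'B.extend_map_rmod_hom] id _ that])
      (simp add: X'B.extend_map_tens XB.extend_map_tens rmod_hom_closed[OF X'] X_X')
  show "X'B (XB b) = b" if "b \<in> carrier MS"
    by (rule tensor_hom_eqI[OF comp[OF X'B.extend_map_rmod_hom XB.extend_map_rmod_hom] id _ that])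
      (simp add: X'B.extend_map_tens XB.extend_map_tens rmod_hom_closed[OF X] X'_X)
qed

lemmas XB_closed = rmod_hom_closed[OF XB.extend_map_rmod_hom]
  and X'B_closed = rmod_hom_closed[OF X'B.extend_map_rmod_hom]

lemma perturbation_rmod_hom: "(\<lambda>b. XB b \<ominus>\<^bsub>MS\<^esub> var \<odot>\<^bsub>MS\<^esub> eB b) \<in> rmod_hom S MS MS"
  by (rule rmod_hom_minus[OF MS_right_module XB.extend_map_rmod_hom
        rmod_hom_comp[OF var_smult_rmod_hom eB.extend_map_rmod_hom]])

lemma perturbation_surj:
  assumes u: "u \<in> carrier MS"
  shows "\<exists>v\<in>carrier MS. XB v \<ominus>\<^bsub>MS\<^esub> var \<odot>\<^bsub>MS\<^esub> eB v = u"
proof -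
  obtain \<phi> where \<phi>: "\<And>j. j \<in> I \<Longrightarrow> \<phi> j \<in> carrier S"
    and \<phi>_eq: "\<And>j. j \<in> I \<Longrightarrow> \<phi> j = coordinate j (X'B u) \<oplus>\<^bsub>S\<^esub>
      (\<Oplus>\<^bsub>S\<^esub>i\<in>I. laurent_const R (f j (X' (g i))) \<otimes>\<^bsub>S\<^esub> \<phi> i)
        \<otimes>\<^bsub>S\<^esub> var"
    using R.linear_system_solvable[of I "\<lambda>j i. f j (X' (g i))" "\<lambda>j. coordinate j (X'B u)" k]
      finite_I matrix_closed coordinate_closed X'B_closed[OF u] by blast
  have comb: "combination \<phi> \<in> carrier MS" by (rule combination_closed[OF \<phi>])
  define v where "v = X'B (u \<oplus>\<^bsub>MS\<^esub> var \<odot>\<^bsub>MS\<^esub> combination \<phi>)"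
  have v: "v \<in> carrier MS"
    unfolding v_def by (intro X'B_closed MS.a_closed MS.smult_closed u comb var_closed)
  have "v = X'B u \<oplus>\<^bsub>MS\<^esub> var \<odot>\<^bsub>MS\<^esub> X'B (combination \<phi>)"
    unfolding v_def using u comb
    by (simp add: rmod_hom_add[OF X'B.extend_map_rmod_hom] rmod_hom_smult[OF X'B.extend_map_rmod_hom]
        MS.smult_closed)
  then have "coordinate j v = \<phi> j" if "j \<in> I" for j
    using that u comb \<phi>_eq[OF that]
    by (simp add: abelian_group_hom.hom_add[OF coordinate_hom] coordinate_smult X'B_closed MS.smult_closed
        coordinate_X'B_combination \<phi>)
  then have "combination (\<lambda>i. coordinate i v) = combination \<phi>"
    unfolding combination_def using \<phi> g by (intro MS.finsum_cong') auto
  then have "eB v = combination \<phi>" by (simp add: eB_eq[OF v])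
  then have "XB v \<ominus>\<^bsub>MS\<^esub> var \<odot>\<^bsub>MS\<^esub> eB v = u"
    using u comb by (simp add: v_def XB_X'B MS.smult_closed MS.minus_eq_iff)
  with v show ?thesis by blast
qed

lemma perturbation_inj:
  assumes v: "v \<in> carrier MS" and eq: "XB v \<ominus>\<^bsub>MS\<^esub> var \<odot>\<^bsub>MS\<^esub> eB v = \<zero>\<^bsub>MS\<^esub>"
  shows "v = \<zero>\<^bsub>MS\<^esub>"
proof -
  let ?\<phi> = "\<lambda>i. coordinate i v"
  have \<phi>: "i \<in> I \<Longrightarrow> ?\<phi> i \<in> carrier S" for i by (rule coordinate_closed[OF _ v])
  have comb: "combination ?\<phi> \<in> carrier MS" by (rule combination_closed[OF \<phi>])
  have "XB v = var \<odot>\<^bsub>MS\<^esub> combination ?\<phi>"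
    using eq comb by (simp add: eB_eq[OF v] MS.minus_eq_iff XB_closed[OF v] MS.smult_closed)
  then have v_eq: "v = var \<odot>\<^bsub>MS\<^esub> X'B (combination ?\<phi>)"
    using X'B_XB[OF v] comb by (simp add: rmod_hom_smult[OF X'B.extend_map_rmod_hom])
  have zero: "?\<phi> j = \<zero>\<^bsub>S\<^esub>" if "j \<in> I" for j
  proof (rule R.linear_system_unique[of I "\<lambda>j i. f j (X' (g i))"])
    fix j assume j: "j \<in> I"
    have "?\<phi> j = coordinate j (var \<odot>\<^bsub>MS\<^esub> X'B (combination ?\<phi>))" using v_eq by simp
    then show "?\<phi> j = (\<Oplus>\<^bsub>S\<^esub>i\<in>I. laurent_const R (f j (X' (g i)))
        \<otimes>\<^bsub>S\<^esub> ?\<phi> i) \<otimes>\<^bsub>S\<^esub> var"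
      using j comb by (simp add: coordinate_smult X'B_closed coordinate_X'B_combination \<phi>)
  qed (use finite_I matrix_closed \<phi> that in auto)
  have "combination ?\<phi> = \<zero>\<^bsub>MS\<^esub>"
    unfolding combination_def using g zero
    by (intro MS.add.finprod_one_eqI) (simp add: abelian_group_hom.hom_zero[OF tens_right_hom])
  then show ?thesis
    using v_eq rmod_hom_map_zero[OF X'B.extend_map_rmod_hom MS_right_module MS_right_module]
    by (simp add: MS.smult_zero_right)
qed

lemma perturbation_bij: "bij_betw (\<lambda>b. XB b \<ominus>\<^bsub>MS\<^esub> var \<odot>\<^bsub>MS\<^esub> eB b) (carrier MS) (carrier MS)"
  (is "bij_betw ?p _ _")
proof -
  interpret p: abelian_group_hom MS MS ?p
    by (rule rmod_hom_abelian_group_hom[OF perturbation_rmod_hom MS_right_module MS_right_module])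
  have "inj_on ?p (carrier MS)"
    by (rule p.inj_onI_kernel) (rule perturbation_inj)
  moreover have "?p ` carrier MS = carrier MS"
    using perturbation_surj p.hom_closed by blast
  ultimately show ?thesis by (simp add: bij_betw_def)
qed

end

section \<open>Modules over the Laurent polynomial ring\<close>

locale laurent_module = R: ring R + T: tensor "laurent_ring R" "novikov_ring R" "\<lambda>f. f" M
  for R :: "('a, 'r) ring_scheme" and M :: "(int ^ 'n::finite \<Rightarrow> 'a, 'm) module" +
  fixes k :: 'n
begin

abbreviation "L \<equiv> laurent_ring R :: (int ^ 'n \<Rightarrow> 'a) ring"
abbreviation "N \<equiv> novikov_ring R :: (int ^ 'n \<Rightarrow> 'a) ring"
abbreviation "S \<equiv> axis_series_ring R k"
abbreviation "MR \<equiv> restrict_scalars (laurent_const R) M"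

lemma MR_right_module: "right_module R MR"
  by (rule restrict_scalars_right_module[OF R.ring_axioms R.laurent_const_ring_hom T.M.right_module_axioms])

lemma MR_axis_tensor: "axis_tensor R k MR"
  using MR_right_module
  by (simp add: axis_tensor_def tensor_def tensor_axioms_def R.ring_axioms R.axis_series_ring
      R.laurent_const_axis_series_ring_hom)

sublocale B: axis_tensor R k MR
  by (rule MR_axis_tensor)

abbreviation shift :: "int ^ 'n \<Rightarrow> 'm \<Rightarrow> 'm" where "shift a x \<equiv> monomial R a \<one>\<^bsub>R\<^esub> \<odot>\<^bsub>M\<^esub> x"

lemma axis_subset_novikov: "s \<in> carrier S \<Longrightarrow> s \<in> carrier N"
  using R.axis_series_subset_novikov by blast

lemma laurent_subset_novikov: "f \<in> carrier L \<Longrightarrow> f \<in> carrier N"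
  using R.laurent_subset_novikov by blast

lemma monomial_laurent [simp]: "r \<in> carrier R \<Longrightarrow> monomial R a r \<in> carrier L"
  by (rule R.monomial_laurent)

lemma shift_closed [simp]: "x \<in> carrier M \<Longrightarrow> shift a x \<in> carrier M"
  by (simp add: T.M.smult_closed)

lemma monomial_smult_monomial_smult:
  "\<lbrakk>r \<in> carrier R; s \<in> carrier R; x \<in> carrier M\<rbrakk> \<Longrightarrow>
   monomial R a r \<odot>\<^bsub>M\<^esub> (monomial R b s \<odot>\<^bsub>M\<^esub> x) = monomial R (a + b) (s \<otimes>\<^bsub>R\<^esub> r) \<odot>\<^bsub>M\<^esub> x"
  by (simp add: R.laurent_simps R.monomial_mult_monomial add.commute flip: T.M.smult_assoc)

lemma monomial_expansion:
  assumes f: "f \<in> carrier L"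
  shows "(\<Oplus>\<^bsub>L\<^esub>a\<in>{a. f a \<noteq> \<zero>\<^bsub>R\<^esub>}. monomial R a (f a)) = f"
proof
  fix b
  let ?A = "{a. f a \<noteq> \<zero>\<^bsub>R\<^esub>}"
  have A: "finite ?A" and closed: "f a \<in> carrier R" for a
    using f by (simp_all add: R.laurent_carrier_iff)
  interpret eval: abelian_group_hom L R "\<lambda>f. f b"
    by (rule abelian_group_homI_additive)
      (simp_all add: T.M.R.abelian_group_axioms R.abelian_group_axioms R.laurent_coeff_closed
        R.laurent_simps R.novikov_simps)
  have "(\<Oplus>\<^bsub>L\<^esub>a\<in>?A. monomial R a (f a)) b = (\<Oplus>\<^bsub>R\<^esub>a\<in>?A. monomial R a (f a) b)"
    using closed by (intro eval.hom_finsum) auto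
  also have "\<dots> = (\<Oplus>\<^bsub>R\<^esub>a\<in>?A. if b = a then f a else \<zero>\<^bsub>R\<^esub>)"
    by (simp add: monomial_def)
  also have "\<dots> = f b"
    using A closed by (simp add: R.finsum_delta Pi_iff)
  finally show "(\<Oplus>\<^bsub>L\<^esub>a\<in>?A. monomial R a (f a)) b = f b" .
qed

lemma monomial_smult_expansion:
  assumes f: "f \<in> carrier L" and x: "x \<in> carrier M"
  shows "(\<Oplus>\<^bsub>M\<^esub>a\<in>{a. f a \<noteq> \<zero>\<^bsub>R\<^esub>}. monomial R a (f a) \<odot>\<^bsub>M\<^esub> x) = f \<odot>\<^bsub>M\<^esub> x"
proof -
  interpret smult: abelian_group_hom L M "\<lambda>f. f \<odot>\<^bsub>M\<^esub> x"
    using x by (intro abelian_group_homI_additive T.M.R.abelian_group_axioms T.M.M.abelian_group_axioms)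
      (simp_all add: T.M.smult_closed T.M.smult_l_distr)
  have "(\<lambda>a. monomial R a (f a)) \<in> {a. f a \<noteq> \<zero>\<^bsub>R\<^esub>} \<rightarrow> carrier L"
    using R.laurent_coeff_closed[OF f] by simp
  from smult.hom_finsum[OF this] show ?thesis by (simp add: monomial_expansion f)
qed

lemma shift_shift: "x \<in> carrier M \<Longrightarrow> shift a (shift b x) = shift (a + b) x"
  by (simp add: monomial_smult_monomial_smult)

lemma shift_zero: "x \<in> carrier M \<Longrightarrow> shift 0 x = x"
  using T.M.smult_one[of x] by (simp add: R.laurent_simps R.novikov_simps)

lemma shift_rmod_hom: "shift a \<in> rmod_hom R MR MR"
  by (rule smult_rmod_hom_restrict_scalars[OF T.M.right_module_axioms R.laurent_const_ring_hom])
    (simp_all add: R.laurent_simps laurent_const_eq_monomial R.monomial_mult_monomial)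

subsection \<open>Evaluation of the variable\<close>

lemma ex_comparison: "\<exists>h. abelian_group_hom B.MS T.MS h \<and>
    (\<forall>x\<in>carrier MR. \<forall>s\<in>carrier S. h (B.tens x s) = T.tens x s)"
  by (rule B.ex_tensor_lift[OF T.MS_abelian_group])
    (simp_all add: axis_subset_novikov T.tens_add_left T.tens_add_right T.tens_balanced
      R.axis_series_simps laurent_const_eq_monomial)

definition comparison ::
  "('m, int ^ 'n \<Rightarrow> 'a) tensor_elem \<Rightarrow> ('m, int ^ 'n \<Rightarrow> 'a) tensor_elem" where
  "comparison = (SOME h. abelian_group_hom B.MS T.MS h \<and>
     (\<forall>x\<in>carrier MR. \<forall>s\<in>carrier S. h (B.tens x s) = T.tens x s))"

lemma comparison_hom: "abelian_group_hom B.MS T.MS comparison"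
  and comparison_tens: "\<lbrakk>x \<in> carrier M; s \<in> carrier S\<rbrakk> \<Longrightarrow> comparison (B.tens x s) = T.tens x s"
  using someI_ex[OF ex_comparison] by (simp_all add: comparison_def)

sublocale X: tensor_map R S "laurent_const R" MR MR "shift (axis k 1)"
  by unfold_locales (rule shift_rmod_hom)

abbreviation "XB \<equiv> extend_map R S (laurent_const R) MR (shift (axis k 1))"

definition \<zeta> :: "('m, int ^ 'n \<Rightarrow> 'a) tensor_elem \<Rightarrow> ('m, int ^ 'n \<Rightarrow> 'a) tensor_elem" where
  "\<zeta> b = XB b \<ominus>\<^bsub>B.MS\<^esub> B.var \<odot>\<^bsub>B.MS\<^esub> b"

lemma \<zeta>_rmod_hom: "\<zeta> \<in> rmod_hom S B.MS B.MS"
  unfolding \<zeta>_def by (rule rmod_hom_minus[OF B.MS_right_module X.extend_map_rmod_hom B.var_smult_rmod_hom])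

sublocale \<zeta>: abelian_group_hom B.MS B.MS \<zeta>
  by (rule rmod_hom_abelian_group_hom[OF \<zeta>_rmod_hom B.MS_right_module B.MS_right_module])

lemma \<zeta>_tens:
  "\<lbrakk>x \<in> carrier M; s \<in> carrier S\<rbrakk> \<Longrightarrow>
   \<zeta> (B.tens x s) = B.tens (shift (axis k 1) x) s \<ominus>\<^bsub>B.MS\<^esub> B.tens x (B.var \<otimes>\<^bsub>S\<^esub> s)"
  by (simp add: \<zeta>_def X.extend_map_tens B.MS_smult_tens B.var_central)

lemma comparison_\<zeta>:
  assumes "b \<in> carrier B.MS"
  shows "comparison (\<zeta> b) = \<zero>\<^bsub>T.MS\<^esub>"
proof -
  interpret comparison: abelian_group_hom B.MS T.MS comparison by (rule comparison_hom)
  show ?thesis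
    using assms
  proof (induction rule: B.tensor_induct)
    case (tens x s)
    then have xs: "x \<in> carrier M" "s \<in> carrier S" by simp_all
    then have balanced: "T.tens (shift (axis k 1) x) s = T.tens x (B.var \<otimes>\<^bsub>S\<^esub> s)"
      by (simp add: T.tens_balanced axis_subset_novikov R.axis_series_simps)
    have "comparison (\<zeta> (B.tens x s)) = T.tens (shift (axis k 1) x) s \<ominus>\<^bsub>T.MS\<^esub> T.tens x (B.var \<otimes>\<^bsub>S\<^esub> s)"
      using xs by (simp add: \<zeta>_tens comparison.hom_minus comparison_tens)
    also have "\<dots> = \<zero>\<^bsub>T.MS\<^esub>"
      unfolding balanced using xs by (intro T.MS.minus_self) (simp add: axis_subset_novikov)
    finally show ?case .
  next
    case (add U V)
    then show ?case by simp
  qed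
qed

definition \<zeta>_cong :: "('m, int ^ 'n \<Rightarrow> 'a) tensor_elem \<Rightarrow> ('m, int ^ 'n \<Rightarrow> 'a) tensor_elem \<Rightarrow> bool"
    (infix "\<doteq>" 50) where
  "b \<doteq> c \<longleftrightarrow> b \<in> carrier B.MS \<and> c \<in> carrier B.MS \<and> (\<exists>v\<in>carrier B.MS. b = c \<oplus>\<^bsub>B.MS\<^esub> \<zeta> v)"

lemma \<zeta>_congI:
  "\<lbrakk>b \<in> carrier B.MS; c \<in> carrier B.MS; v \<in> carrier B.MS; \<zeta> v = b \<ominus>\<^bsub>B.MS\<^esub> c\<rbrakk> \<Longrightarrow> b \<doteq> c"
  unfolding \<zeta>_cong_def by (auto simp: a_minus_def B.MS.a_ac B.MS.r_neg intro!: bexI[of _ v])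

lemma \<zeta>_cong_refl: "b \<in> carrier B.MS \<Longrightarrow> b \<doteq> b"
  unfolding \<zeta>_cong_def by (auto intro!: bexI[of _ "\<zero>\<^bsub>B.MS\<^esub>"])

lemma \<zeta>_cong_sym: "b \<doteq> c \<Longrightarrow> c \<doteq> b"
proof -
  assume "b \<doteq> c"
  then obtain v where "b \<in> carrier B.MS" "c \<in> carrier B.MS" "v \<in> carrier B.MS" "b = c \<oplus>\<^bsub>B.MS\<^esub> \<zeta> v"
    by (auto simp: \<zeta>_cong_def)
  then show ?thesis
    unfolding \<zeta>_cong_def by (auto intro!: bexI[of _ "\<ominus>\<^bsub>B.MS\<^esub> v"] simp: B.MS.a_assoc B.MS.r_neg)
qed

lemma \<zeta>_cong_add: "\<lbrakk>b \<doteq> c; b' \<doteq> c'\<rbrakk> \<Longrightarrow> b \<oplus>\<^bsub>B.MS\<^esub> b' \<doteq> c \<oplus>\<^bsub>B.MS\<^esub> c'"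
proof -
  assume "b \<doteq> c" "b' \<doteq> c'"
  then obtain v v' where "b \<in> carrier B.MS" "c \<in> carrier B.MS" "v \<in> carrier B.MS" "b = c \<oplus>\<^bsub>B.MS\<^esub> \<zeta> v"
    "b' \<in> carrier B.MS" "c' \<in> carrier B.MS" "v' \<in> carrier B.MS" "b' = c' \<oplus>\<^bsub>B.MS\<^esub> \<zeta> v'"
    by (auto simp: \<zeta>_cong_def)
  then show ?thesis
    unfolding \<zeta>_cong_def by (auto intro!: bexI[of _ "v \<oplus>\<^bsub>B.MS\<^esub> v'"] simp: B.MS.a_ac)
qed

lemma \<zeta>_cong_trans [trans]: "\<lbrakk>b \<doteq> c; c \<doteq> d\<rbrakk> \<Longrightarrow> b \<doteq> d"
proof -
  assume "b \<doteq> c" "c \<doteq> d"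
  then obtain v w where "b \<in> carrier B.MS" "d \<in> carrier B.MS" "v \<in> carrier B.MS" "w \<in> carrier B.MS"
    "c \<in> carrier B.MS" "b = c \<oplus>\<^bsub>B.MS\<^esub> \<zeta> v" "c = d \<oplus>\<^bsub>B.MS\<^esub> \<zeta> w"
    by (auto simp: \<zeta>_cong_def)
  then show ?thesis
    unfolding \<zeta>_cong_def by (auto intro!: bexI[of _ "v \<oplus>\<^bsub>B.MS\<^esub> w"] simp: B.MS.a_ac)
qed

lemma \<zeta>_cong_finsum:
  assumes "finite G" "\<And>i. i \<in> G \<Longrightarrow> f i \<doteq> h i"
  shows "(\<Oplus>\<^bsub>B.MS\<^esub>i\<in>G. f i) \<doteq> (\<Oplus>\<^bsub>B.MS\<^esub>i\<in>G. h i)"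
  using assms
proof (induction G rule: finite_induct)
  case empty
  then show ?case by (simp add: \<zeta>_cong_refl)
next
  case (insert i G)
  then have "f j \<in> carrier B.MS" "h j \<in> carrier B.MS" if "j \<in> insert i G" for j
    using that by (auto simp: \<zeta>_cong_def)
  with insert show ?case by (simp add: Pi_iff \<zeta>_cong_add)
qed

lemma tens_var_cong:
  "\<lbrakk>x \<in> carrier M; s \<in> carrier S\<rbrakk> \<Longrightarrow> B.tens (shift (axis k 1) x) s \<doteq> B.tens x (B.var \<otimes>\<^bsub>S\<^esub> s)"
  by (rule \<zeta>_congI[of _ _ "B.tens x s"]) (simp_all add: \<zeta>_tens)

lemma tens_axis_monomial_cong:
  assumes "x \<in> carrier M" "s \<in> carrier S"
  shows "B.tens (shift (axis k l) x) s \<doteq> B.tens x (monomial R (axis k l) \<one>\<^bsub>R\<^esub> \<otimes>\<^bsub>S\<^esub> s)"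
  using assms
proof (induction l arbitrary: x s rule: int_induct[where k = 0])
  case base
  then show ?case
    using B.S.l_one[of s]
    by (simp add: shift_zero \<zeta>_cong_refl R.axis_series_simps R.novikov_simps)
next
  case (step1 l)
  have "shift (axis k (l + 1)) x = shift (axis k 1) (shift (axis k l) x)"
    using step1.prems by (simp add: shift_shift axis_add add.commute)
  then have "B.tens (shift (axis k (l + 1)) x) s \<doteq> B.tens (shift (axis k l) x) (B.var \<otimes>\<^bsub>S\<^esub> s)"
    using step1.prems by (simp add: tens_var_cong)
  also have "\<dots> \<doteq> B.tens x (monomial R (axis k l) \<one>\<^bsub>R\<^esub> \<otimes>\<^bsub>S\<^esub> (B.var \<otimes>\<^bsub>S\<^esub> s))"
    using step1.prems by (intro step1.IH) simp_all
  also have "monomial R (axis k l) \<one>\<^bsub>R\<^esub> \<otimes>\<^bsub>S\<^esub> (B.var \<otimes>\<^bsub>S\<^esub> s) = monomial R (axis k (l + 1)) \<one>\<^bsub>R\<^esub> \<otimes>\<^bsub>S\<^esub> s"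
    using step1.prems
    by (simp add: R.axis_monomial_axis_series flip: B.S.m_assoc)
      (simp add: R.axis_series_simps R.monomial_mult_monomial axis_add)
  finally show ?case .
next
  case (step2 l)
  let ?x = "shift (axis k (- 1)) x" and ?s = "monomial R (axis k (l - 1)) \<one>\<^bsub>R\<^esub> \<otimes>\<^bsub>S\<^esub> s"
  have x: "shift (axis k (l - 1)) x = shift (axis k l) ?x" "shift (axis k 1) ?x = x"
    using step2.prems by (simp_all add: shift_shift axis_add shift_zero)
  have s: "?s \<in> carrier S" using step2.prems by (simp add: R.axis_monomial_axis_series)
  have "B.tens (shift (axis k (l - 1)) x) s \<doteq> B.tens ?x (monomial R (axis k l) \<one>\<^bsub>R\<^esub> \<otimes>\<^bsub>S\<^esub> s)"
    unfolding x(1) using step2.prems by (intro step2.IH) simp_all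
  also have "monomial R (axis k l) \<one>\<^bsub>R\<^esub> \<otimes>\<^bsub>S\<^esub> s = B.var \<otimes>\<^bsub>S\<^esub> ?s"
    using step2.prems
    by (simp add: R.axis_monomial_axis_series flip: B.S.m_assoc)
      (simp add: R.axis_series_simps R.monomial_mult_monomial axis_add)
  also have "B.tens ?x (B.var \<otimes>\<^bsub>S\<^esub> ?s) \<doteq> B.tens (shift (axis k 1) ?x) ?s"
    using step2.prems s by (intro \<zeta>_cong_sym[OF tens_var_cong]) simp_all
  finally show ?case by (simp only: x(2))
qed

lemma monomial_smult_comparison_mem:
  assumes r: "r \<in> carrier R" and "b \<in> carrier B.MS"
  shows "monomial R a r \<odot>\<^bsub>T.MS\<^esub> comparison b \<in> comparison ` carrier B.MS"
  using assms(2)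
proof (induction rule: B.tensor_induct)
  case (tens x s)
  then have xs: "x \<in> carrier M" "s \<in> carrier S" "s \<in> carrier N"
    by (simp_all add: axis_subset_novikov)
  have sr: "s \<otimes>\<^bsub>S\<^esub> laurent_const R r \<in> carrier S" using xs(2) r by (simp add: B.phi_closed)
  have "s \<otimes>\<^bsub>N\<^esub> monomial R a r = monomial R a \<one>\<^bsub>R\<^esub> \<otimes>\<^bsub>N\<^esub> (s \<otimes>\<^bsub>S\<^esub> laurent_const R r)"
    using r xs R.novikov_coeff_closed[OF xs(3)]
    by (simp add: R.axis_series_simps laurent_const_eq_monomial R.monomial_mult)
  then have "monomial R a r \<odot>\<^bsub>T.MS\<^esub> comparison (B.tens x s) =
      comparison (B.tens (shift a x) (s \<otimes>\<^bsub>S\<^esub> laurent_const R r))"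
    using r xs sr
    by (simp add: comparison_tens T.MS_smult_tens R.monomial_novikov T.tens_balanced axis_subset_novikov)
  then show ?case using xs sr by auto
next
  case (add U V)
  interpret comparison: abelian_group_hom B.MS T.MS comparison by (rule comparison_hom)
  obtain U' V' where images: "U' \<in> carrier B.MS" "monomial R a r \<odot>\<^bsub>T.MS\<^esub> comparison U = comparison U'"
    "V' \<in> carrier B.MS" "monomial R a r \<odot>\<^bsub>T.MS\<^esub> comparison V = comparison V'"
    using add.IH by blast
  then have "monomial R a r \<odot>\<^bsub>T.MS\<^esub> comparison (U \<oplus>\<^bsub>B.MS\<^esub> V) = comparison (U' \<oplus>\<^bsub>B.MS\<^esub> V')"
    using add.hyps r by (simp add: T.MS.smult_r_distr R.monomial_novikov)
  then show ?case by (rule image_eqI) (use images(1,3) in simp)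
qed

lemma comparison_image_submodule: "submodule (comparison ` carrier B.MS) L T.MS"
proof -
  interpret comparison: abelian_group_hom B.MS T.MS comparison by (rule comparison_hom)
  let ?U = "comparison ` carrier B.MS"
  have "f \<odot>\<^bsub>T.MS\<^esub> U \<in> ?U" if "f \<in> carrier L" "U \<in> ?U" for f U
    using that(1)
  proof (induction rule: R.laurent_induct)
    case zero
    have "\<zero>\<^bsub>L\<^esub> \<odot>\<^bsub>T.MS\<^esub> U = comparison \<zero>\<^bsub>B.MS\<^esub>"
      using that(2) by (auto simp: R.laurent_simps T.MS.smult_zero_left)
    then show ?case by blast
  next
    case (add f a r)
    have "monomial R a r \<odot>\<^bsub>T.MS\<^esub> U \<in> ?U"
      using monomial_smult_comparison_mem that(2) add.hyps by auto
    moreover have "(f \<oplus>\<^bsub>L\<^esub> monomial R a r) \<odot>\<^bsub>T.MS\<^esub> U = f \<odot>\<^bsub>T.MS\<^esub> U \<oplus>\<^bsub>T.MS\<^esub> monomial R a r \<odot>\<^bsub>T.MS\<^esub> U"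
      using add.hyps that(2)
      by (auto simp: laurent_subset_novikov R.laurent_simps T.MS.smult_l_distr R.monomial_novikov)
    ultimately show ?case using add.IH by (auto simp flip: comparison.hom_add)
  qed
  moreover have "subgroup ?U (add_monoid T.MS)"
    using group_hom.img_is_subgroup[OF comparison.a_group_hom] by simp
  ultimately show ?thesis by (simp add: submodule_def submodule_axioms_def)
qed

end

subsection \<open>Coordinates of projective modules\<close>

locale laurent_dual_basis = laurent_module R M k + dual_basis "laurent_ring R" M I \<theta> e
  for R :: "('a, 'r) ring_scheme" and M :: "(int ^ 'n::finite \<Rightarrow> 'a, 'm) module" and k :: 'n
    and I :: "'i set" and \<theta> :: "'i \<Rightarrow> 'm \<Rightarrow> int ^ 'n \<Rightarrow> 'a" and e :: "'i \<Rightarrow> 'm"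
begin

definition coefficient :: "'i \<times> (int ^ 'n) \<Rightarrow> 'm \<Rightarrow> 'a" where
  "coefficient p x = \<theta> (fst p) x (snd p)"

definition monomial_generator :: "'i \<times> (int ^ 'n) \<Rightarrow> 'm" where
  "monomial_generator p = shift (snd p) (e (fst p))"

lemma monomial_generator_closed: "p \<in> I \<times> UNIV \<Longrightarrow> monomial_generator p \<in> carrier M"
  by (auto simp: monomial_generator_def generator_closed)

lemma coefficient_smult_monomial:
  "\<lbrakk>i \<in> I; r \<in> carrier R; x \<in> carrier M\<rbrakk> \<Longrightarrow>
   coefficient (i, a) (monomial R b r \<odot>\<^bsub>M\<^esub> x) = coefficient (i, a - b) x \<otimes>\<^bsub>R\<^esub> r"
  using R.laurent_coeff_closed[OF functional_closed]
  by (simp add: coefficient_def functional_smult R.laurent_simps R.monomial_mult)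

lemma coefficient_functional:
  assumes "p \<in> I \<times> UNIV"
  shows "coefficient p \<in> rmod_hom R MR (regular_rmodule R)"
proof -
  obtain i a where p: "p = (i, a)" "i \<in> I" using assms by auto
  show ?thesis
    unfolding p(1)
  proof (rule rmod_homI)
    show "coefficient (i, a) (r \<odot>\<^bsub>MR\<^esub> x) = r \<odot>\<^bsub>regular_rmodule R\<^esub> coefficient (i, a) x"
      if "r \<in> carrier R" "x \<in> carrier MR" for r x
      using coefficient_smult_monomial[OF p(2) that(1), of x a 0] that by (simp add: laurent_const_eq_monomial)
  qed (use p(2) in \<open>simp_all add: coefficient_def functional_add R.laurent_simps R.novikov_simps
        R.laurent_coeff_closed[OF functional_closed]\<close>)
qed

lemma coefficient_support:
  "{p \<in> I \<times> UNIV. coefficient p x \<noteq> \<zero>\<^bsub>R\<^esub>} =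
   Sigma {i \<in> I. \<theta> i x \<noteq> \<zero>\<^bsub>L\<^esub>} (\<lambda>i. {a. \<theta> i x a \<noteq> \<zero>\<^bsub>R\<^esub>})"
  by (auto simp: coefficient_def R.laurent_simps R.novikov_simps)

lemma coefficient_expansion:
  assumes x: "x \<in> carrier M"
  shows "(\<Oplus>\<^bsub>M\<^esub>p\<in>{p \<in> I \<times> UNIV. coefficient p x \<noteq> \<zero>\<^bsub>R\<^esub>}. coefficient p x \<odot>\<^bsub>MR\<^esub> monomial_generator p) = x"
proof -
  let ?I = "{i \<in> I. \<theta> i x \<noteq> \<zero>\<^bsub>L\<^esub>}" and ?supp = "\<lambda>i. {a. \<theta> i x a \<noteq> \<zero>\<^bsub>R\<^esub>}"
  have closed: "\<theta> i x a \<in> carrier R" if "i \<in> I" for i a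
    by (rule R.laurent_coeff_closed[OF functional_closed[OF that x]])
  have finite_supp: "finite (?supp i)" if "i \<in> I" for i
    using functional_closed[OF that x] by (simp add: R.laurent_carrier_iff)
  have "coefficient (i, a) x \<odot>\<^bsub>MR\<^esub> monomial_generator (i, a) = monomial R a (\<theta> i x a) \<odot>\<^bsub>M\<^esub> e i"
    if "i \<in> I" for i a
    using that closed generator_closed
    by (simp add: coefficient_def monomial_generator_def laurent_const_eq_monomial
        monomial_smult_monomial_smult)
  then have "(\<Oplus>\<^bsub>M\<^esub>p\<in>{p \<in> I \<times> UNIV. coefficient p x \<noteq> \<zero>\<^bsub>R\<^esub>}. coefficient p x \<odot>\<^bsub>MR\<^esub> monomial_generator p) =
      (\<Oplus>\<^bsub>M\<^esub>p\<in>Sigma ?I ?supp. case_prod (\<lambda>i a. monomial R a (\<theta> i x a) \<odot>\<^bsub>M\<^esub> e i) p)"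
    unfolding coefficient_support
    using closed generator_closed by (intro T.M.M.finsum_cong') (auto simp: T.M.smult_closed)
  also have "\<dots> = (\<Oplus>\<^bsub>M\<^esub>i\<in>?I. \<Oplus>\<^bsub>M\<^esub>a\<in>?supp i. monomial R a (\<theta> i x a) \<odot>\<^bsub>M\<^esub> e i)"
    using closed generator_closed finite_support[OF x] finite_supp
    by (intro T.M.M.finsum_Sigma) (auto simp: T.M.smult_closed)
  also have "\<dots> = (\<Oplus>\<^bsub>M\<^esub>i\<in>?I. \<theta> i x \<odot>\<^bsub>M\<^esub> e i)"
    using generator_closed functional_closed[OF _ x]
    by (intro T.M.M.finsum_cong') (auto simp: monomial_smult_expansion T.M.smult_closed)
  also have "\<dots> = x" by (rule expansion[OF x])
  finally show ?thesis .
qed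

lemma coefficient_dual_basis: "dual_basis R MR (I \<times> UNIV) coefficient monomial_generator"
proof unfold_locales
  show "monomial_generator p \<in> carrier MR" if "p \<in> I \<times> UNIV" for p
    using monomial_generator_closed[OF that] by simp
  fix x assume "x \<in> carrier MR"
  then have x: "x \<in> carrier M" by simp
  let ?supp = "{p \<in> I \<times> UNIV. coefficient p x \<noteq> \<zero>\<^bsub>R\<^esub>}"
  show "finite ?supp"
    unfolding coefficient_support using finite_support[OF x] functional_closed[OF _ x]
    by (intro finite_SigmaI) (auto simp: R.laurent_carrier_iff)
  have "(\<lambda>p. coefficient p x \<odot>\<^bsub>MR\<^esub> monomial_generator p) \<in> ?supp \<rightarrow> carrier M"
    using rmod_hom_closed[OF coefficient_functional] x monomial_generator_closed
    by (auto simp: T.M.smult_closed laurent_const_eq_monomial)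
  from restrict_scalars_finsum[OF T.M.M.abelian_group_axioms this] coefficient_expansion[OF x]
  show "(\<Oplus>\<^bsub>MR\<^esub>p\<in>?supp. coefficient p x \<odot>\<^bsub>MR\<^esub> monomial_generator p) = x"
    by (rule trans)
qed (rule coefficient_functional)

definition coordinate :: "'i \<times> (int ^ 'n) \<Rightarrow> ('m, int ^ 'n \<Rightarrow> 'a) tensor_elem \<Rightarrow> int ^ 'n \<Rightarrow> 'a" where
  "coordinate p = B.extend_functional (coefficient p)"

sublocale B: dual_basis S B.MS "I \<times> UNIV" coordinate "\<lambda>p. B.tens (monomial_generator p) \<one>\<^bsub>S\<^esub>"
  unfolding coordinate_def by (rule B.dual_basis_extend_scalars[OF coefficient_dual_basis])

lemma coordinate_tens:
  "\<lbrakk>i \<in> I; x \<in> carrier M; s \<in> carrier S\<rbrakk> \<Longrightarrow>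
   coordinate (i, a) (B.tens x s) = laurent_const R (coefficient (i, a) x) \<otimes>\<^bsub>S\<^esub> s"
  unfolding coordinate_def by (rule B.extend_functional_tens[OF coefficient_functional]) simp_all

lemma coordinate_coeff_closed: "\<lbrakk>i \<in> I; b \<in> carrier B.MS\<rbrakk> \<Longrightarrow> coordinate (i, a) b c \<in> carrier R"
  by (rule R.novikov_coeff_closed[OF axis_subset_novikov[OF B.functional_closed]]) auto

lemma coordinate_outside_axis:
  "\<lbrakk>i \<in> I; b \<in> carrier B.MS; coordinate (i, a) b c \<noteq> \<zero>\<^bsub>R\<^esub>\<rbrakk> \<Longrightarrow> c = axis k (c $ k)"
  using B.functional_closed[of "(i, a)" b] by (simp add: R.axis_series_carrier_iff)

lemma coordinate_XB:
  assumes i: "i \<in> I" and "b \<in> carrier B.MS"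
  shows "coordinate (i, a) (XB b) = coordinate (i, a - axis k 1) b"
proof (rule B.tensor_hom_eqI[OF _ _ _ assms(2)])
  have hom: "coordinate (i, a) \<in> rmod_hom S B.MS (regular_rmodule S)" for a
    using i by (intro B.functional) simp
  show "abelian_group_hom B.MS S (coordinate (i, a - axis k 1))"
    by (rule functional_abelian_group_hom[OF hom B.MS_right_module])
  show "abelian_group_hom B.MS S (\<lambda>b. coordinate (i, a) (XB b))"
    by (rule functional_abelian_group_hom[OF rmod_hom_comp[OF hom X.extend_map_rmod_hom] B.MS_right_module])
  fix x s assume "x \<in> carrier MR" "s \<in> carrier S"
  then show "coordinate (i, a) (XB (B.tens x s)) = coordinate (i, a - axis k 1) (B.tens x s)"
    using i R.laurent_coeff_closed[OF functional_closed[OF i]]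
    by (simp add: X.extend_map_tens coordinate_tens coefficient_smult_monomial) (simp add: coefficient_def)
qed

subsection \<open>The quotient by the difference of the two variables\<close>

text \<open>
  If \<open>\<zeta> b = 0\<close>, a nonzero coordinate of \<open>b\<close> at the exponent \<open>a\<close> forces nonzero coordinates at all
  exponents \<open>a - axis k l\<close>.
\<close>

lemma \<zeta>_inj: "inj_on \<zeta> (carrier B.MS)"
proof (rule \<zeta>.inj_onI_kernel)
  fix b assume b: "b \<in> carrier B.MS" and "\<zeta> b = \<zero>\<^bsub>B.MS\<^esub>"
  then have XB_eq: "XB b = B.var \<odot>\<^bsub>B.MS\<^esub> b"
    using rmod_hom_closed[OF X.extend_map_rmod_hom b]
    by (simp add: \<zeta>_def B.MS.minus_eq_iff B.MS.smult_closed)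
  have coordinate_pred: "coordinate (i, a - axis k 1) b = coordinate (i, a) b \<otimes>\<^bsub>S\<^esub> B.var" if "i \<in> I" for i a
    using that coordinate_XB[OF that b, of a] by (simp add: XB_eq B.functional_smult b)
  have "coordinate (i, a) b = \<zero>\<^bsub>S\<^esub>" if i: "i \<in> I" for i a
  proof (rule ccontr)
    assume nonzero: "coordinate (i, a) b \<noteq> \<zero>\<^bsub>S\<^esub>"
    have "coordinate (i, a - axis k (int l)) b \<noteq> \<zero>\<^bsub>S\<^esub>" for l
    proof (induction l)
      case (Suc l)
      let ?c = "coordinate (i, a - axis k (int l)) b"
      obtain d where d: "?c d \<noteq> \<zero>\<^bsub>R\<^esub>"
        using Suc by (auto simp: R.axis_series_simps R.novikov_simps)
      have axis_Suc: "a - axis k (int (Suc l)) = a - axis k (int l) - axis k 1"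
        by (simp add: diff_diff_eq axis_add add.commute)
      have "coordinate (i, a - axis k (int (Suc l))) b (d + axis k 1) = ?c d"
        unfolding axis_Suc coordinate_pred[OF i] using coordinate_coeff_closed[OF i b]
        by (simp add: R.axis_series_simps R.monomial_mult)
      with d show ?case by (auto simp: R.axis_series_simps R.novikov_simps)
    qed (use nonzero in simp)
    then have "range (\<lambda>l. (i, a - axis k (int l))) \<subseteq> {p \<in> I \<times> UNIV. coordinate p b \<noteq> \<zero>\<^bsub>S\<^esub>}"
      using i by auto
    moreover have "inj (\<lambda>l. (i, a - axis k (int l) :: int ^ 'n))"
      by (auto simp: inj_def axis_eq_axis)
    ultimately show False
      using B.finite_support[OF b] finite_subset range_inj_infinite by blast
  qed
  then have no_support: "{p \<in> I \<times> UNIV. coordinate p b \<noteq> \<zero>\<^bsub>S\<^esub>} = {}" by auto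
  from B.expansion[OF b] show "b = \<zero>\<^bsub>B.MS\<^esub>" unfolding no_support by simp
qed

text \<open>This expresses \<open>x\<^sub>k = X\<close> in terms of coordinates: the coefficients of the image of \<open>b\<close> add up.\<close>

lemma comparison_coeff_tens:
  assumes i: "i \<in> I" and x: "x \<in> carrier M" and s: "s \<in> carrier S"
    and A: "finite A" "{a. \<theta> i x a \<noteq> \<zero>\<^bsub>R\<^esub>} \<subseteq> A"
  shows "T.extend_functional (\<theta> i) (comparison (B.tens x s)) d =
    (\<Oplus>\<^bsub>R\<^esub>a\<in>A. coordinate (i, a) (B.tens x s) (d - a))"
proof -
  have closed: "\<theta> i x a \<in> carrier R" "s a \<in> carrier R" for a
    by (rule R.laurent_coeff_closed[OF functional_closed[OF i x]],
        rule R.novikov_coeff_closed[OF axis_subset_novikov[OF s]])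
  have "T.extend_functional (\<theta> i) (comparison (B.tens x s)) d = (\<theta> i x \<otimes>\<^bsub>N\<^esub> s) d"
    using x s by (simp add: comparison_tens T.extend_functional_tens[OF functional[OF i]] axis_subset_novikov)
  also have "\<dots> = (\<Oplus>\<^bsub>R\<^esub>a\<in>A. \<theta> i x a \<otimes>\<^bsub>R\<^esub> s (d - a))"
    using A closed by (intro R.novikov_mult_eq) auto
  also have "\<dots> = (\<Oplus>\<^bsub>R\<^esub>a\<in>A. coordinate (i, a) (B.tens x s) (d - a))"
    using i x s closed
    by (intro R.finsum_cong') (auto simp: coordinate_tens coefficient_def R.axis_series_simps
        laurent_const_eq_monomial R.monomial_mult)
  finally show ?thesis .
qed

lemma comparison_coeff:
  assumes i: "i \<in> I" and "b \<in> carrier B.MS"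
  shows "\<forall>\<^sub>F A in finite_subsets_at_top UNIV. \<forall>d.
    T.extend_functional (\<theta> i) (comparison b) d = (\<Oplus>\<^bsub>R\<^esub>a\<in>A. coordinate (i, a) b (d - a))"
  using assms(2)
proof (induction rule: B.tensor_induct)
  case (tens x s)
  then have "finite {a. \<theta> i x a \<noteq> \<zero>\<^bsub>R\<^esub>}"
    using functional_closed[OF i] by (simp add: R.laurent_carrier_iff)
  then have "\<forall>\<^sub>F A in finite_subsets_at_top UNIV. finite A \<and> {a. \<theta> i x a \<noteq> \<zero>\<^bsub>R\<^esub>} \<subseteq> A"
    by (auto simp: eventually_finite_subsets_at_top)
  then show ?case
    by eventually_elim (use comparison_coeff_tens[OF i] tens in simp)
next
  case (add U V)
  interpret comparison: abelian_group_hom B.MS T.MS comparison by (rule comparison_hom)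
  interpret functional: abelian_group_hom T.MS N "T.extend_functional (\<theta> i)"
    by (rule T.extend_functional_hom[OF functional[OF i]])
  have coordinate_add: "coordinate (i, a) (U \<oplus>\<^bsub>B.MS\<^esub> V) c =
      coordinate (i, a) U c \<oplus>\<^bsub>R\<^esub> coordinate (i, a) V c" for a c
    using B.functional_add[of "(i, a)" U V] i add.hyps by (simp add: R.axis_series_simps R.novikov_simps)
  from add.IH show ?case
  proof eventually_elim
    case (elim A)
    then have "T.extend_functional (\<theta> i) (comparison (U \<oplus>\<^bsub>B.MS\<^esub> V)) d =
        (\<Oplus>\<^bsub>R\<^esub>a\<in>A. coordinate (i, a) U (d - a)) \<oplus>\<^bsub>R\<^esub> (\<Oplus>\<^bsub>R\<^esub>a\<in>A. coordinate (i, a) V (d - a))" for d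
      using add.hyps by (simp add: R.novikov_simps)
    then show ?case
      using add.hyps i coordinate_coeff_closed by (simp add: coordinate_add R.finsum_addf Pi_def)
  qed
qed

definition project :: "'i \<times> (int ^ 'n) \<Rightarrow> 'i \<times> (int ^ 'n)" where
  "project p = (fst p, snd p - axis k (snd p $ k))"

lemma project_mem: "p \<in> I \<times> UNIV \<Longrightarrow> project p \<in> I \<times> UNIV"
  by (auto simp: project_def)

text \<open>
  \<open>transferred b p\<close> is the coordinate of \<open>b\<close> at \<open>p\<close> after replacing the power of \<open>X\<close> at \<open>p\<close> by one of \<open>x\<^sub>k\<close>.
\<close>

definition transferred :: "('m, int ^ 'n \<Rightarrow> 'a) tensor_elem \<Rightarrow> 'i \<times> (int ^ 'n) \<Rightarrow> int ^ 'n \<Rightarrow> 'a" where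
  "transferred b p = monomial R (axis k (snd p $ k)) \<one>\<^bsub>R\<^esub> \<otimes>\<^bsub>S\<^esub> coordinate p b"

lemma transferred_closed: "\<lbrakk>p \<in> I \<times> UNIV; b \<in> carrier B.MS\<rbrakk> \<Longrightarrow> transferred b p \<in> carrier S"
  by (simp add: transferred_def R.axis_monomial_axis_series B.functional_closed)

lemma transferred_coeff:
  assumes "i \<in> I" "b \<in> carrier B.MS" and project: "project (i, a) = (i, c)"
  shows "transferred b (i, a) (axis k l) = coordinate (i, a) b (c + axis k l - a)"
proof -
  have exponent: "c + axis k l - a = axis k l - axis k (a $ k)" using project by (auto simp: project_def)
  show ?thesis
    unfolding exponent using coordinate_coeff_closed[OF assms(1,2)]
    by (simp add: transferred_def R.axis_series_simps R.monomial_mult)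
qed

lemma coordinate_outside_fibre:
  assumes "i \<in> I" "b \<in> carrier B.MS" and c: "c $ k = 0" and "project (i, a) \<noteq> (i, c)"
  shows "coordinate (i, a) b (c + axis k l - a) = \<zero>\<^bsub>R\<^esub>"
proof (rule ccontr)
  assume nonzero: "coordinate (i, a) b (c + axis k l - a) \<noteq> \<zero>\<^bsub>R\<^esub>"
  have "(c + axis k l - a) $ j = 0" if "j \<noteq> k" for j
    using coordinate_outside_axis[OF assms(1,2) nonzero] that unfolding axis_eq_iff by blast
  then have "c $ j = (a - axis k (a $ k)) $ j" for j
    using c by (cases "j = k") (auto simp: axis_def)
  then show False using assms(4) by (simp add: project_def vec_eq_iff)
qed

lemma transferred_sum_eq_zero:
  assumes b: "b \<in> carrier B.MS" and kernel: "comparison b = \<zero>\<^bsub>T.MS\<^esub>"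
    and G: "finite G" "{p \<in> I \<times> UNIV. coordinate p b \<noteq> \<zero>\<^bsub>S\<^esub>} \<subseteq> G" "G \<subseteq> I \<times> UNIV"
    and q: "q \<in> project ` G"
  shows "(\<Oplus>\<^bsub>S\<^esub>p\<in>{p \<in> G. project p = q}. transferred b p) = \<zero>\<^bsub>S\<^esub>" (is "?s = _")
proof (rule R.axis_series_eqI)
  obtain i c where q_eq: "q = (i, c)" and i: "i \<in> I" and c: "c $ k = 0"
    using q G(3) by (auto simp: project_def)
  let ?G = "{p \<in> G. project p = q}" and ?A = "{a. (i, a) \<in> G \<and> project (i, a) = (i, c)}"
  have fibre: "?G = Pair i ` ?A" by (auto simp: image_iff project_def q_eq)
  have closed: "transferred b p \<in> carrier S" if "p \<in> ?G" for p
    using that G(3) b by (intro transferred_closed) auto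
  then show "?s \<in> carrier S" by (intro B.S.finsum_closed) auto
  show "\<zero>\<^bsub>S\<^esub> \<in> carrier S" by simp
  fix l
  note coeff_closed = coordinate_coeff_closed[OF i b] and coeff = transferred_coeff[OF i b]
  from comparison_coeff[OF i b] obtain A0 where A0: "finite A0"
    and large: "\<forall>A. finite A \<and> A0 \<subseteq> A \<longrightarrow> (\<forall>d.
      T.extend_functional (\<theta> i) (comparison b) d = (\<Oplus>\<^bsub>R\<^esub>a\<in>A. coordinate (i, a) b (d - a)))"
    unfolding eventually_finite_subsets_at_top by auto
  define A where "A = A0 \<union> snd ` G"
  have A: "finite A" "?A \<subseteq> A" using A0 G(1) by (auto simp: A_def rev_image_eqI)
  have outside: "coordinate (i, a) b (c + axis k l - a) = \<zero>\<^bsub>R\<^esub>" if "a \<notin> ?A" for a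
  proof (cases "(i, a) \<in> G")
    case True
    then show ?thesis using that by (intro coordinate_outside_fibre i b c) simp
  next
    case False
    then have "coordinate (i, a) b = \<zero>\<^bsub>S\<^esub>" using G(2) i by blast
    then show ?thesis by (simp add: R.axis_series_simps R.novikov_simps)
  qed
  have "?s (axis k l) = (\<Oplus>\<^bsub>R\<^esub>p\<in>?G. transferred b p (axis k l))"
    using closed by (intro abelian_group_hom.hom_finsum[OF R.axis_series_coeff_abelian_group_hom]) auto
  also have "\<dots> = (\<Oplus>\<^bsub>R\<^esub>a\<in>?A. transferred b (i, a) (axis k l))"
    unfolding fibre by (rule R.finsum_reindex) (auto simp: inj_on_def coeff coeff_closed)
  also have "\<dots> = (\<Oplus>\<^bsub>R\<^esub>a\<in>A. coordinate (i, a) b (c + axis k l - a))"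
    using A outside by (intro R.add.finprod_mono_neutral_cong_left) (auto simp: coeff coeff_closed)
  also have "\<dots> = T.extend_functional (\<theta> i) (comparison b) (c + axis k l)"
    using large[rule_format, of A "c + axis k l"] A(1) by (simp add: A_def)
  also have "\<dots> = \<zero>\<^bsub>R\<^esub>"
    unfolding kernel abelian_group_hom.hom_zero[OF T.extend_functional_hom[OF functional[OF i]]]
    by (simp add: R.novikov_simps)
  finally show "?s (axis k l) = \<zero>\<^bsub>S\<^esub> (axis k l)" by (simp add: R.axis_series_simps R.novikov_simps)
qed

lemma transferred_tensor_sum_eq_zero:
  assumes b: "b \<in> carrier B.MS" and kernel: "comparison b = \<zero>\<^bsub>T.MS\<^esub>"
    and G: "finite G" "{p \<in> I \<times> UNIV. coordinate p b \<noteq> \<zero>\<^bsub>S\<^esub>} \<subseteq> G" "G \<subseteq> I \<times> UNIV"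
  shows "(\<Oplus>\<^bsub>B.MS\<^esub>p\<in>G. B.tens (monomial_generator (project p)) (transferred b p)) = \<zero>\<^bsub>B.MS\<^esub>"
proof -
  let ?t = "\<lambda>q. B.tens (monomial_generator q)" and ?fibre = "\<lambda>q. {p \<in> G. project p = q}"
  have transferred: "transferred b p \<in> carrier S" if "p \<in> G" for p
    using that G(3) by (intro transferred_closed b) auto
  have closed: "?t (project p) (transferred b p) \<in> carrier B.MS" if "p \<in> G" for p
    using monomial_generator_closed[OF project_mem] transferred[OF that] that G(3)
    by (intro B.tens_closed) auto
  have fibre_sum: "(\<Oplus>\<^bsub>B.MS\<^esub>p\<in>?fibre q. ?t (project p) (transferred b p)) = \<zero>\<^bsub>B.MS\<^esub>"
    if "q \<in> project ` G" for q
  proof -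
    have q: "q \<in> I \<times> UNIV" using that G(3) project_mem by blast
    then interpret right: abelian_group_hom S B.MS "?t q"
      by (intro B.tens_right_hom) (simp add: monomial_generator_closed)
    have "(\<Oplus>\<^bsub>B.MS\<^esub>p\<in>?fibre q. ?t (project p) (transferred b p)) =
        (\<Oplus>\<^bsub>B.MS\<^esub>p\<in>?fibre q. ?t q (transferred b p))"
      using transferred by (intro B.MS.finsum_cong') auto
    also have "\<dots> = ?t q (\<Oplus>\<^bsub>S\<^esub>p\<in>?fibre q. transferred b p)"
      using transferred by (intro right.hom_finsum[symmetric]) auto
    also have "\<dots> = \<zero>\<^bsub>B.MS\<^esub>"
      unfolding transferred_sum_eq_zero[OF b kernel G that] by (rule right.hom_zero)
    finally show ?thesis .
  qed
  have "(\<Oplus>\<^bsub>B.MS\<^esub>q\<in>project ` G. \<Oplus>\<^bsub>B.MS\<^esub>p\<in>?fibre q. ?t (project p) (transferred b p)) = \<zero>\<^bsub>B.MS\<^esub>"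
    using fibre_sum by (rule B.MS.add.finprod_one_eqI)
  with B.MS.finsum_group[OF G(1) closed] show ?thesis by (rule trans)
qed

lemma kernel_comparison:
  assumes b: "b \<in> carrier B.MS" and kernel: "comparison b = \<zero>\<^bsub>T.MS\<^esub>"
  shows "b \<in> \<zeta> ` carrier B.MS"
proof -
  define G where "G = {p \<in> I \<times> UNIV. coordinate p b \<noteq> \<zero>\<^bsub>S\<^esub>}"
  have G: "finite G" "{p \<in> I \<times> UNIV. coordinate p b \<noteq> \<zero>\<^bsub>S\<^esub>} \<subseteq> G" "G \<subseteq> I \<times> UNIV"
    using B.finite_support[OF b] by (auto simp: G_def)
  have expansion: "(\<Oplus>\<^bsub>B.MS\<^esub>p\<in>G. B.tens (monomial_generator p) (coordinate p b)) = b"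
  proof -
    have "(\<Oplus>\<^bsub>B.MS\<^esub>p\<in>G. B.tens (monomial_generator p) (coordinate p b)) =
        (\<Oplus>\<^bsub>B.MS\<^esub>p\<in>G. coordinate p b \<odot>\<^bsub>B.MS\<^esub> B.tens (monomial_generator p) \<one>\<^bsub>S\<^esub>)"
      using G(3) monomial_generator_closed B.functional_closed[OF _ b]
      by (intro B.MS.finsum_cong') (auto simp: B.MS_smult_tens)
    then show ?thesis using B.expansion[OF b] by (simp only: G_def)
  qed
  have transfer: "B.tens (monomial_generator p) (coordinate p b) \<doteq>
      B.tens (monomial_generator (project p)) (transferred b p)" if "p \<in> G" for p
  proof -
    have p: "p \<in> I \<times> UNIV" using that G(3) by blast
    have "monomial_generator p = shift (axis k (snd p $ k)) (monomial_generator (project p))"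
      using p generator_closed by (auto simp: monomial_generator_def project_def shift_shift)
    with tens_axis_monomial_cong[OF monomial_generator_closed[OF project_mem[OF p]] B.functional_closed[OF p b]]
    show ?thesis by (simp only: transferred_def)
  qed
  have "b \<doteq> \<zero>\<^bsub>B.MS\<^esub>"
    using \<zeta>_cong_finsum[OF G(1), OF transfer, of "\<lambda>p. p"]
    unfolding expansion transferred_tensor_sum_eq_zero[OF b kernel G] by blast
  then show ?thesis by (auto simp: \<zeta>_cong_def)
qed

end

section \<open>Acyclicity over the Novikov ring\<close>

context laurent_module
begin

lemma perturbation_bij:
  fixes C :: "('a, 'c) module"
  assumes C: "fg_rmodule R C" "projective_rmodule R C"
    and f: "f \<in> rmod_hom R MR C" and g: "g \<in> rmod_hom R C MR"
  shows "bij_betw (\<lambda>b. XB b \<ominus>\<^bsub>B.MS\<^esub> B.var \<odot>\<^bsub>B.MS\<^esub> extend_map R S (laurent_const R) MR (\<lambda>x. g (f x)) b)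
    (carrier B.MS) (carrier B.MS)"
proof -
  obtain J :: "'c set" and \<theta> w where "dual_basis R C J \<theta> w" using projective_rmodule_dual_basis[OF C(2)] .
  then obtain I where "finite I" and basis: "dual_basis R C I \<theta> w"
    using dual_basis.finite_if_fg C(1) by blast
  interpret C: dual_basis R C I \<theta> w by (rule basis)
  interpret g: abelian_group_hom C MR g
    by (rule rmod_hom_abelian_group_hom[OF g C.M.right_module_axioms MR_right_module])
  interpret P: finite_rank_perturbation R k MR "shift (axis k 1)" "shift (axis k (- 1))" "\<lambda>x. g (f x)" I
    "\<lambda>i x. \<theta> i (f x)" "\<lambda>i. g (w i)"
  proof unfold_locales
    show "g (f x) = (\<Oplus>\<^bsub>MR\<^esub>i\<in>I. \<theta> i (f x) \<odot>\<^bsub>MR\<^esub> g (w i))" if "x \<in> carrier MR" for x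
    proof -
      have fx: "f x \<in> carrier C" by (rule rmod_hom_closed[OF f that])
      have "g (f x) = g (\<Oplus>\<^bsub>C\<^esub>i\<in>I. \<theta> i (f x) \<odot>\<^bsub>C\<^esub> w i)"
        using C.expansion_superset[OF fx \<open>finite I\<close>] by simp
      also have "\<dots> = (\<Oplus>\<^bsub>MR\<^esub>i\<in>I. g (\<theta> i (f x) \<odot>\<^bsub>C\<^esub> w i))"
        using fx by (intro g.hom_finsum) (auto simp: C.M.smult_closed C.functional_closed C.generator_closed)
      also have "\<dots> = (\<Oplus>\<^bsub>MR\<^esub>i\<in>I. \<theta> i (f x) \<odot>\<^bsub>MR\<^esub> g (w i))"
      proof (rule B.M.M.finsum_cong')
        show "(\<lambda>i. \<theta> i (f x) \<odot>\<^bsub>MR\<^esub> g (w i)) \<in> I \<rightarrow> carrier MR"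
          using fx by (intro Pi_I B.M.smult_closed C.functional_closed g.hom_closed C.generator_closed)
        show "g (\<theta> i (f x) \<odot>\<^bsub>C\<^esub> w i) = \<theta> i (f x) \<odot>\<^bsub>MR\<^esub> g (w i)" if "i \<in> I" for i
          using that fx by (intro rmod_hom_smult[OF g] C.functional_closed C.generator_closed)
      qed simp
      finally show ?thesis .
    qed
  qed (use \<open>finite I\<close> C.generator_closed g.hom_closed in
      \<open>auto intro: shift_rmod_hom rmod_hom_comp[OF g f] rmod_hom_comp[OF C.functional f]
        simp: shift_shift shift_zero axis_add\<close>)
  show ?thesis by (rule P.perturbation_bij)
qed

lemma projective_laurent_dual_basis:
  assumes "projective_rmodule L M"
  obtains X :: "'m set" and \<theta> e where "laurent_dual_basis R M X \<theta> e"
  using projective_rmodule_dual_basis[OF assms]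
  by (metis laurent_dual_basis.intro laurent_module_axioms)

lemma projective_\<zeta>_inj: "projective_rmodule L M \<Longrightarrow> inj_on \<zeta> (carrier B.MS)"
  by (elim projective_laurent_dual_basis) (rule laurent_dual_basis.\<zeta>_inj)

lemma projective_kernel_comparison:
  "\<lbrakk>projective_rmodule L M; b \<in> carrier B.MS; comparison b = \<zero>\<^bsub>T.MS\<^esub>\<rbrakk> \<Longrightarrow> b \<in> \<zeta> ` carrier B.MS"
  by (elim projective_laurent_dual_basis) (rule laurent_dual_basis.kernel_comparison)

end

locale laurent_complex = R: ring R + D: cochain "laurent_ring R" D
  for R :: "('a, 'r) ring_scheme" and D :: "(int ^ 'n::finite \<Rightarrow> 'a, 'm) mod_complex" +
  fixes k :: 'n
begin

abbreviation "L \<equiv> laurent_ring R :: (int ^ 'n \<Rightarrow> 'a) ring"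
abbreviation "N \<equiv> novikov_ring R :: (int ^ 'n \<Rightarrow> 'a) ring"
abbreviation "S \<equiv> axis_series_ring R k"
abbreviation "DR \<equiv> restrict_complex (laurent_const R) D"
abbreviation "B \<equiv> extend_complex R S (laurent_const R) DR"
abbreviation "T \<equiv> novikov_complex R D"

lemma T_eq: "T = extend_complex L N (\<lambda>f. f) D"
  by (simp add: novikov_complex_def)

sublocale M: laurent_module R "obj D j" k for j
  by (intro laurent_module.intro R.ring_axioms tensor.intro R.novikov_ring D.obj_module
      tensor_axioms.intro R.laurent_inclusion_ring_hom)

sublocale B: extension R S "laurent_const R"
  by (rule extension.intro) (rule R.axis_series_ring, rule R.laurent_const_axis_series_ring_hom)

sublocale T: extension L N "\<lambda>f. f"
  by (rule extension.intro) (rule R.novikov_ring, rule R.laurent_inclusion_ring_hom)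

lemma DR_complex: "cochain_complex R DR"
  by (rule restrict_complex_cochain_complex[OF R.ring_axioms R.laurent_const_ring_hom D.complex])

sublocale DR: cochain R DR
  by (rule cochain.intro) (rule DR_complex)

sublocale BC: cochain S B
  by (rule cochain.intro) (rule B.extend_complex_cochain_complex[OF DR_complex])

lemma T_complex: "cochain_complex N T"
  unfolding T_eq by (rule T.extend_complex_cochain_complex[OF D.complex])

subsection \<open>The comparison map\<close>

lemma comparison_differential:
  assumes "b \<in> carrier (M.B.MS j)"
  shows "M.comparison (j + 1) (differential B j b) = differential T j (M.comparison j b)"
  using assms
proof (induction rule: M.B.tensor_induct)
  case (tens x s)
  note dB = DR.obj_module DR.obj_module DR.differential_hom
    and dT = D.obj_module D.obj_module D.differential_hom
  show ?case
    using tens D.differential_closed B.extend_map_tens[OF dB, of x j s] T.extend_map_tens[OF dT, of x j s]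
    by (simp add: T_eq M.comparison_tens M.axis_subset_novikov)
next
  case (add U V)
  interpret dB: abelian_group_hom "M.B.MS j" "M.B.MS (j + 1)" "differential B j"
    using BC.differential_abelian_group_hom[of j] by simp
  interpret dT: abelian_group_hom "M.T.MS j" "M.T.MS (j + 1)" "differential T j"
    using cochain.differential_abelian_group_hom[OF cochain.intro[OF T_complex], of j] by (simp add: T_eq)
  note comparison_add = abelian_group_hom.hom_add[OF M.comparison_hom]
    and comparison_closed = abelian_group_hom.hom_closed[OF M.comparison_hom]
  show ?case
    using add by (simp only: comparison_add comparison_closed dB.hom_add dB.hom_closed dT.hom_add)
qed

lemma image_comparison_subcomplex:
  "subcomplex L (restrict_complex (\<lambda>f. f) T) (\<lambda>j. M.comparison j ` carrier (M.B.MS j))"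
  unfolding subcomplex_def
proof (intro conjI allI)
  show "submodule (M.comparison j ` carrier (M.B.MS j)) L (obj (restrict_complex (\<lambda>f. f) T) j)" for j
    using M.comparison_image_submodule[of j] by (simp add: T_eq restrict_scalars_id)
  show "differential (restrict_complex (\<lambda>f. f) T) j ` M.comparison j ` carrier (M.B.MS j)
      \<subseteq> M.comparison (j + 1) ` carrier (M.B.MS (j + 1))" for j
    using BC.differential_closed[of _ j] by (auto simp flip: comparison_differential)
qed

subsection \<open>The perturbed difference of the two variables\<close>

definition perturbation ::
  "(int \<Rightarrow> ('m, int ^ 'n \<Rightarrow> 'a) tensor_elem \<Rightarrow> ('m, int ^ 'n \<Rightarrow> 'a) tensor_elem) \<Rightarrow>
   int \<Rightarrow> ('m, int ^ 'n \<Rightarrow> 'a) tensor_elem \<Rightarrow> ('m, int ^ 'n \<Rightarrow> 'a) tensor_elem" where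
  "perturbation h j b = M.XB j b \<ominus>\<^bsub>obj B j\<^esub> M.B.var \<odot>\<^bsub>obj B j\<^esub> h j b"

lemma \<zeta>_eq_perturbation: "M.\<zeta> j b = perturbation (\<lambda>j b. b) j b"
  by (simp add: M.\<zeta>_def perturbation_def)

lemma X_cochain_map: "cochain_map R DR DR (\<lambda>j. M.shift j (axis k 1))"
  unfolding cochain_map_def
  using M.shift_rmod_hom rmod_hom_smult[OF D.differential_hom] by simp

lemma XB_cochain_map: "cochain_map S B B M.XB"
  using B.extend_cochain_map[OF DR_complex DR_complex X_cochain_map] by simp

lemma var_rmod_hom: "(\<lambda>b. M.B.var \<odot>\<^bsub>obj B j\<^esub> b) \<in> rmod_hom S (obj B j) (obj B j)"
  using M.B.var_smult_rmod_hom[of j] by simp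

lemma perturbation_cochain_map:
  assumes h: "cochain_map S B B h"
  shows "cochain_map S B B (perturbation h)"
  unfolding cochain_map_def
proof (intro conjI allI ballI)
  fix j
  show "perturbation h j \<in> rmod_hom S (obj B j) (obj B j)"
    unfolding perturbation_def
    by (rule rmod_hom_minus[OF BC.obj_module cochain_map_hom[OF XB_cochain_map]
          rmod_hom_comp[OF var_rmod_hom cochain_map_hom[OF h]]])
  fix b assume b: "b \<in> carrier (obj B j)"
  interpret Bj: right_module S "obj B j" by (rule BC.obj_module)
  have closed: "M.XB j b \<in> carrier (obj B j)" "h j b \<in> carrier (obj B j)"
    by (rule rmod_hom_closed[OF cochain_map_hom b], fact XB_cochain_map h)+
  have "differential B j (perturbation h j b) =
      differential B j (M.XB j b) \<ominus>\<^bsub>obj B (j + 1)\<^esub> M.B.var \<odot>\<^bsub>obj B (j + 1)\<^esub> differential B j (h j b)"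
    unfolding perturbation_def
    using closed Bj.smult_closed[of "M.B.var"]
    by (simp only: abelian_group_hom.hom_minus[OF BC.differential_abelian_group_hom]
        rmod_hom_smult[OF BC.differential_hom] M.B.var_closed)
  then show "perturbation h (j + 1) (differential B j b) = differential B j (perturbation h j b)"
    by (simp only: perturbation_def cochain_map_commute[OF XB_cochain_map b] cochain_map_commute[OF h b])
qed

lemma perturbation_homotopic:
  assumes h: "cochain_map S B B h" and h': "cochain_map S B B h'" and "cochain_homotopic S B B h h'"
  shows "cochain_homotopic S B B (perturbation h') (perturbation h)"
proof -
  obtain s where s: "\<And>j. s j \<in> rmod_hom S (obj B j) (obj B (j - 1))"
    and s_eq: "\<And>j b. b \<in> carrier (obj B j) \<Longrightarrow> h j b \<ominus>\<^bsub>obj B j\<^esub> h' j b =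
      differential B (j - 1) (s j b) \<oplus>\<^bsub>obj B j\<^esub> s (j + 1) (differential B j b)"
    using assms(3) unfolding cochain_homotopic_def by blast
  let ?s = "\<lambda>j b. M.B.var \<odot>\<^bsub>obj B (j - 1)\<^esub> s j b"
  have "perturbation h' j b \<ominus>\<^bsub>obj B j\<^esub> perturbation h j b =
      differential B (j - 1) (?s j b) \<oplus>\<^bsub>obj B j\<^esub> ?s (j + 1) (differential B j b)"
    if b: "b \<in> carrier (obj B j)" for j b
  proof -
    interpret Bj: right_module S "obj B j" by (rule BC.obj_module)
    have sb: "s j b \<in> carrier (obj B (j - 1))" by (rule rmod_hom_closed[OF s b])
    have sdb: "s (j + 1) (differential B j b) \<in> carrier (obj B j)"
      using rmod_hom_closed[OF s BC.differential_closed[OF b]] by simp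
    have closed: "M.XB j b \<in> carrier (obj B j)" "h j b \<in> carrier (obj B j)" "h' j b \<in> carrier (obj B j)"
      by (rule rmod_hom_closed[OF cochain_map_hom b], fact XB_cochain_map h h')+
    have "perturbation h' j b \<ominus>\<^bsub>obj B j\<^esub> perturbation h j b =
        M.B.var \<odot>\<^bsub>obj B j\<^esub> h j b \<ominus>\<^bsub>obj B j\<^esub> M.B.var \<odot>\<^bsub>obj B j\<^esub> h' j b"
      unfolding perturbation_def by (intro Bj.M.minus_diff_minus Bj.smult_closed closed M.B.var_closed)
    also have "\<dots> = M.B.var \<odot>\<^bsub>obj B j\<^esub> (h j b \<ominus>\<^bsub>obj B j\<^esub> h' j b)"
      by (rule Bj.smult_minus[OF M.B.var_closed closed(2,3), symmetric])
    also have "\<dots> = M.B.var \<odot>\<^bsub>obj B j\<^esub> differential B (j - 1) (s j b) \<oplus>\<^bsub>obj B j\<^esub>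
        M.B.var \<odot>\<^bsub>obj B j\<^esub> s (j + 1) (differential B j b)"
      unfolding s_eq[OF b] by (rule Bj.smult_r_distr[OF M.B.var_closed BC.differential_closed_pred[OF sb] sdb])
    also have "M.B.var \<odot>\<^bsub>obj B j\<^esub> differential B (j - 1) (s j b) = differential B (j - 1) (?s j b)"
      by (rule rmod_hom_smult[OF BC.differential_hom_pred M.B.var_closed sb, symmetric])
    finally show ?thesis by simp
  qed
  moreover have "?s j \<in> rmod_hom S (obj B j) (obj B (j - 1))" for j
    by (rule rmod_hom_comp[OF var_rmod_hom s])
  ultimately show ?thesis unfolding cochain_homotopic_def by (intro exI[of _ ?s]) blast
qed

lemma extend_map_homotopic_id:
  assumes e: "cochain_map R DR DR e" and homotopic: "cochain_homotopic R DR DR e (\<lambda>j x. x)"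
  shows "cochain_homotopic S B B (\<lambda>j. extend_map R S (laurent_const R) (obj DR j) (e j)) (\<lambda>j b. b)"
  using B.extend_cochain_homotopic[OF DR_complex DR_complex e cochain_map_id homotopic]
    B.extend_map_id[OF DR.obj_module]
  by (simp add: cochain_homotopic_def)

lemma \<zeta>_homotopic_to_bij:
  assumes "finitely_dominated TYPE('c) R D"
  obtains g where "homotopic_to_bij S B M.\<zeta> g"
proof -
  obtain C :: "('a, 'c) mod_complex" and f g where
    C: "\<And>j. fg_rmodule R (obj C j)" "\<And>j. projective_rmodule R (obj C j)"
    and f: "cochain_map R DR C f" and g: "cochain_map R C DR g"
    and "cochain_homotopic R DR DR (\<lambda>j. g j \<circ> f j) (\<lambda>j. id)"
    using assms unfolding finitely_dominated_def homotopy_equivalent_def by blast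
  then have homotopic: "cochain_homotopic R DR DR (\<lambda>j x. g j (f j x)) (\<lambda>j x. x)"
    by (simp add: comp_def id_def)
  note e = cochain_map_comp[OF g f]
  let ?eB = "\<lambda>j. extend_map R S (laurent_const R) (obj DR j) (\<lambda>x. g j (f j x))"
  have eB: "cochain_map S B B ?eB"
    by (rule B.extend_cochain_map[OF DR_complex DR_complex e])
  have "bij_betw (perturbation ?eB j) (carrier (obj B j)) (carrier (obj B j))" for j
    using M.perturbation_bij[OF C(1)[of j] C(2)[of j], of "f j" j "g j"]
      cochain_map_hom[OF f, of j] cochain_map_hom[OF g, of j]
    by (simp add: perturbation_def[abs_def])
  then have "homotopic_to_bij S B (perturbation (\<lambda>j b. b)) (perturbation ?eB)"
    using perturbation_homotopic[OF eB cochain_map_id extend_map_homotopic_id[OF e homotopic]]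
    by unfold_locales (rule perturbation_cochain_map cochain_map_id eB | assumption)+
  then show thesis
    by (intro that) (simp add: \<zeta>_eq_perturbation[abs_def])
qed

lemma image_comparison_acyclic:
  assumes proj: "\<And>j. projective_rmodule L (obj D j)" and "finitely_dominated TYPE('c) R D"
    and z: "z \<in> M.comparison j ` carrier (M.B.MS j)" "differential T j z = \<zero>\<^bsub>obj T (j + 1)\<^esub>"
  shows "z \<in> differential T (j - 1) ` M.comparison (j - 1) ` carrier (M.B.MS (j - 1))"
proof -
  obtain g where "homotopic_to_bij S B M.\<zeta> g" by (rule \<zeta>_homotopic_to_bij[OF assms(2)])
  then interpret homotopic_to_bij S B M.\<zeta> g .
  interpret comparison: abelian_group_hom "M.B.MS j" "M.T.MS j" "M.comparison j"
    by (rule M.comparison_hom)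
  obtain b where b: "b \<in> carrier (M.B.MS j)" "z = M.comparison j b" using z(1) by blast
  have "M.comparison (j + 1) (differential B j b) = \<zero>\<^bsub>M.T.MS (j + 1)\<^esub>"
    using comparison_differential[OF b(1)] z(2) b(2) by (simp add: T_eq)
  then have "differential B j b \<in> M.\<zeta> (j + 1) ` carrier (obj B (j + 1))"
    using M.projective_kernel_comparison[OF proj] BC.differential_closed[of b j] b(1) by simp
  then obtain v w where v: "v \<in> carrier (M.B.MS j)" and w: "w \<in> carrier (M.B.MS (j - 1))"
    and b_eq: "b = M.\<zeta> j v \<oplus>\<^bsub>M.B.MS j\<^esub> differential B (j - 1) w"
    using cokernel_acyclic[of j b] M.projective_\<zeta>_inj[OF proj] b(1) by auto
  have dw: "differential B (j - 1) w \<in> carrier (M.B.MS j)"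
    using BC.differential_closed_pred[of w j] w by simp
  have "z = M.comparison j (differential B (j - 1) w)"
    unfolding b(2) b_eq using v dw by (simp add: M.comparison_\<zeta>)
  also have "\<dots> = differential T (j - 1) (M.comparison (j - 1) w)"
    using comparison_differential[OF w] by simp
  finally show ?thesis using w by blast
qed

lemma unit_cochain_map:
  "cochain_map L D (restrict_complex (\<lambda>f. f) T) (\<lambda>j x. T.tens (obj D j) x \<one>\<^bsub>N\<^esub>)"
  unfolding cochain_map_def
proof (intro conjI allI ballI)
  show "(\<lambda>x. T.tens (obj D j) x \<one>\<^bsub>N\<^esub>) \<in> rmod_hom L (obj D j) (obj (restrict_complex (\<lambda>f. f) T) j)" for j
    using M.T.tens_one_rmod_hom[of j] by (simp add: T_eq)
  show "T.tens (obj D (j + 1)) (differential D j x) \<one>\<^bsub>N\<^esub> =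
      differential (restrict_complex (\<lambda>f. f) T) j (T.tens (obj D j) x \<one>\<^bsub>N\<^esub>)"
    if "x \<in> carrier (obj D j)" for j x
    using T.extend_map_tens[OF D.obj_module D.obj_module D.differential_hom that] by (simp add: T_eq)
qed

theorem contractible_novikov_complex:
  assumes "bounded_complex D" and proj: "\<And>j. projective_rmodule L (obj D j)"
    and dominated: "finitely_dominated TYPE('c) R D"
  shows "contractible_complex N T"
  unfolding T_eq
proof (rule T.contractible_extend_complex[OF D.complex], fold T_eq)
  obtain a c where "\<And>j. j < a \<or> c < j \<Longrightarrow> carrier (obj D j) = {\<zero>\<^bsub>obj D j\<^esub>}"
    using assms(1) unfolding bounded_complex_def by blast
  then have bounded: "carrier (obj D j) = {\<zero>\<^bsub>obj D j\<^esub>}" if "c + 1 \<le> j" for j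
    using that by simp
  have unit_mem: "T.tens (obj D j) x \<one>\<^bsub>N\<^esub> \<in> M.comparison j ` carrier (M.B.MS j)"
    if "x \<in> carrier (obj D j)" for j x
  proof (rule image_eqI)
    show "T.tens (obj D j) x \<one>\<^bsub>N\<^esub> = M.comparison j (M.B.tens j x \<one>\<^bsub>S\<^esub>)"
      using M.comparison_tens[OF that M.B.S.one_closed] by (simp add: R.axis_series_simps)
  qed (use that in simp)
  have "cochain_homotopic L D (restrict_complex (\<lambda>f. f) T)
      (\<lambda>j x. T.tens (obj D j) x \<one>\<^bsub>N\<^esub>) (\<lambda>j x. \<zero>\<^bsub>obj (restrict_complex (\<lambda>f. f) T) j\<^esub>)"
    by (rule projective_to_acyclic_subcomplex_null_homotopic[OF D.complex bounded proj _
          image_comparison_subcomplex _ unit_cochain_map unit_mem])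
      (use image_comparison_acyclic[OF proj dominated]
        restrict_complex_cochain_complex[OF M.T.M.R.ring_axioms R.laurent_inclusion_ring_hom T_complex]
        in \<open>simp_all\<close>)
  then show "cochain_homotopic L D (restrict_complex (\<lambda>f. f) T)
      (\<lambda>j x. T.tens (obj D j) x \<one>\<^bsub>N\<^esub>) (\<lambda>j x. \<zero>\<^bsub>extend_scalars L N (\<lambda>f. f) (obj D j)\<^esub>)"
    by (simp add: T_eq)
qed

end

theorem mainTheorem2:
  fixes R :: "('a, 'r) ring_scheme"
    and D :: "(int ^ 'n::finite \<Rightarrow> 'a, 'm) mod_complex"
  assumes "ring R"
    and "cochain_complex (laurent_ring R) D"
    and "bounded_complex D"
    and "\<forall>k. projective_rmodule (laurent_ring R) (obj D k)"
    and "finitely_dominated TYPE('c) R D"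
  shows "acyclic_complex (novikov_complex R D) \<and>
         contractible_complex (novikov_ring R) (novikov_complex R D)"
proof
  interpret laurent_complex R D
    by (intro laurent_complex.intro cochain.intro assms(1,2))
  show contractible: "contractible_complex (novikov_ring R) (novikov_complex R D)"
    by (rule contractible_novikov_complex[OF assms(3) spec[OF assms(4)] assms(5)])
  show "acyclic_complex (novikov_complex R D)"
    by (rule contractible_imp_acyclic[OF T_complex contractible])
qed

end
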